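(* Let $v$ be a finite place of $k$. Fix a square matrix $\Phi(t)\in\mathrm{Mat}_{\ell}(\overline{k}[t])$ and a vector $\psi(t)\in\mathrm{Mat}_{\ell\times 1}(\mathcal{E}_v)$ satisfying $\psi^{(-1)}=\Phi\psi$. Let $\gamma\in\overline{k}^\times\setminus\overline{\mathbb{F}}_q^\times$ be such that $\det\Phi(\gamma^{q^{-i}})\neq 0$ for all $i\in\mathbb{Z}_{>0}$. Then, for every $\rho\in\mathrm{Mat}_{1\times\ell}(\overline{k})$ such that $\rho\,\psi(\gamma)=0$, there exists $P(t)\in\mathrm{Mat}_{1\times\ell}(\overline{k}[t])$ such that $P(\gamma)=\rho$ and $P\psi=0$.
   Context: Let $\mathbb{F}_q$ be a finite field with $q$ elements, $A=\mathbb{F}_q[\theta]$, $k=\mathbb{F}_q(\theta)$. Let $v$ be a finite place of $k$, given by a monic irreducible $\varpi_v\in A$ of degree $\epsilon_v$, with $|\cdot|_v$ normalized so that $|\varpi_v|_v=q_v^{-1}$, $q_v=q^{\epsilon_v}$. Let $k_v$ be the completion of $k$ at $v$, $\overline{k_v}$ a fixed algebraic closure, and $\mathbb{C}_v$ the completion of $\overline{k_v}$. Let $\overline{k}$ be an algebraic closure of $k$, regarded as a subfield of $\mathbb{C}_v$ via a fixed embedding, and $\overline{\mathbb{F}}_q$ the algebraic closure of $\mathbb{F}_q$ in $\overline{k}$. The ring of $v$-adic entire series is $$\mathcal{E}_v=\Bigl\{\sum_{i\ge0}a_it^i\in\overline{k}[[t]] : \lim_{i\to\infty}|a_i|_v^{1/i}=0,\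 [k_v(a_0,a_1,\dots):k_v]<\infty\Bigr\}.$$ For $n\in\mathbb{Z}$ and $f=\sum a_it^i$ with $a_i\in\mathbb{C}_v$, the $n$-fold twist is $f^{(n)}=\sum a_i^{q^n}t^i$; it is applied entrywise to matrices. *)

theory Defs
  imports
    "HOL-Analysis.Analysis"
    "HOL-Computational_Algebra.Computational_Algebra"
    "HOL-Algebra.Generated_Fields"
    "HOL-Algebra.Algebraic_Closure_Type"
begin

unbundle no fps_syntax

text \<open>
  Throughout, \<open>F\<^sub>q\<close> is a type \<open>'a :: {field, finite}\<close>, so that \<open>q = CARD('a)\<close>,
  \<open>A = 'a poly\<close> and \<open>k = 'a poly fract\<close>; \<open>\<theta>\<close> is \<open>[:0, 1:]\<close>.
\<close>

definition place_ord :: "'a :: field poly \<Rightarrow> 'a poly fract \<Rightarrow> int" where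
  "place_ord \<pi> x = (THE n. \<exists>f g. \<not> \<pi> dvd f \<and> \<not> \<pi> dvd g \<and>
     x = to_fract \<pi> powi n * Fract f g)"

definition place_abs :: "'a :: {field, finite} poly \<Rightarrow> 'a poly fract \<Rightarrow> real" where
  "place_abs \<pi> x =
     (if x = 0 then 0 else real (CARD('a) ^ Polynomial.degree \<pi>) powi (- place_ord \<pi> x))"

lemma place_ord_unique:
  fixes \<pi> f g f' g' :: "'a :: field poly"
  assumes "prime_elem \<pi>"
    and ndvd: "\<not> \<pi> dvd f" "\<not> \<pi> dvd g" "\<not> \<pi> dvd f'" "\<not> \<pi> dvd g'"
    and eq: "to_fract \<pi> powi m * Fract f g = to_fract \<pi> powi n * Fract f' g'"
  shows "m \<le> n"
proof (rule ccontr)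
  assume "\<not> m \<le> n"
  then obtain k where k: "m = n + int k" "k > 0"
    by (metis linorder_not_le zless_iff_Suc_zadd zero_less_Suc)
  have nz: "\<pi> \<noteq> 0" "f \<noteq> 0" "g \<noteq> 0" "f' \<noteq> 0" "g' \<noteq> 0"
    using assms by auto
  then have P: "to_fract \<pi> \<noteq> 0"
    by simp
  have "to_fract \<pi> powi n * (to_fract \<pi> ^ k * Fract f g) = to_fract \<pi> powi n * Fract f' g'"
    using eq P by (simp add: k power_int_add mult.assoc)
  moreover have "to_fract (\<pi> ^ k) = to_fract \<pi> ^ k"
    by (induction k) simp_all
  ultimately have "to_fract (\<pi> ^ k) * Fract f g = Fract f' g'"
    using P by simp
  then have "\<pi> ^ k * f * g' = f' * g"
    using nz by (simp add: to_fract_def eq_fract)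
  moreover have "\<pi> dvd \<pi> ^ k * f * g'"
    using k by (simp add: dvd_power)
  ultimately show False
    using ndvd prime_elem_dvd_mult_iff[OF assms(1)] by metis
qed

lemma place_ord_eq:
  fixes \<pi> f g :: "'a :: field poly"
  assumes "Factorial_Ring.irreducible \<pi>" and "\<not> \<pi> dvd f" and "\<not> \<pi> dvd g"
  shows "place_ord \<pi> (to_fract \<pi> powi n * Fract f g) = n"
proof -
  have prime: "prime_elem \<pi>"
    using assms(1) by (rule field_poly_irreducible_imp_prime)
  show ?thesis
    unfolding place_ord_def
  proof (rule the_equality)
    fix m
    assume "\<exists>f' g'. \<not> \<pi> dvd f' \<and> \<not> \<pi> dvd g' \<and>
      to_fract \<pi> powi n * Fract f g = to_fract \<pi> powi m * Fract f' g'"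
    then obtain f' g' where fg: "\<not> \<pi> dvd f'" "\<not> \<pi> dvd g'"
      and eq: "to_fract \<pi> powi n * Fract f g = to_fract \<pi> powi m * Fract f' g'"
      by blast
    show "m = n"
      using place_ord_unique[OF prime assms(2,3) fg eq]
        place_ord_unique[OF prime fg assms(2,3) eq[symmetric]] by simp
  qed (use assms in blast)
qed

abbreviation ring_of :: "'c :: field set \<Rightarrow> 'c ring" where
  "ring_of K \<equiv> ring_of_type_algebra\<lparr>carrier := K\<rparr>"

text \<open>
  \<open>C\<^sub>v\<close> is a type \<open>'c\<close> which is a field and a complete metric space, its absolute value being
  the distance to 0. The map \<open>\<iota>\<close> is the embedding of \<open>k\<close> into \<open>C\<^sub>v\<close>. As \<open>C\<^sub>v\<close> is
  complete, the completion of \<open>k\<close> is the topological closure of the image of \<open>\<iota>\<close>.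
\<close>

definition vabs :: "'c :: {field, metric_space} \<Rightarrow> real" where
  "vabs x = dist x 0"

definition completed_base :: "('k \<Rightarrow> 'c :: {field, metric_space}) \<Rightarrow> 'c set" where
  "completed_base \<iota> = closure (range \<iota>)"

text \<open>
  The following conditions determine \<open>C\<^sub>v\<close>, up to an isometric isomorphism over \<open>k\<close>, as the
  completion of an algebraic closure \<open>Kvbar\<close> of \<open>k\<^sub>v\<close>; the absolute value of \<open>Kvbar\<close> is
  the only one that extends that of \<open>k\<^sub>v\<close>. The set \<open>Kbar\<close> is the image of the fixed
  embedding of an algebraic closure of \<open>k\<close>.
\<close>

locale finite_place =
  fixes \<pi> :: "'a :: {field, finite} poly"
    and \<iota> :: "'a poly fract \<Rightarrow> 'c :: {field, complete_space}"
    and Kvbar Kbar :: "'c set"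
  assumes irreducible: "Factorial_Ring.irreducible \<pi>"
    and monic: "Polynomial.lead_coeff \<pi> = 1"
    and dist_vabs: "dist (x :: 'c) y = vabs (x - y)"
    and vabs_mult: "vabs (x * y :: 'c) = vabs x * vabs y"
    and vabs_ultrametric: "vabs (x + y :: 'c) \<le> max (vabs x) (vabs y)"
    and embedding: "\<iota> \<in> ring_hom ring_of_type_algebra ring_of_type_algebra"
    and vabs_embedding: "vabs (\<iota> z) = place_abs \<pi> z"
    and Kvbar: "algebraic_closure (ring_of Kvbar) (completed_base \<iota>)"
    and Kvbar_dense: "closure Kvbar = UNIV"
    and Kbar: "algebraic_closure (ring_of Kbar) (range \<iota>)"

definition const_closure :: "('a :: field poly fract \<Rightarrow> 'c :: field) \<Rightarrow> 'c set \<Rightarrow> 'c set" where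
  "const_closure \<iota> Kbar =
     {x \<in> Kbar. (ring.algebraic ring_of_type_algebra over (range (\<lambda>c. \<iota> (to_fract [:c:])))) x}"

definition polys_over :: "'c :: field set \<Rightarrow> 'c poly set" where
  "polys_over K = {p. \<forall>i. Polynomial.coeff p i \<in> K}"

definition entire_series ::
  "('k \<Rightarrow> 'c :: {field, metric_space}) \<Rightarrow> 'c set \<Rightarrow> 'c fps set" where
  "entire_series \<iota> Kbar =
     {f. (\<forall>i. fps_nth f i \<in> Kbar) \<and>
         (\<lambda>i. root i (vabs (fps_nth f i))) \<longlonglongrightarrow> 0 \<and>
         ring.finite_dimension ring_of_type_algebra (completed_base \<iota>)
           (generate_field ring_of_type_algebra (completed_base \<iota> \<union> range (fps_nth f)))}"

definition series_eval :: "'c :: {field, metric_space} fps \<Rightarrow> 'c \<Rightarrow> 'c" where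
  "series_eval f x = (\<Sum>i. fps_nth f i * x ^ i)"

text \<open>
  \<open>frob q n x\<close> is \<open>x\<close> to the power \<open>q\<^sup>n\<close>. For negative \<open>n\<close> it is a root, which exists and is
  unique in the algebraically closed field \<open>C\<^sub>v\<close> whose
  characteristic divides \<open>q\<close>.
\<close>

definition frob :: "nat \<Rightarrow> int \<Rightarrow> 'c :: field \<Rightarrow> 'c" where
  "frob q n x = (if 0 \<le> n then x ^ (q ^ nat n) else (THE y. y ^ (q ^ nat (- n)) = x))"

definition twist :: "nat \<Rightarrow> int \<Rightarrow> 'c :: field fps \<Rightarrow> 'c fps" where
  "twist q n f = Abs_fps (\<lambda>i. frob q n (fps_nth f i))"

definition vec_twist :: "nat \<Rightarrow> int \<Rightarrow> 'c :: field fps ^ 'l \<Rightarrow> 'c fps ^ 'l" where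
  "vec_twist q n \<psi> = (\<chi> r. twist q n (\<psi> $ r))"

end

theory Submission
  imports Defs "HOL-Real_Asymp.Real_Asymp"
begin

text \<open>
  Write \<open>f\<^sup>(\<^sup>n\<^sup>)\<close> for the \<open>n\<close>-fold twist. Iterating the functional equation gives
  \<open>\<psi> = G\<^sub>m \<psi>\<^sup>(\<^sup>m\<^sup>)\<close> with polynomial matrices \<open>G\<^sub>m\<close>, so \<open>\<rho>\<psi>(\<gamma>) = 0\<close> yields a nonzero row \<open>w\<^sub>m = \<rho>G\<^sub>m(\<gamma>)\<close>
  that annihilates \<open>\<psi>\<^sup>(\<^sup>m\<^sup>)(\<gamma>)\<close>. Put \<open>s = 2N\<close>. A box principle provides a row \<open>Q \<noteq> 0\<close> of polynomials of
  degree less than \<open>(1 - 1/2l)N\<close> and of height \<open>O(q\<^sup>s)\<close> such that \<open>Q(\<gamma>^(q^j))\<close> is a multiple of the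
  \<open>j\<close>-fold twist of \<open>w\<close> at \<open>m = s - j\<close>, for \<open>0 \<le> j < N\<close>. Then \<open>H = Q\<psi>\<^sup>(\<^sup>s\<^sup>)\<close> vanishes at the \<open>N\<close> distinct points
  \<open>\<gamma>^(q^j)\<close>, and Schwarz's lemma on the disc of radius \<open>2\<close> to the power \<open>q\<^sup>s\<close> makes its lowest coefficient
  very small. On the other hand the twists of \<open>H\<close> are linearly dependent over the polynomials, which makes
  this coefficient a root of an additive polynomial of height \<open>O(q\<^sup>s)\<close>, and Liouville's inequality bounds it from below.
  For large \<open>N\<close> this forces \<open>H = 0\<close>. As \<open>Q\<close> has degree less than \<open>N\<close>, it is nonzero at some \<open>\<gamma>^(q^j)\<close>, and
  inverting \<open>G\<^sub>m\<close> and untwisting turns the relation \<open>Q\<psi>\<^sup>(\<^sup>s\<^sup>) = 0\<close> into the desired one.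

  Heights are replaced by a filtration \<open>R 0 \<subseteq> R 1 \<subseteq> \<dots>\<close> of a finitely generated ring by finite groups whose
  logarithmic sizes grow at most linearly; both the box principle and Liouville's inequality are pigeonhole
  arguments in it.
\<close>

subsection \<open>The absolute value and the \<open>q\<close>-power map\<close>

lemma CARD_field_gt_1: "1 < CARD('a :: {field, finite})"
proof -
  have "card {0, 1 :: 'a} \<le> CARD('a)"
    by (rule card_mono) auto
  then show ?thesis
    by simp
qed

lemma finite_field_power_CARD:
  fixes x :: "'a :: {field, finite}"
  shows "x ^ CARD('a) = x"
proof (cases "x = 0")
  case False
  let ?U = "UNIV - {0 :: 'a}"
  have "bij_betw ((*) x) ?U ?U"
    using False by (intro bij_betwI[of _ _ _ "\<lambda>y. y / x"]) auto
  then have "prod id ?U = prod ((*) x) ?U"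
    using prod.reindex_bij_betw[of "(*) x" ?U ?U id] by simp
  then have "prod id ?U = x ^ card ?U * prod id ?U"
    by (simp add: prod.distrib)
  then have "x ^ (CARD('a) - 1) = 1"
    by (simp add: card_Diff_singleton)
  moreover have "x ^ CARD('a) = x ^ (CARD('a) - 1) * x"
    by (rule power_minus_mult[symmetric]) simp
  ultimately show ?thesis
    by simp
qed (use finite_UNIV_card_ge_0[where 'a = 'a] in auto)

text \<open>The polynomial \<open>(X + 1)^q - X^q - 1\<close>, with \<open>q = CARD('a)\<close>, has
  degree below \<open>q\<close> but vanishes at all \<open>q\<close> elements of the field. It is
  therefore zero, and its coefficients are the binomials in question. This yields additivity of the
  \<open>q\<close>-power map without mentioning the characteristic.\<close>

lemma of_nat_CARD_choose_eq_0:
  assumes "0 < i" "i < CARD('a :: {field, finite})"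
  shows "of_nat (CARD('a) choose i) = (0 :: 'a)"
proof -
  define p :: "'a poly" where "p = (Polynomial.monom 1 1 + 1) ^ CARD('a) - Polynomial.monom 1 CARD('a) - 1"
  have p: "p = (\<Sum>k\<in>{1..<CARD('a)}. Polynomial.monom (of_nat (CARD('a) choose k)) k)"
  proof -
    have "(Polynomial.monom 1 1 + 1 :: 'a poly) ^ CARD('a) =
        (\<Sum>k\<le>CARD('a). Polynomial.monom (of_nat (CARD('a) choose k)) k)"
      by (subst binomial_ring, rule sum.cong)
        (auto simp: monom_power of_nat_monom mult_monom)
    also have "{..CARD('a)} = insert 0 (insert CARD('a) {1..<CARD('a)})"
      by auto
    finally show ?thesis
      by (simp add: p_def)
  qed
  have "poly p x = 0" for x
    by (simp add: p_def poly_monom finite_field_power_CARD)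
  then have "{x. poly p x = 0} = UNIV"
    by auto
  moreover have "Polynomial.degree p < CARD('a)"
    unfolding p using CARD_field_gt_1[where 'a='a]
    by (intro degree_sum_less) (auto intro: le_less_trans[OF degree_monom_le])
  ultimately have "p = 0"
    using card_poly_roots_bound[of p] by (auto simp: not_le[symmetric])
  then have "Polynomial.coeff p i = 0"
    by simp
  then show ?thesis
    using assms unfolding p Polynomial.coeff_sum by (simp add: if_distrib cong: if_cong)
qed

context finite_place
begin

lemma vabs_nonneg: "0 \<le> vabs (x :: 'c)"
  by (simp add: vabs_def)

lemma vabs_0 [simp]: "vabs (0 :: 'c) = 0"
  by (simp add: vabs_def)

lemma vabs_eq_0_iff [simp]: "vabs (x :: 'c) = 0 \<longleftrightarrow> x = 0"
  by (simp add: vabs_def)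

lemma vabs_pos: "x \<noteq> 0 \<Longrightarrow> 0 < vabs (x :: 'c)"
  by (simp add: vabs_def)

lemma vabs_1 [simp]: "vabs (1 :: 'c) = 1"
  using vabs_mult[of 1 1] by simp

lemma vabs_minus [simp]: "vabs (- x :: 'c) = vabs x"
  using dist_vabs[of 0 x] dist_vabs[of x 0] by (simp add: dist_commute)

lemma vabs_power [simp]: "vabs (x ^ n :: 'c) = vabs x ^ n"
  by (induction n) (simp_all add: vabs_mult)

lemma vabs_inverse: "vabs (inverse x :: 'c) = inverse (vabs x)"
proof (cases "x = 0")
  case False
  then have "vabs x * vabs (inverse x) = 1"
    by (simp flip: vabs_mult)
  then show ?thesis
    by (simp add: inverse_unique)
qed auto

lemma vabs_prod: "vabs (\<Prod>i\<in>A. f i :: 'c) = (\<Prod>i\<in>A. vabs (f i))"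
  by (induction A rule: infinite_finite_induct) (simp_all add: vabs_mult)

lemma vabs_diff_le: "vabs (x - y :: 'c) \<le> max (vabs x) (vabs y)"
  using vabs_ultrametric[of x "- y"] by simp

lemma vabs_add_le: "vabs x \<le> B \<Longrightarrow> vabs y \<le> B \<Longrightarrow> vabs (x + y :: 'c) \<le> B"
  using vabs_ultrametric[of x y] by simp

lemma vabs_sum_le:
  assumes "\<And>i. i \<in> A \<Longrightarrow> vabs (f i :: 'c) \<le> B" "0 \<le> B"
  shows "vabs (\<Sum>i\<in>A. f i) \<le> B"
  using assms
  by (induction A rule: infinite_finite_induct) (auto intro!: vabs_add_le)

definition base :: "'a poly \<Rightarrow> 'c" where
  "base p = \<iota> (to_fract p)"

lemma iota_simps:
  "\<iota> 1 = 1" "\<iota> (x + y) = \<iota> x + \<iota> y" "\<iota> (x * y) = \<iota> x * \<iota> y"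
  using ring_hom_one[OF embedding] ring_hom_add[OF embedding] ring_hom_mult[OF embedding]
  by (auto simp: ring_of_type_algebra_def)

lemma iota_0 [simp]: "\<iota> 0 = 0"
  using iota_simps(2)[of 0 0] by (metis add.right_neutral add_left_cancel)

lemma base_0 [simp]: "base 0 = 0"
  by (simp add: base_def)

lemma base_1 [simp]: "base 1 = 1"
  by (simp add: base_def iota_simps)

lemma base_add: "base (p + r) = base p + base r"
  by (simp add: base_def iota_simps)

lemma base_mult: "base (p * r) = base p * base r"
  by (simp add: base_def iota_simps)

lemma base_minus: "base (- p) = - base p"
  using base_add[of p "- p"] by (simp add: add_eq_0_iff)

lemma base_diff: "base (p - r) = base p - base r"
  using base_add[of p "- r"] base_minus by simp

lemma base_of_nat: "base (of_nat n) = of_nat n"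
  by (induction n) (simp_all add: base_add)

lemma base_eq_0_iff [simp]: "base p = 0 \<longleftrightarrow> p = 0"
proof
  assume "base p = 0"
  then have "place_abs \<pi> (to_fract p) = 0"
    by (metis base_def vabs_0 vabs_embedding)
  then show "p = 0"
    using CARD_field_gt_1[where 'a='a] by (auto simp: place_abs_def split: if_splits)
qed simp

lemma base_eq_iff: "base p = base r \<longleftrightarrow> p = r"
  by (metis base_diff base_eq_0_iff eq_iff_diff_eq_0)

text \<open>Splitting off the powers of \<open>\<pi>\<close>, \<open>p = \<pi>^n f\<close>, gives
  \<open>q ^ (- n * degree \<pi>)\<close> as absolute value, and \<open>n * degree \<pi>\<close> is
  at most the degree of \<open>p\<close>. The lower bound is Liouville's inequality over
  \<open>A\<close> itself, from which the general one is derived.\<close>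

lemma vabs_base:
  assumes "p \<noteq> 0"
  shows "vabs (base p) \<le> 1" "1 / real CARD('a) ^ Polynomial.degree p \<le> vabs (base p)"
proof -
  have unit: "\<not> is_unit \<pi>"
    using irreducible by (rule irreducible_not_unit)
  have "\<exists>n f. p = \<pi> ^ n * f \<and> \<not> \<pi> dvd f"
    using assms
  proof (induction "Polynomial.degree p" arbitrary: p rule: less_induct)
    case less
    show ?case
    proof (cases "\<pi> dvd p")
      case True
      then obtain r where r: "p = \<pi> * r"
        by blast
      have "Polynomial.degree \<pi> > 0"
        using unit is_unit_iff_degree[of \<pi>] less.prems r by fastforce
      then have "Polynomial.degree r < Polynomial.degree p"
        using less.prems by (simp add: r degree_mult_eq)
      then obtain n f where "r = \<pi> ^ n * f" "\<not> \<pi> dvd f"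
        using less r by (metis mult_zero_right)
      then have "p = \<pi> ^ Suc n * f \<and> \<not> \<pi> dvd f"
        by (simp add: r mult.assoc)
      then show ?thesis
        by blast
    next
      case False
      then show ?thesis
        by (intro exI[of _ 0] exI[of _ p]) simp
    qed
  qed
  then obtain n f where f: "p = \<pi> ^ n * f" "\<not> \<pi> dvd f"
    by blast
  have pow: "to_fract (\<pi> ^ n) = to_fract \<pi> powi int n"
    by (induction n) (simp_all add: power_int_add)
  have "place_ord \<pi> (to_fract p) = place_ord \<pi> (to_fract \<pi> powi int n * Fract f 1)"
    by (simp add: f(1) pow flip: to_fract_def)
  also have "\<dots> = int n"
    by (rule place_ord_eq[OF irreducible f(2) unit])
  finally have "vabs (base p) = 1 / real (CARD('a) ^ Polynomial.degree \<pi>) ^ n"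
    using assms by (simp add: base_def vabs_embedding place_abs_def power_int_minus divide_inverse)
  then have v: "vabs (base p) = 1 / real CARD('a) ^ (Polynomial.degree \<pi> * n)"
    by (simp add: power_mult)
  have q: "1 \<le> real CARD('a)"
    using CARD_field_gt_1[where 'a='a] by simp
  show "vabs (base p) \<le> 1"
    using q unfolding v by simp
  have "Polynomial.degree p = Polynomial.degree \<pi> * n + Polynomial.degree f"
    using assms monic by (auto simp: f(1) degree_mult_eq degree_power_eq mult.commute)
  then have "real CARD('a) ^ (Polynomial.degree \<pi> * n) \<le> real CARD('a) ^ Polynomial.degree p"
    using q by (intro power_increasing) auto
  then show "1 / real CARD('a) ^ Polynomial.degree p \<le> vabs (base p)"
    unfolding v using q by (intro divide_left_mono) auto
qed

end

locale finite_place_card = finite_place \<pi> \<iota> Kvbar Kbar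
  for \<pi> :: "'a :: {field, finite} poly" and \<iota> :: "'a poly fract \<Rightarrow> 'c :: {field, complete_space}"
    and Kvbar Kbar :: "'c set" +
  fixes q :: nat
  assumes q_eq: "q = CARD('a)"
begin

lemma q_gt_1: "1 < q"
  unfolding q_eq by (rule CARD_field_gt_1)

lemma power_q_add: "(x + y :: 'c) ^ q = x ^ q + y ^ q"
proof -
  have "(x + y) ^ q = (\<Sum>k\<le>q. of_nat (q choose k) * x ^ k * y ^ (q - k))"
    by (rule binomial_ring)
  also have "\<dots> = (\<Sum>k\<in>{0,q}. of_nat (q choose k) * x ^ k * y ^ (q - k))"
  proof (intro sum.mono_neutral_right ballI)
    fix k assume "k \<in> {..q} - {0, q}"
    then have "of_nat (q choose k) = (0 :: 'a)"
      unfolding q_eq by (intro of_nat_CARD_choose_eq_0) auto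
    then have "(of_nat (q choose k) :: 'a poly) = 0"
      by (simp add: of_nat_poly)
    then have "of_nat (q choose k) = (0 :: 'c)"
      by (metis base_0 base_of_nat)
    then show "of_nat (q choose k) * x ^ k * y ^ (q - k) = 0"
      by simp
  qed auto
  finally show ?thesis
    using q_gt_1 by simp
qed

text \<open>The non-negative part of \<open>frob\<close>: an injective ring endomorphism defined on
  all of \<open>'c\<close>. Roots are extracted separately, and only of elements of
  \<open>Kbar\<close>.\<close>

definition fr :: "nat \<Rightarrow> 'c \<Rightarrow> 'c" where
  "fr n x = x ^ (q ^ n)"

lemma fr_0 [simp]: "fr n 0 = 0" and fr_1 [simp]: "fr n 1 = 1" and fr_id [simp]: "fr 0 x = x"
  using q_gt_1 by (auto simp: fr_def)

lemma fr_mult: "fr n (x * y) = fr n x * fr n y"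
  by (simp add: fr_def power_mult_distrib)

lemma fr_fr: "fr m (fr n x) = fr (m + n) x"
  by (simp add: fr_def power_add mult.commute flip: power_mult)

lemma fr_power: "fr n (x ^ i) = fr n x ^ i"
  by (simp add: fr_def mult.commute flip: power_mult)

lemma fr_add: "fr n (x + y) = fr n x + fr n y"
proof (induction n)
  case (Suc n)
  have "fr (Suc n) z = fr n z ^ q" for z
    by (simp add: fr_def mult.commute flip: power_mult)
  then show ?case
    using Suc by (simp add: power_q_add)
qed auto

lemma fr_minus: "fr n (- x) = - fr n x"
  using fr_add[of n x "- x"] by (simp add: add_eq_0_iff)

lemma fr_diff: "fr n (x - y) = fr n x - fr n y"
  using fr_add[of n x "- y"] by (simp add: fr_minus)

lemma fr_sum: "fr n (\<Sum>i\<in>A. f i) = (\<Sum>i\<in>A. fr n (f i))"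
  by (induction A rule: infinite_finite_induct) (simp_all add: fr_add)

lemma fr_eq_0_iff [simp]: "fr n x = 0 \<longleftrightarrow> x = 0"
  using q_gt_1 by (simp add: fr_def)

lemma fr_eq_iff [simp]: "fr n x = fr n y \<longleftrightarrow> x = y"
  by (metis fr_diff fr_eq_0_iff eq_iff_diff_eq_0)

lemma vabs_fr: "vabs (fr n x) = vabs x ^ (q ^ n)"
  by (simp add: fr_def)

end

subsection \<open>Zeros of power series\<close>

context finite_place_card
begin

definition psum :: "'c fps \<Rightarrow> 'c \<Rightarrow> nat \<Rightarrow> 'c" where
  "psum f z n = (\<Sum>i<n. fps_nth f i * z ^ i)"

definition nullseq :: "(nat \<Rightarrow> 'c) \<Rightarrow> bool" where
  "nullseq a \<longleftrightarrow> (\<lambda>n. vabs (a n)) \<longlonglongrightarrow> 0"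

text \<open>Speaking of partial sums instead of a value lets relations be added and twisted without
  first proving that the series involved converge.\<close>

definition vanishes :: "'c fps \<Rightarrow> 'c \<Rightarrow> bool" where
  "vanishes f z \<longleftrightarrow> nullseq (psum f z)"

text \<open>This says that the Gauss norm of radius \<open>T\<close> is at most
  \<open>B\<close>.\<close>

definition bounded_at :: "'c fps \<Rightarrow> real \<Rightarrow> real \<Rightarrow> bool" where
  "bounded_at f T B \<longleftrightarrow> (\<forall>i. vabs (fps_nth f i) * T ^ i \<le> B)"

lemma nullseq_0: "nullseq (\<lambda>n. 0)"
  by (simp add: nullseq_def)

lemma nullseq_add:
  assumes "nullseq a" "nullseq b"
  shows "nullseq (\<lambda>n. a n + b n)"
proof -
  have *: "(\<lambda>n. max (vabs (a n)) (vabs (b n))) \<longlonglongrightarrow> max 0 0"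
    using assms unfolding nullseq_def by (rule tendsto_max)
  show ?thesis
    unfolding nullseq_def
    by (rule tendsto_sandwich[of "\<lambda>_. 0" _ _ "\<lambda>n. max (vabs (a n)) (vabs (b n))"])
      (use * in \<open>auto simp: vabs_nonneg vabs_ultrametric\<close>)
qed

lemma nullseq_mult: "nullseq a \<Longrightarrow> nullseq (\<lambda>n. c * a n)"
  unfolding nullseq_def vabs_mult using tendsto_mult_left[of "\<lambda>n. vabs (a n)" 0 _ "vabs c"] by simp

lemma nullseq_sum: "(\<And>i. i \<in> A \<Longrightarrow> nullseq (a i)) \<Longrightarrow> nullseq (\<lambda>n. \<Sum>i\<in>A. a i n)"
  by (induction A rule: infinite_finite_induct) (auto simp: nullseq_0 intro!: nullseq_add)

lemma vanishes_iff_Suc: "vanishes f z \<longleftrightarrow> nullseq (\<lambda>n. psum f z (Suc n))"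
  unfolding vanishes_def nullseq_def
  using filterlim_sequentially_Suc[of "\<lambda>n. vabs (psum f z n)" "nhds 0"] by simp

lemma psum_Suc: "psum f z (Suc n) = psum f z n + fps_nth f n * z ^ n"
  by (simp add: psum_def)

lemma psum_add: "psum (f + g) z n = psum f z n + psum g z n"
  by (simp add: psum_def algebra_simps sum.distrib)

lemma psum_const_mult: "psum (fps_const c * f) z n = c * psum f z n"
  by (simp add: psum_def sum_distrib_left mult.assoc)

lemma psum_sum: "psum (\<Sum>i\<in>A. f i) z n = (\<Sum>i\<in>A. psum (f i) z n)"
  by (induction A rule: infinite_finite_induct) (simp_all add: psum_add, simp_all add: psum_def)

lemma vanishes_add: "vanishes f z \<Longrightarrow> vanishes g z \<Longrightarrow> vanishes (f + g) z"
  unfolding vanishes_def psum_add[abs_def] by (rule nullseq_add)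

lemma vanishes_const_mult: "vanishes f z \<Longrightarrow> vanishes (fps_const c * f) z"
  unfolding vanishes_def psum_const_mult[abs_def] by (rule nullseq_mult)

lemma vanishes_minus: "vanishes f z \<Longrightarrow> vanishes (- f) z"
  using vanishes_const_mult[of f z "-1"] by (simp flip: fps_const_neg)

lemma vanishes_diff: "vanishes f z \<Longrightarrow> vanishes g z \<Longrightarrow> vanishes (f - g) z"
  using vanishes_add[of f z "- g"] vanishes_minus by simp

lemma vanishes_sum: "(\<And>i. i \<in> A \<Longrightarrow> vanishes (f i) z) \<Longrightarrow> vanishes (\<Sum>i\<in>A. f i) z"
  unfolding vanishes_def psum_sum[abs_def] by (rule nullseq_sum)

lemma bounded_at_nonneg: "bounded_at f T B \<Longrightarrow> 0 \<le> B"
  unfolding bounded_at_def by (metis vabs_nonneg mult.right_neutral order_trans power_0)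

lemma bounded_at_nth_power:
  assumes "bounded_at f T B" "0 < T"
  shows "vabs (fps_nth f i * z ^ i) \<le> B * (vabs z / T) ^ i"
proof -
  have "vabs (fps_nth f i * z ^ i) = vabs (fps_nth f i) * T ^ i * (vabs z / T) ^ i"
    using assms by (simp add: vabs_mult power_divide)
  also have "\<dots> \<le> B * (vabs z / T) ^ i"
    using assms by (intro mult_right_mono) (auto simp: bounded_at_def vabs_nonneg)
  finally show ?thesis .
qed

lemma nullseq_bounded_at:
  assumes "bounded_at f T B" "vabs z < T"
  shows "nullseq (\<lambda>n. fps_nth f n * z ^ n)"
proof -
  have T: "0 < T"
    using assms(2) vabs_nonneg[of z] by linarith
  have "(\<lambda>n. B * (vabs z / T) ^ n) \<longlonglongrightarrow> B * 0"
    by (intro tendsto_mult_left LIMSEQ_power_zero) (use assms T in \<open>auto simp: vabs_nonneg abs_mult\<close>)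
  then have *: "(\<lambda>n. B * (vabs z / T) ^ n) \<longlonglongrightarrow> 0"
    by simp
  show ?thesis
    unfolding nullseq_def
    by (rule tendsto_sandwich[OF _ _ tendsto_const *])
      (auto simp: vabs_nonneg bounded_at_nth_power[OF assms(1) T] simp del: vabs_power)
qed

text \<open>The sum telescopes: the truncated series multiply like polynomials except for one
  boundary term. For \<open>vabs z < T\<close> that term is a null sequence by
  \<open>nullseq_bounded_at\<close>, so zeros of the product and of \<open>g\<close> can be
  compared.\<close>

lemma psum_linear_mult:
  "psum ((fps_X - fps_const w) * g) z (Suc m) = (z - w) * psum g z (Suc m) - fps_nth g m * z ^ Suc m"
proof (induction m)
  case 0
  then show ?case
    by (simp add: psum_def algebra_simps)
next
  case (Suc m)
  have "fps_nth ((fps_X - fps_const w) * g) (Suc m) = fps_nth g m - w * fps_nth g (Suc m)"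
    by (simp add: left_diff_distrib)
  then show ?case
    using Suc by (simp add: psum_Suc[of _ _ "Suc m"] algebra_simps)
qed

lemma vanishes_linear_mult:
  assumes "bounded_at g T B" "vabs z < T"
  shows "vanishes ((fps_X - fps_const z) * g) z"
proof -
  have "nullseq (\<lambda>m. (- z) * (fps_nth g m * z ^ m))"
    by (rule nullseq_mult, rule nullseq_bounded_at[OF assms])
  also have "(\<lambda>m. (- z) * (fps_nth g m * z ^ m)) = (\<lambda>m. psum ((fps_X - fps_const z) * g) z (Suc m))"
    unfolding psum_linear_mult by (simp add: mult_ac)
  finally have "nullseq (\<lambda>m. psum ((fps_X - fps_const z) * g) z (Suc m))" .
  then show ?thesis
    by (simp only: vanishes_iff_Suc)
qed

lemma vanishes_linear_cancel:
  assumes "bounded_at g T B" "vabs z < T" "z \<noteq> w" "vanishes ((fps_X - fps_const w) * g) z"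
  shows "vanishes g z"
proof -
  have "nullseq (\<lambda>m. inverse (z - w) *
      (psum ((fps_X - fps_const w) * g) z (Suc m) + z * (fps_nth g m * z ^ m)))"
  proof (rule nullseq_mult, rule nullseq_add)
    show "nullseq (\<lambda>m. psum ((fps_X - fps_const w) * g) z (Suc m))"
      using assms(4) by (simp only: vanishes_iff_Suc)
    show "nullseq (\<lambda>m. z * (fps_nth g m * z ^ m))"
      by (rule nullseq_mult, rule nullseq_bounded_at[OF assms(1,2)])
  qed
  also have "(\<lambda>m. inverse (z - w) *
      (psum ((fps_X - fps_const w) * g) z (Suc m) + z * (fps_nth g m * z ^ m)))
      = (\<lambda>m. psum g z (Suc m))"
  proof
    fix m
    have "psum ((fps_X - fps_const w) * g) z (Suc m) + z * (fps_nth g m * z ^ m) = (z - w) * psum g z (Suc m)"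
      unfolding psum_linear_mult by simp
    then show "inverse (z - w) *
      (psum ((fps_X - fps_const w) * g) z (Suc m) + z * (fps_nth g m * z ^ m)) = psum g z (Suc m)"
      using assms(3) by simp
  qed
  finally show ?thesis
    by (simp only: vanishes_iff_Suc)
qed

lemma bounded_at_mult:
  assumes "bounded_at f T B" "bounded_at g T C" "0 < T"
  shows "bounded_at (f * g) T (B * C)"
  unfolding bounded_at_def
proof
  fix n
  have nn: "0 \<le> B" "0 \<le> C"
    using assms bounded_at_nonneg by auto
  have "vabs (fps_nth f i * fps_nth g (n - i)) \<le> B * C / T ^ n" if "i \<in> {0..n}" for i
  proof -
    have "(vabs (fps_nth f i) * T ^ i) * (vabs (fps_nth g (n - i)) * T ^ (n - i)) \<le> B * C"
      using assms nn by (intro mult_mono) (auto simp: bounded_at_def vabs_nonneg)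
    moreover have "T ^ n = T ^ i * T ^ (n - i)"
      using that by (simp flip: power_add)
    ultimately show ?thesis
      using assms(3) by (simp add: vabs_mult field_simps)
  qed
  then have "vabs (fps_nth (f * g) n) \<le> B * C / T ^ n"
    unfolding fps_mult_nth using nn assms(3) by (intro vabs_sum_le) auto
  then show "vabs (fps_nth (f * g) n) * T ^ n \<le> B * C"
    using assms(3) by (simp add: field_simps)
qed

lemma bounded_at_sum:
  assumes "\<And>i. i \<in> A \<Longrightarrow> bounded_at (f i) T B" "0 \<le> B" "0 < T"
  shows "bounded_at (\<Sum>i\<in>A. f i) T B"
  unfolding bounded_at_def
proof
  fix n
  have "vabs (\<Sum>i\<in>A. fps_nth (f i) n) \<le> B / T ^ n"
    using assms by (intro vabs_sum_le) (auto simp: bounded_at_def field_simps)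
  then show "vabs (fps_nth (\<Sum>i\<in>A. f i) n) * T ^ n \<le> B"
    using assms(3) by (simp add: fps_sum_nth field_simps)
qed

lemma bounded_at_poly:
  assumes "\<And>i. vabs (Polynomial.coeff p i) \<le> B" "\<And>i. L \<le> i \<Longrightarrow> Polynomial.coeff p i = 0" "1 \<le> T"
  shows "bounded_at (fps_of_poly p) T (B * T ^ L)"
  unfolding bounded_at_def
proof
  fix i
  have B: "0 \<le> B"
    using assms(1)[of 0] vabs_nonneg order_trans by blast
  show "vabs (fps_nth (fps_of_poly p) i) * T ^ i \<le> B * T ^ L"
  proof (cases "i < L")
    case True
    then show ?thesis
      using assms B by (auto intro!: mult_mono power_increasing)
  qed (use B assms in auto)
qed

lemma bounded_at_poly_ex:
  assumes "1 \<le> T"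
  shows "\<exists>B. bounded_at (fps_of_poly p) T B"
proof -
  have "finite (range (\<lambda>i. vabs (Polynomial.coeff p i)))"
  proof (rule finite_subset)
    show "range (\<lambda>i. vabs (Polynomial.coeff p i)) \<subseteq>
        insert 0 ((\<lambda>i. vabs (Polynomial.coeff p i)) ` {..Polynomial.degree p})"
      by (force simp: image_iff not_le intro: coeff_eq_0)
  qed auto
  then have "vabs (Polynomial.coeff p i) \<le> Max (range (\<lambda>i. vabs (Polynomial.coeff p i)))" for i
    by simp
  from bounded_at_poly[OF this _ assms, of "Suc (Polynomial.degree p)"] show ?thesis
    by (auto intro!: exI simp: coeff_eq_0)
qed

text \<open>The polynomial \<open>p - p(z)\<close> is divisible by \<open>t - z\<close>, the
  quotient being given by synthetic division, so \<open>vanishes_linear_mult\<close>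
  applies.\<close>

lemma vanishes_poly_mult_diff:
  assumes "bounded_at f T B" "vabs z < T" "1 \<le> T"
  shows "vanishes (fps_of_poly p * f - fps_const (poly p z) * f) z"
proof -
  obtain C where C: "bounded_at (fps_of_poly (synthetic_div p z)) T C"
    using bounded_at_poly_ex[OF assms(3)] by blast
  have "p = [:- z, 1:] * synthetic_div p z + [:poly p z:]"
    by (rule synthetic_div_correct'[symmetric])
  then have "fps_of_poly p = fps_of_poly ([:- z, 1:] * synthetic_div p z + [:poly p z:])"
    by (rule arg_cong)
  also have "\<dots> = (fps_X - fps_const z) * fps_of_poly (synthetic_div p z) + fps_const (poly p z)"
    unfolding fps_of_poly_add fps_of_poly_mult fps_of_poly_const
    by (simp add: fps_of_poly_pCons)
  finally have eq: "fps_of_poly p = (fps_X - fps_const z) * fps_of_poly (synthetic_div p z) + fps_const (poly p z)" .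
  have "fps_of_poly p * f - fps_const (poly p z) * f
      = (fps_X - fps_const z) * (fps_of_poly (synthetic_div p z) * f)"
    unfolding eq by (simp add: algebra_simps)
  then show ?thesis
    using vanishes_linear_mult[OF bounded_at_mult[OF C assms(1)] assms(2)] assms(3) by simp
qed

lemma vanishes_poly_mult_iff:
  assumes "finite A" "\<And>i. i \<in> A \<Longrightarrow> bounded_at (f i) T (B i)" "vabs z < T" "1 \<le> T"
  shows "vanishes (\<Sum>i\<in>A. fps_of_poly (p i) * f i) z \<longleftrightarrow>
    vanishes (\<Sum>i\<in>A. fps_const (poly (p i) z) * f i) z"
proof -
  let ?f = "\<Sum>i\<in>A. fps_of_poly (p i) * f i" and ?g = "\<Sum>i\<in>A. fps_const (poly (p i) z) * f i"
  have "vanishes (\<Sum>i\<in>A. fps_of_poly (p i) * f i - fps_const (poly (p i) z) * f i) z"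
    using assms by (intro vanishes_sum vanishes_poly_mult_diff) auto
  then have "vanishes (?f - ?g) z"
    by (simp add: sum_subtractf)
  then show ?thesis
    using vanishes_add[of "?f - ?g" z ?g] vanishes_diff[of ?f z "?f - ?g"] by auto
qed

text \<open>The coefficients of the quotient are partial sums of \<open>f\<close> at
  \<open>z\<close> divided by powers of \<open>z\<close>. As the full sum is zero, a partial sum is
  minus a tail, and tails are as small as the first term they contain may be.\<close>

lemma vanishes_divide_linear:
  assumes f: "bounded_at f T B" and z: "vabs z < T" "z \<noteq> 0" and "vanishes f z"
  shows "\<exists>g. f = (fps_X - fps_const z) * g \<and> bounded_at g T (B / T)"
proof -
  have T: "0 < T"
    using z vabs_nonneg[of z] by linarith
  have B: "0 \<le> B"
    using f by (rule bounded_at_nonneg)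
  \<comment> \<open>Solving \<open>f = (t - z) g\<close> recursively from the constant term divides
    by \<open>z\<close> at each coefficient, which explains the assumption
    \<open>z \<noteq> 0\<close>.\<close>
  define g where "g = Abs_fps (\<lambda>n. - psum f z (Suc n) / z ^ Suc n)"
  have "fps_nth f n = fps_nth ((fps_X - fps_const z) * g) n" for n
  proof (cases n)
    case 0
    then show ?thesis
      using z(2) by (simp add: g_def psum_def left_diff_distrib)
  next
    case (Suc m)
    have "z * (psum f z (Suc (Suc m)) / z ^ Suc (Suc m)) = psum f z (Suc (Suc m)) / z ^ Suc m"
      using z(2) by simp
    also have "\<dots> = (psum f z (Suc m) + fps_nth f (Suc m) * z ^ Suc m) / z ^ Suc m"
      by (simp only: psum_Suc[of f z "Suc m"])
    also have "\<dots> = psum f z (Suc m) / z ^ Suc m + fps_nth f (Suc m)"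
      using z(2) by (subst add_divide_distrib) (simp del: power_Suc)
    finally show ?thesis
      unfolding Suc by (simp add: g_def left_diff_distrib del: power_Suc)
  qed
  then have "f = (fps_X - fps_const z) * g"
    by (rule fps_ext)
  \<comment> \<open>If a partial sum exceeded the bound valid for all later terms, the ultrametric
    inequality would keep every later partial sum at least as large, so that they could not tend to
    zero.\<close>
  moreover have tail: "vabs (psum f z (Suc n)) \<le> B * (vabs z / T) ^ Suc n" for n
  proof (rule ccontr)
    let ?b = "B * (vabs z / T) ^ Suc n" and ?s = "vabs (psum f z (Suc n))"
    assume *: "\<not> ?s \<le> ?b"
    have b: "0 \<le> ?b"
      using B T by (simp add: vabs_nonneg)
    have "?s \<le> vabs (psum f z k)" if "Suc n \<le> k" for k
    proof -
      have "vabs (\<Sum>i\<in>{Suc n..<k}. fps_nth f i * z ^ i) \<le> ?b"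
      proof (rule vabs_sum_le[OF _ b])
        fix i assume i: "i \<in> {Suc n..<k}"
        have "vabs (fps_nth f i * z ^ i) \<le> B * (vabs z / T) ^ i"
          by (rule bounded_at_nth_power[OF f T])
        also have "\<dots> \<le> ?b"
          using i z T B by (intro mult_left_mono power_decreasing) (auto simp: vabs_nonneg)
        finally show "vabs (fps_nth f i * z ^ i) \<le> ?b" .
      qed
      moreover have "psum f z k = psum f z (Suc n) + (\<Sum>i\<in>{Suc n..<k}. fps_nth f i * z ^ i)"
        using that unfolding psum_def lessThan_atLeast0 by (intro sum.atLeastLessThan_concat[symmetric]) auto
      then have "psum f z (Suc n) = psum f z k - (\<Sum>i\<in>{Suc n..<k}. fps_nth f i * z ^ i)"
        by simp
      ultimately show ?thesis
        using * vabs_diff_le[of "psum f z k" "\<Sum>i\<in>{Suc n..<k}. fps_nth f i * z ^ i"] by auto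
    qed
    then have "?s \<le> 0"
      using assms(4) unfolding vanishes_def nullseq_def
      by (intro tendsto_lowerbound[of "\<lambda>k. vabs (psum f z k)"])
        (auto intro: eventually_sequentiallyI[of "Suc n"])
    then show False
      using * b by linarith
  qed
  have "bounded_at g T (B / T)"
    unfolding bounded_at_def
  proof
    fix n
    have vz: "0 < vabs z"
      using z by (simp add: vabs_pos)
    have "vabs (fps_nth g n) = vabs (psum f z (Suc n)) / vabs z ^ Suc n"
      by (simp only: g_def fps_nth_Abs_fps divide_inverse vabs_mult vabs_minus vabs_inverse vabs_power)
    also have "\<dots> \<le> B * (vabs z / T) ^ Suc n / vabs z ^ Suc n"
      using vz by (intro divide_right_mono tail) auto
    also have "\<dots> = B / T ^ Suc n"
      using vz T z(2) by (simp add: power_divide)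
    finally show "vabs (fps_nth g n) * T ^ n \<le> B / T"
      using T by (simp add: field_simps)
  qed
  ultimately show ?thesis
    by blast
qed

text \<open>Dividing out one zero gains a factor \<open>T\<close> in the Gauss norm, and the
  remaining zeros survive by \<open>vanishes_linear_cancel\<close>.\<close>

lemma vanishes_divide_prod:
  assumes "finite Z" "bounded_at f T B" "\<And>z. z \<in> Z \<Longrightarrow> vabs z < T \<and> z \<noteq> 0 \<and> vanishes f z"
  shows "\<exists>g. f = (\<Prod>z\<in>Z. fps_X - fps_const z) * g \<and> bounded_at g T (B / T ^ card Z)"
  using assms
proof (induction Z arbitrary: f B rule: finite_induct)
  case (insert w Z)
  have w: "vabs w < T" "w \<noteq> 0" "vanishes f w"
    using insert.prems(2)[of w] by simp_all
  obtain g where g: "f = (fps_X - fps_const w) * g" "bounded_at g T (B / T)"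
    using vanishes_divide_linear[OF insert.prems(1) w] by blast
  have "vanishes g z" if "z \<in> Z" for z
  proof (rule vanishes_linear_cancel[OF g(2)])
    show "vabs z < T"
      using that insert.prems(2) by blast
    show "z \<noteq> w"
      using that insert.hyps by blast
    show "vanishes ((fps_X - fps_const w) * g) z"
      using that insert.prems(2) unfolding g(1)[symmetric] by blast
  qed
  then have "\<And>z. z \<in> Z \<Longrightarrow> vabs z < T \<and> z \<noteq> 0 \<and> vanishes g z"
    using insert.prems(2) by blast
  from insert.IH[OF g(2) this] obtain h where h: "g = (\<Prod>z\<in>Z. fps_X - fps_const z) * h"
    "bounded_at h T (B / T / T ^ card Z)"
    by blast
  have "f = (\<Prod>z\<in>insert w Z. fps_X - fps_const z) * h"
    using insert.hyps by (simp add: g(1) h(1) mult.assoc)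
  moreover have "bounded_at h T (B / T ^ card (insert w Z))"
    using insert.hyps h(2) by simp
  ultimately show ?case
    by blast
qed auto

text \<open>A non-archimedean Schwarz lemma, phrased through the lowest coefficient.\<close>

lemma vabs_lowest_coeff_le:
  assumes Z: "finite Z" and f: "bounded_at f T B" "f \<noteq> 0" and T: "1 \<le> T"
    and zeros: "\<And>z. z \<in> Z \<Longrightarrow> vabs z < T \<and> z \<noteq> 0 \<and> vanishes f z"
  shows "vabs (fps_nth f (subdegree f)) \<le> (\<Prod>z\<in>Z. vabs z) * B / T ^ card Z"
proof -
  obtain g where g: "f = (\<Prod>z\<in>Z. fps_X - fps_const z) * g" "bounded_at g T (B / T ^ card Z)"
    using vanishes_divide_prod[OF Z f(1) zeros] by blast
  let ?P = "\<Prod>z\<in>Z. fps_X - fps_const z"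
  have P0: "fps_nth ?P 0 = (\<Prod>z\<in>Z. - z)"
    by (induction Z rule: infinite_finite_induct) simp_all
  \<comment> \<open>Since no zero lies at the origin, \<open>?P\<close> has subdegree 0. The lowest
    coefficient of \<open>f\<close> is then the constant term of \<open>?P\<close> times the lowest
    coefficient of \<open>g\<close>.\<close>
  have "fps_nth ?P 0 \<noteq> 0"
    unfolding P0 using Z zeros by auto
  then have "subdegree ?P = 0"
    by (rule subdegree_eq_0)
  moreover have "?P \<noteq> 0" "g \<noteq> 0"
    using f(2) g(1) by auto
  ultimately have "fps_nth f (subdegree f) = (\<Prod>z\<in>Z. - z) * fps_nth g (subdegree g)"
    using nth_subdegree_mult[of ?P g] P0 by (simp add: g(1))
  moreover have "vabs (fps_nth g n) \<le> B / T ^ card Z" for n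
  proof -
    have "vabs (fps_nth g n) \<le> vabs (fps_nth g n) * T ^ n"
      using T vabs_nonneg[of "fps_nth g n"] by (simp add: mult_le_cancel_left1 one_le_power)
    also have "\<dots> \<le> B / T ^ card Z"
      using g(2) by (simp add: bounded_at_def)
    finally show ?thesis .
  qed
  ultimately have "vabs (fps_nth f (subdegree f)) \<le> (\<Prod>z\<in>Z. vabs z) * (B / T ^ card Z)"
    unfolding vabs_mult vabs_prod vabs_minus by (simp add: vabs_mult vabs_prod vabs_nonneg mult_left_mono prod_nonneg del: times_divide_eq_right)
  then show ?thesis
    by simp
qed

end

subsection \<open>Twists and convergence\<close>

context finite_place_card
begin

definition ffr :: "nat \<Rightarrow> 'c fps \<Rightarrow> 'c fps" where
  "ffr n f = Abs_fps (\<lambda>i. fr n (fps_nth f i))"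

definition pfr :: "nat \<Rightarrow> 'c poly \<Rightarrow> 'c poly" where
  "pfr n = map_poly (fr n)"

lemma ffr_nth [simp]: "fps_nth (ffr n f) i = fr n (fps_nth f i)"
  by (simp add: ffr_def)

lemma pfr_coeff [simp]: "Polynomial.coeff (pfr n p) i = fr n (Polynomial.coeff p i)"
  by (simp add: pfr_def coeff_map_poly)

lemma ffr_id [simp]: "ffr 0 f = f"
  by (rule fps_ext) simp

lemma ffr_ffr: "ffr m (ffr n f) = ffr (m + n) f"
  by (rule fps_ext) (simp add: fr_fr)

lemma ffr_add: "ffr n (f + g) = ffr n f + ffr n g"
  by (rule fps_ext) (simp add: fr_add)

lemma ffr_0 [simp]: "ffr n 0 = 0"
  by (rule fps_ext) simp

lemma ffr_mult: "ffr n (f * g) = ffr n f * ffr n g"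
  by (rule fps_ext) (simp add: fps_mult_nth fr_sum fr_mult)

lemma ffr_sum: "ffr n (\<Sum>i\<in>A. f i) = (\<Sum>i\<in>A. ffr n (f i))"
  by (induction A rule: infinite_finite_induct) (simp_all add: ffr_add)

lemma ffr_const: "ffr n (fps_const c) = fps_const (fr n c)"
  by (rule fps_ext) simp

lemma ffr_eq_0_iff [simp]: "ffr n f = 0 \<longleftrightarrow> f = 0"
  by (simp add: fps_eq_iff)

lemma fps_of_poly_pfr: "fps_of_poly (pfr n p) = ffr n (fps_of_poly p)"
  by (rule fps_ext) simp

lemma degree_pfr [simp]: "Polynomial.degree (pfr n p) = Polynomial.degree p"
  unfolding pfr_def by (rule degree_map_poly) simp

lemma poly_pfr: "poly (pfr n p) (fr n z) = fr n (poly p z)"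
  by (simp add: poly_altdef fr_sum fr_mult fr_power)

lemma psum_ffr: "psum (ffr n f) (fr n z) k = fr n (psum f z k)"
  by (simp add: psum_def fr_sum fr_mult fr_power)

lemma vanishes_ffr:
  assumes "vanishes f z"
  shows "vanishes (ffr n f) (fr n z)"
proof -
  have "(\<lambda>k. vabs (psum f z k) ^ (q ^ n)) \<longlonglongrightarrow> 0 ^ (q ^ n)"
    using assms unfolding vanishes_def nullseq_def by (rule tendsto_power)
  then show ?thesis
    using q_gt_1 by (simp add: vanishes_def nullseq_def psum_ffr vabs_fr power_0_left)
qed

text \<open>The radius is raised to the power \<open>q ^ n\<close> together with the bound. A bound
  for \<open>\<psi>\<close> on radius \<open>2\<close> thus controls its \<open>s\<close>-fold twist
  on the huge radius \<open>2 ^ (q ^ s)\<close>.\<close>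

lemma bounded_at_ffr:
  assumes "bounded_at f T B" "0 \<le> T"
  shows "bounded_at (ffr n f) (T ^ (q ^ n)) (B ^ (q ^ n))"
  unfolding bounded_at_def
proof
  fix i
  have "vabs (fps_nth (ffr n f) i) * (T ^ (q ^ n)) ^ i = (vabs (fps_nth f i) * T ^ i) ^ (q ^ n)"
    by (simp add: vabs_fr power_mult_distrib mult.commute flip: power_mult)
  also have "\<dots> \<le> B ^ (q ^ n)"
    using assms by (intro power_mono) (auto simp: bounded_at_def vabs_nonneg)
  finally show "vabs (fps_nth (ffr n f) i) * (T ^ (q ^ n)) ^ i \<le> B ^ (q ^ n)" .
qed

text \<open>A type that is merely a field and a metric space offers no library of series, so
  convergence is obtained by hand from completeness.\<close>

lemma psum_tendsto_series_eval:
  assumes f: "bounded_at f T B" and z: "vabs z < T"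
  shows "nullseq (\<lambda>n. psum f z n - series_eval f z)"
proof -
  have T: "0 < T"
    using z vabs_nonneg[of z] by linarith
  let ?r = "vabs z / T"
  have r: "0 \<le> ?r" "?r < 1"
    using z T by (simp_all add: vabs_nonneg)
  have diff: "vabs (psum f z n - psum f z m) \<le> B * ?r ^ m" if "m \<le> n" for m n
  proof -
    have "psum f z n = psum f z m + (\<Sum>i\<in>{m..<n}. fps_nth f i * z ^ i)"
      using that unfolding psum_def lessThan_atLeast0 by (intro sum.atLeastLessThan_concat[symmetric]) auto
    then have "psum f z n - psum f z m = (\<Sum>i\<in>{m..<n}. fps_nth f i * z ^ i)"
      by simp
    also have "vabs \<dots> \<le> B * ?r ^ m"
    proof (rule vabs_sum_le)
      fix i assume i: "i \<in> {m..<n}"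
      have "vabs (fps_nth f i * z ^ i) \<le> B * ?r ^ i"
        by (rule bounded_at_nth_power[OF f T])
      also have "\<dots> \<le> B * ?r ^ m"
        using i r bounded_at_nonneg[OF f] by (intro mult_left_mono power_decreasing) auto
      finally show "vabs (fps_nth f i * z ^ i) \<le> B * ?r ^ m" .
    qed (use r bounded_at_nonneg[OF f] in auto)
    finally show ?thesis .
  qed
  have lim: "(\<lambda>m. B * ?r ^ m) \<longlonglongrightarrow> 0"
    using tendsto_mult_left[OF LIMSEQ_power_zero[of ?r], of B] r by simp
  have "Cauchy (psum f z)"
  proof (rule metric_CauchyI)
    fix e :: real assume "0 < e"
    with lim have "\<forall>\<^sub>F m in sequentially. B * ?r ^ m < e"
      by (rule order_tendstoD)
    then obtain M where M: "B * ?r ^ M < e"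
      by (auto simp: eventually_sequentially)
    have "dist (psum f z m) (psum f z n) < e" if "M \<le> m" "M \<le> n" for m n
    proof -
      have "psum f z m - psum f z n = (psum f z m - psum f z M) - (psum f z n - psum f z M)"
        by simp
      also have "vabs \<dots> \<le> B * ?r ^ M"
        by (rule order_trans[OF vabs_diff_le]) (use diff that in auto)
      finally show ?thesis
        using M by (simp add: dist_vabs)
    qed
    then show "\<exists>M. \<forall>m\<ge>M. \<forall>n\<ge>M. dist (psum f z m) (psum f z n) < e"
      by blast
  qed
  then obtain L where L: "psum f z \<longlonglongrightarrow> L"
    using Cauchy_convergent convergent_def by blast
  then have "(\<lambda>i. fps_nth f i * z ^ i) sums L"
    by (simp add: sums_def psum_def[abs_def])
  then have "series_eval f z = L"
    unfolding series_eval_def by (rule sums_unique[symmetric])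
  then show ?thesis
    using L by (simp add: nullseq_def tendsto_dist_iff[of _ L] dist_vabs)
qed

text \<open>Translates a linear relation between limits into the language of partial sums: the
  partial sums of the combination are combinations of the errors
  \<open>psum - series_eval\<close>.\<close>

lemma vanishes_iff_series_eval:
  assumes "finite A" "\<And>i. i \<in> A \<Longrightarrow> bounded_at (f i) T (B i)" "vabs z < T"
    "(\<Sum>i\<in>A. c i * series_eval (f i) z) = 0"
  shows "vanishes (\<Sum>i\<in>A. fps_const (c i) * f i) z"
proof -
  have "nullseq (\<lambda>n. \<Sum>i\<in>A. c i * (psum (f i) z n - series_eval (f i) z))"
    using assms by (intro nullseq_sum nullseq_mult psum_tendsto_series_eval) auto
  then show ?thesis
    using assms(4) by (simp add: vanishes_def psum_sum[abs_def] psum_const_mult right_diff_distrib sum_subtractf)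
qed

text \<open>By the root condition, all but finitely many terms are at most \<open>1\<close>; the
  finitely many others enter through a maximum.\<close>

lemma entire_series_bounded_at:
  assumes "f \<in> entire_series \<iota> Kbar" "0 < T"
  shows "\<exists>B\<ge>1. bounded_at f T B"
proof -
  have "(\<lambda>i. root i (vabs (fps_nth f i))) \<longlonglongrightarrow> 0"
    using assms(1) by (simp add: entire_series_def)
  then have "\<forall>\<^sub>F i in sequentially. root i (vabs (fps_nth f i)) < 1 / T"
    using assms(2) by (intro order_tendstoD) auto
  then obtain N where N: "\<And>i. N \<le> i \<Longrightarrow> root i (vabs (fps_nth f i)) < 1 / T"
    by (auto simp: eventually_sequentially)
  \<comment> \<open>Starting at \<open>Suc N\<close> excludes the index \<open>0\<close>, where
    taking a root and then a power does not give back the argument.\<close>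
  have big: "vabs (fps_nth f i) * T ^ i \<le> 1" if "Suc N \<le> i" for i
  proof -
    have "vabs (fps_nth f i) = root i (vabs (fps_nth f i)) ^ i"
      using that by (intro real_root_pow_pos2[symmetric]) (auto simp: vabs_nonneg)
    also have "\<dots> \<le> (1 / T) ^ i"
      using N[of i] that by (intro power_mono real_root_ge_zero) (auto simp: vabs_nonneg)
    finally show ?thesis
      using assms(2) by (simp add: power_divide field_simps)
  qed
  define B where "B = Max (insert 1 ((\<lambda>i. vabs (fps_nth f i) * T ^ i) ` {..N}))"
  have "1 \<le> B"
    unfolding B_def by (rule Max_ge) auto
  moreover have "vabs (fps_nth f i) * T ^ i \<le> B" for i
  proof (cases "i \<le> N")
    case True
    then show ?thesis
      unfolding B_def by (intro Max_ge) auto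
  next
    case False
    then show ?thesis
      using big[of i] \<open>1 \<le> B\<close> by simp
  qed
  ultimately show ?thesis
    unfolding bounded_at_def by blast
qed

end

subsection \<open>Filtrations of linear growth\<close>

lemma card_polys_degree_le:
  "finite {p :: 'a :: {field, finite} poly. Polynomial.degree p \<le> n}"
  "card {p :: 'a :: {field, finite} poly. Polynomial.degree p \<le> n} = CARD('a) ^ (n + 1)"
proof -
  let ?F = "Pi\<^sub>E {..n} (\<lambda>_. UNIV :: 'a set)"
  have cf: "Polynomial.coeff (\<Sum>i\<le>n. Polynomial.monom (f i :: 'a) i) j = (if j \<le> n then f j else 0)" for f j
    by (auto simp: Polynomial.coeff_sum if_distrib cong: if_cong)
  have "bij_betw (\<lambda>f. \<Sum>i\<le>n. Polynomial.monom (f i) i) ?F {p :: 'a poly. Polynomial.degree p \<le> n}"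
  proof (rule bij_betw_byWitness[where f' = "\<lambda>p. restrict (Polynomial.coeff p) {..n}"])
    show "\<forall>f\<in>?F. restrict (Polynomial.coeff (\<Sum>i\<le>n. Polynomial.monom (f i) i)) {..n} = f"
      by (auto simp: cf fun_eq_iff PiE_def extensional_def restrict_def)
    show "\<forall>p\<in>{p :: 'a poly. Polynomial.degree p \<le> n}.
        (\<Sum>i\<le>n. Polynomial.monom (restrict (Polynomial.coeff p) {..n} i) i) = p"
      by (intro ballI poly_eqI) (simp only: cf, simp add: coeff_eq_0)
    show "(\<lambda>f. \<Sum>i\<le>n. Polynomial.monom (f i) i) ` ?F \<subseteq> {p. Polynomial.degree p \<le> n}"
      by (auto simp: cf intro!: degree_le)
  qed (auto split: if_splits)
  then have "finite ?F = finite {p :: 'a poly. Polynomial.degree p \<le> n}"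
    "card ?F = card {p :: 'a poly. Polynomial.degree p \<le> n}"
    by (rule bij_betw_finite, rule bij_betw_same_card)
  moreover have "finite ?F" "card ?F = CARD('a) ^ (n + 1)"
    by (rule finite_PiE) (simp_all add: card_PiE)
  ultimately show "finite {p :: 'a poly. Polynomial.degree p \<le> n}"
    "card {p :: 'a poly. Polynomial.degree p \<le> n} = CARD('a) ^ (n + 1)"
    by simp_all
qed

text \<open>Here \<open>R n\<close> stands for the elements of height at most \<open>n\<close> in a
  finitely generated ring. The conditions keep what the counting arguments use: a group structure,
  additive behaviour of levels under products, a cardinality with logarithm linear in
  \<open>n\<close>, and a bound at the one place considered.\<close>

locale filtered = finite_place_card \<pi> \<iota> Kvbar Kbar q
  for \<pi> :: "'a :: {field, finite} poly" and \<iota> :: "'a poly fract \<Rightarrow> 'c :: {field, complete_space}"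
    and Kvbar Kbar :: "'c set" and q :: nat +
  fixes R :: "nat \<Rightarrow> 'c set" and C :: nat and B :: real
  assumes R_base: "Polynomial.degree p \<le> n \<Longrightarrow> base p \<in> R n"
    and R_add: "x \<in> R n \<Longrightarrow> y \<in> R n \<Longrightarrow> x + y \<in> R n"
    and R_minus: "x \<in> R n \<Longrightarrow> - x \<in> R n"
    and R_mult: "x \<in> R m \<Longrightarrow> y \<in> R n \<Longrightarrow> x * y \<in> R (m + n)"
    and R_mono: "m \<le> n \<Longrightarrow> x \<in> R m \<Longrightarrow> x \<in> R n"
    and R_finite: "finite (R n)"
    and R_card: "card (R n) \<le> q ^ (C * (n + 1))"
    and B_ge_1: "1 \<le> B"
    and R_vabs: "x \<in> R n \<Longrightarrow> vabs x \<le> B ^ (n + 1)"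
begin

lemma R_0: "0 \<in> R n" and R_1: "1 \<in> R n"
  using R_base[of 0 n] R_base[of 1 n] by auto

lemma R_diff: "x \<in> R n \<Longrightarrow> y \<in> R n \<Longrightarrow> x - y \<in> R n"
  using R_add[of x n "- y"] R_minus by simp

lemma R_sum: "(\<And>i. i \<in> A \<Longrightarrow> f i \<in> R n) \<Longrightarrow> (\<Sum>i\<in>A. f i) \<in> R n"
  by (induction A rule: infinite_finite_induct) (auto intro: R_0 R_add)

lemma R_power: "x \<in> R n \<Longrightarrow> x ^ i \<in> R (i * n)"
  by (induction i) (auto intro: R_1 R_mult)

text \<open>The linear map given by \<open>c\<close> sends the vectors over \<open>U\<close> into
  vectors over \<open>R (h + k)\<close>. By counting, two of them have the same image, and their
  difference solves the system. The set \<open>U\<close> is kept separate from \<open>R k\<close>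
  because \<open>liouville\<close> takes it inside the image of \<open>A\<close>.\<close>

lemma pigeonhole:
  assumes I: "finite I" and J: "finite J"
    and U: "finite U" "U \<subseteq> R k" "\<And>x y. x \<in> U \<Longrightarrow> y \<in> U \<Longrightarrow> x - y \<in> U"
    and c: "\<And>i j. i \<in> I \<Longrightarrow> j \<in> J \<Longrightarrow> c j i \<in> R h"
    and card: "card (R (h + k)) ^ card J < card U ^ card I"
  shows "\<exists>x. (\<forall>i\<in>I. x i \<in> U) \<and> (\<exists>i\<in>I. x i \<noteq> 0) \<and> (\<forall>j\<in>J. (\<Sum>i\<in>I. c j i * x i) = 0)"
proof -
  let ?X = "Pi\<^sub>E I (\<lambda>_. U)" and ?Y = "Pi\<^sub>E J (\<lambda>_. R (h + k))"
  let ?f = "\<lambda>x. restrict (\<lambda>j. \<Sum>i\<in>I. c j i * x i) J"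
  have "?f ` ?X \<subseteq> ?Y"
    using U(2) c by (fastforce intro!: R_sum R_mult)
  moreover have "finite ?Y" "card ?Y < card ?X"
    using I J card by (auto simp: card_PiE R_finite intro: finite_PiE)
  ultimately have "\<not> inj_on ?f ?X"
    by (meson card_inj_on_le not_le)
  then obtain x y where xy: "x \<in> ?X" "y \<in> ?X" "?f x = ?f y" "x \<noteq> y"
    by (auto simp: inj_on_def)
  have "\<exists>i\<in>I. x i \<noteq> y i"
    using PiE_ext[OF xy(1,2)] xy(4) by blast
  moreover have "(\<Sum>i\<in>I. c j i * (x i - y i)) = 0" if "j \<in> J" for j
    using fun_cong[OF xy(3), of j] that by (simp add: right_diff_distrib sum_subtractf)
  ultimately show ?thesis
    using xy U(3) by (intro exI[of _ "\<lambda>i. x i - y i"]) (auto simp: PiE_iff)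
qed

lemma card_base_image: "card (base ` {p. Polynomial.degree p \<le> n}) = q ^ (n + 1)"
proof -
  have "inj_on base {p. Polynomial.degree p \<le> n}"
    by (simp add: inj_on_def base_eq_iff)
  then show ?thesis
    by (simp add: card_image card_polys_degree_le q_eq)
qed

text \<open>The box principle gives a nontrivial relation between \<open>1, b, ..., b^C\<close> with
  coefficients in \<open>A\<close> of bounded degree. After cancelling powers of \<open>b\<close>,
  its lowest nonzero coefficient is at most \<open>vabs b\<close> in absolute value, while
  \<open>vabs_base\<close> bounds it from below.\<close>

lemma liouville:
  assumes b: "b \<in> R n" "b \<noteq> 0"
  shows "1 / real q ^ (C * C * n) \<le> vabs b"
proof (cases "vabs b < 1")
  case False
  have "1 / real q ^ (C * C * n) \<le> 1"
    using q_gt_1 by simp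
  then show ?thesis
    using False by linarith
next
  case True
  \<comment> \<open>There are \<open>C + 1\<close> unknown coefficients in one equation. This
    \<open>?D\<close> makes \<open>(?D + 1) * (C + 1)\<close> exceed the exponent
    \<open>C * (C * n + ?D + 1)\<close> from \<open>R_card\<close> by exactly
    \<open>1\<close>.\<close>
  let ?D = "C * C * n" and ?I = "{..C}" and ?J = "{()}"
  let ?U = "base ` {p. Polynomial.degree p \<le> ?D}"
  have "C * (C * n + ?D + 1) < (?D + 1) * (C + 1)"
    by (simp add: algebra_simps)
  have "card (R (C * n + ?D)) ^ card ?J \<le> q ^ (C * (C * n + ?D + 1))"
    using R_card[of "C * n + ?D"] by simp
  also have "\<dots> < q ^ ((?D + 1) * (C + 1))"
    using q_gt_1 by (intro power_strict_increasing) (simp_all add: algebra_simps)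
  also have "\<dots> = card ?U ^ card ?I"
    by (simp only: card_base_image card_atMost Suc_eq_plus1 power_mult)
  finally have card: "card (R (C * n + ?D)) ^ card ?J < card ?U ^ card ?I" .
  have "\<exists>x. (\<forall>i\<in>?I. x i \<in> ?U) \<and> (\<exists>i\<in>?I. x i \<noteq> 0) \<and> (\<forall>j\<in>?J. (\<Sum>i\<in>?I. b ^ i * x i) = 0)"
  proof (rule pigeonhole[OF _ _ _ _ _ _ card])
    show "finite ?U"
      using card_polys_degree_le by blast
    show "?U \<subseteq> R ?D"
      by (auto intro: R_base)
    show "x - y \<in> ?U" if xy: "x \<in> ?U" "y \<in> ?U" for x y
    proof -
      obtain p r where "x = base p" "y = base r" "Polynomial.degree p \<le> ?D" "Polynomial.degree r \<le> ?D"
        using xy by auto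
      then have "x - y = base (p - r)" "Polynomial.degree (p - r) \<le> ?D"
        by (auto simp: base_diff intro: degree_diff_le)
      then show ?thesis
        by blast
    qed
    show "b ^ i \<in> R (C * n)" if "i \<in> ?I" for i
      using R_power[OF b(1), of i] that by (auto intro: R_mono[of "i * n"])
  qed auto
  then obtain x where x: "\<And>i. i \<le> C \<Longrightarrow> x i \<in> ?U" "\<exists>i\<le>C. x i \<noteq> 0" "(\<Sum>i\<le>C. b ^ i * x i) = 0"
    by auto
  define i0 where "i0 = (LEAST i. i \<le> C \<and> x i \<noteq> 0)"
  have i0: "i0 \<le> C" "x i0 \<noteq> 0"
    using LeastI_ex[of "\<lambda>i. i \<le> C \<and> x i \<noteq> 0"] x(2) unfolding i0_def by auto
  have less: "x i = 0" if "i < i0" for i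
    using not_less_Least[of i "\<lambda>i. i \<le> C \<and> x i \<noteq> 0"] that i0(1) unfolding i0_def by auto
  have split: "{..C} = {..<i0} \<union> insert i0 {i0<..C}"
    using i0(1) by auto
  have "0 = (\<Sum>i\<in>{..<i0} \<union> insert i0 {i0<..C}. b ^ i * x i)"
    unfolding split[symmetric] x(3) ..
  also have "\<dots> = (\<Sum>i<i0. b ^ i * x i) + (b ^ i0 * x i0 + (\<Sum>i\<in>{i0<..C}. b ^ i * x i))"
    by (subst sum.union_disjoint) auto
  also have "(\<Sum>i\<in>{i0<..C}. b ^ i * x i) = b ^ i0 * (\<Sum>i\<in>{i0<..C}. b ^ (i - i0) * x i)"
    unfolding sum_distrib_left by (rule sum.cong) (auto simp flip: power_add mult.assoc)
  also have "(\<Sum>i<i0. b ^ i * x i) = 0"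
    by (rule sum.neutral) (simp add: less)
  finally have "b ^ i0 * (x i0 + (\<Sum>i\<in>{i0<..C}. b ^ (i - i0) * x i)) = 0"
    by (simp add: distrib_left)
  then have eq: "x i0 = - (\<Sum>i\<in>{i0<..C}. b ^ (i - i0) * x i)"
    using b(2) by (simp add: add_eq_0_iff2)
  \<comment> \<open>Every remaining term carries at least one factor \<open>b\<close>, with
    \<open>vabs b < 1\<close>, and a coefficient from \<open>A\<close> of absolute value at most
    \<open>1\<close>.\<close>
  have "vabs (x i0) \<le> vabs b"
    unfolding eq vabs_minus
  proof (rule vabs_sum_le)
    fix i assume i: "i \<in> {i0<..C}"
    have "vabs (x i) \<le> 1"
      using x(1)[of i] i vabs_base(1) by (metis (no_types, lifting) base_0 greaterThanAtMost_iff imageE vabs_0 zero_le_one)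
    moreover have "vabs b ^ (i - i0) \<le> vabs b ^ 1"
      using i True by (intro power_decreasing) (auto simp: vabs_nonneg)
    ultimately show "vabs (b ^ (i - i0) * x i) \<le> vabs b"
      using mult_mono[of "vabs b ^ (i - i0)" "vabs b" "vabs (x i)" 1]
      by (simp add: vabs_mult vabs_nonneg)
  qed (rule vabs_nonneg)
  moreover obtain p where p: "x i0 = base p" "Polynomial.degree p \<le> ?D"
    using x(1)[OF i0(1)] by auto
  moreover have "1 / real q ^ ?D \<le> 1 / real q ^ Polynomial.degree p"
    using p(2) q_gt_1 by (intro divide_left_mono power_increasing) auto
  moreover have "p \<noteq> 0"
    using i0(2) p(1) by auto
  ultimately show ?thesis
    using vabs_base(2)[of p] order_trans unfolding q_eq by metis
qed

text \<open>The choice depends on \<open>C\<close> and \<open>u\<close> only. Hence solutions found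
  by \<open>siegel\<close> have level a fixed multiple of \<open>h\<close>, whatever the number of
  equations; this uniformity is what later allows \<open>N\<close> to be chosen large.\<close>

definition siegel_const :: "nat \<Rightarrow> nat" where
  "siegel_const u = (SOME K. real (C * (K + 1)) < (1 + 1 / real u) ^ K)"

lemma siegel_const:
  assumes "0 < u"
  shows "real (C * (siegel_const u + 1)) < (1 + 1 / real u) ^ siegel_const u"
proof -
  define r where "r = 1 + 1 / real u"
  have r: "1 < r"
    using assms by (simp add: r_def)
  have "\<forall>\<^sub>F K in sequentially. real C * (real K + 1) < r ^ K"
    using r by real_asymp
  then obtain K where "real C * (real K + 1) < r ^ K"
    by (auto simp: eventually_sequentially)
  then have "real (C * (K + 1)) < r ^ K"
    by (simp add: algebra_simps)
  then have "\<exists>K. real (C * (K + 1)) < r ^ K" ..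
  then show ?thesis
    unfolding siegel_const_def r_def by (rule someI_ex)
qed

text \<open>If the pigeonhole principle failed at each of the levels \<open>h, 2h, \<dots>, Kh\<close>, the logarithm
  of \<open>card (R (kh))\<close> would grow geometrically in \<open>k\<close>, against the linear bound \<open>R_card\<close>.\<close>

lemma siegel:
  assumes I: "finite I" and J: "finite J" and u: "0 < u" "(u + 1) * card J \<le> u * card I" "I \<noteq> {}"
    and c: "\<And>i j. i \<in> I \<Longrightarrow> j \<in> J \<Longrightarrow> c j i \<in> R h"
  shows "\<exists>x. (\<forall>i\<in>I. x i \<in> R (siegel_const u * h)) \<and> (\<exists>i\<in>I. x i \<noteq> 0) \<and>
    (\<forall>j\<in>J. (\<Sum>i\<in>I. c j i * x i) = 0)"
proof (rule ccontr)
  let ?K = "siegel_const u"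
  define S where "S n = log q (card (R n))" for n
  assume neg: "\<not> ?thesis"
  have pos: "card (R n) > 0" for n
    using R_finite R_0 by (metis card_gt_0_iff empty_iff)
  \<comment> \<open>If level \<open>k * h\<close> admits no solution, the count of
    \<open>pigeonhole\<close> must fail there. Taking logarithms and using the ratio of
    \<open>card I\<close> to \<open>card J\<close> gives growth by the factor
    \<open>1 + 1 / u\<close>.\<close>
  have step: "(1 + 1 / real u) * S (k * h) \<le> S (Suc k * h)" if "k \<le> ?K" for k
  proof -
    have "\<not> card (R (h + k * h)) ^ card J < card (R (k * h)) ^ card I"
    proof
      assume "card (R (h + k * h)) ^ card J < card (R (k * h)) ^ card I"
      then have "\<exists>x. (\<forall>i\<in>I. x i \<in> R (k * h)) \<and> (\<exists>i\<in>I. x i \<noteq> 0) \<and>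
          (\<forall>j\<in>J. (\<Sum>i\<in>I. c j i * x i) = 0)"
        by (intro pigeonhole[OF I J R_finite subset_refl]) (use c R_diff in auto)
      then show False
        using neg R_mono[of "k * h" "?K * h"] that by (meson mult_le_mono1)
    qed
    then have "real (card (R (k * h))) ^ card I \<le> real (card (R (h + k * h))) ^ card J"
      by (simp flip: of_nat_power)
    then have "log q (real (card (R (k * h))) ^ card I) \<le> log q (real (card (R (h + k * h))) ^ card J)"
      using pos q_gt_1 by (subst log_le_cancel_iff) auto
    then have 1: "card I * S (k * h) \<le> card J * S (Suc k * h)"
      using pos q_gt_1 by (simp add: log_nat_power S_def)
    have S0: "0 \<le> S (Suc k * h)"
      unfolding S_def using pos[of "Suc k * h"] q_gt_1 by (subst zero_le_log_cancel_iff) linarith+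
    have "real (u + 1) * (card I * S (k * h)) \<le> real (u + 1) * (card J * S (Suc k * h))"
      using 1 by (intro mult_left_mono) auto
    also have "\<dots> = real ((u + 1) * card J) * S (Suc k * h)"
      by (simp add: algebra_simps)
    also have "\<dots> \<le> real (u * card I) * S (Suc k * h)"
      using u(2) S0 by (intro mult_right_mono) (simp_all only: of_nat_le_iff)
    finally have "real (card I) * (real (u + 1) * S (k * h)) \<le> real (card I) * (real u * S (Suc k * h))"
      by (simp add: mult_ac)
    moreover have "real (card I) > 0"
      using I u(3) by (simp add: card_gt_0_iff)
    ultimately have "real (u + 1) * S (k * h) \<le> real u * S (Suc k * h)"
      by (simp only: mult_le_cancel_left_pos)
    then have "real (u + 1) * S (k * h) / real u \<le> S (Suc k * h)"
      using u(1) by (subst pos_divide_le_eq) (simp_all only: of_nat_0_less_iff mult.commute)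
    moreover have "1 + 1 / real u = real (u + 1) / real u"
      using u(1) by (simp add: add_divide_distrib)
    ultimately show ?thesis
      by (simp only: times_divide_eq_left)
  qed
  \<comment> \<open>The growth starts from \<open>S h \<ge> h + 1\<close>, because
    \<open>R h\<close> contains the image of all polynomials of degree at most
    \<open>h\<close>.\<close>
  have lower: "(1 + 1 / real u) ^ k * (h + 1) \<le> S (Suc k * h)" if "k \<le> ?K" for k
    using that
  proof (induction k)
    case 0
    have "base ` {p. Polynomial.degree p \<le> h} \<subseteq> R h"
      by (auto intro: R_base)
    then have "q ^ (h + 1) \<le> card (R h)"
      unfolding card_base_image[symmetric] by (rule card_mono[OF R_finite])
    then have "real q ^ (h + 1) \<le> real (card (R h))"
      by (simp only: of_nat_le_iff flip: of_nat_power)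
    then have "log q (real q ^ (h + 1)) \<le> S h"
      unfolding S_def using pos q_gt_1 by (subst log_le_cancel_iff) auto
    moreover have "log q (real q ^ (h + 1)) = real (h + 1)"
      using q_gt_1 by (subst log_nat_power) simp_all
    ultimately show ?case
      by simp
  next
    case (Suc k)
    have "(1 + 1 / real u) * ((1 + 1 / real u) ^ k * (h + 1)) \<le> (1 + 1 / real u) * S (Suc k * h)"
      using Suc by (intro mult_left_mono) auto
    also have "\<dots> \<le> S (Suc (Suc k) * h)"
      using Suc.prems by (rule step)
    finally show ?case
      by (simp add: mult_ac)
  qed
  \<comment> \<open>At level \<open>(?K + 1) * h\<close> the geometric lower bound overtakes the
    linear upper bound of \<open>R_card\<close>; the common factor \<open>h + 1\<close> makes the
    comparison independent of \<open>h\<close>.\<close>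
  have "real (C * (?K + 1)) * (h + 1) < (1 + 1 / real u) ^ ?K * (h + 1)"
    using siegel_const[OF u(1)] by (intro mult_strict_right_mono) auto
  also have "\<dots> \<le> S (Suc ?K * h)"
    by (rule lower) simp
  also have "\<dots> \<le> log q (real q ^ (C * (Suc ?K * h + 1)))"
  proof -
    have "real (card (R (Suc ?K * h))) \<le> real q ^ (C * (Suc ?K * h + 1))"
      using R_card[of "Suc ?K * h"] by (simp only: of_nat_le_iff flip: of_nat_power)
    then show ?thesis
      unfolding S_def using pos q_gt_1 by (subst log_le_cancel_iff) auto
  qed
  also have "\<dots> = real (C * (Suc ?K * h + 1))"
    using q_gt_1 by (subst log_nat_power) simp_all
  also have "\<dots> \<le> real (C * (Suc ?K * (h + 1)))"
    by (simp only: of_nat_le_iff) (intro mult_le_mono2, simp)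
  finally show False
    by (simp add: algebra_simps)
qed

end

subsection \<open>Adjoining an algebraic element\<close>

lemma poly_eq_sum_le:
  fixes p :: "'a :: comm_ring_1 poly"
  assumes "Polynomial.degree p \<le> n"
  shows "poly p x = (\<Sum>i\<le>n. Polynomial.coeff p i * x ^ i)"
  unfolding poly_altdef using assms
  by (intro sum.mono_neutral_left) (auto simp: coeff_eq_0)

context finite_place_card
begin

definition alg_over_base :: "'c \<Rightarrow> bool" where
  "alg_over_base x \<longleftrightarrow> (\<exists>p. p \<noteq> 0 \<and> poly (map_poly base p) x = 0)"

lemma filtered_base: "filtered \<pi> \<iota> Kvbar Kbar q (\<lambda>n. base ` {p. Polynomial.degree p \<le> n}) 1 1"
proof
  fix m n x y
  let ?R = "\<lambda>n. base ` {p. Polynomial.degree p \<le> n}"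
  show "base p \<in> ?R n" if "Polynomial.degree p \<le> n" for p
    using that by blast
  show "x + y \<in> ?R n" if "x \<in> ?R n" "y \<in> ?R n"
    using that by (auto simp flip: base_add intro!: imageI degree_add_le)
  show "- x \<in> ?R n" if "x \<in> ?R n"
    using that by (auto simp flip: base_minus intro!: imageI)
  show "x * y \<in> ?R (m + n)" if "x \<in> ?R m" "y \<in> ?R n"
    using that by (auto simp flip: base_mult intro!: imageI order_trans[OF degree_mult_le])
  show "x \<in> ?R n" if "m \<le> n" "x \<in> ?R m"
    using that by auto
  show "finite (?R n)"
    by (rule finite_imageI) (rule card_polys_degree_le)
  show "card (?R n) \<le> q ^ (1 * (n + 1))"
    unfolding q_eq mult_1 card_polys_degree_le(2)[symmetric]
    by (rule card_image_le) (rule card_polys_degree_le)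
  show "vabs x \<le> 1 ^ (n + 1)" if "x \<in> ?R n"
    using that vabs_base(1) by (auto, metis base_0 vabs_0 zero_le_one)
qed auto

end

context filtered
begin

text \<open>Polynomials in \<open>x\<close> of weighted degree at most \<open>n\<close>, where \<open>x\<close> has weight \<open>1\<close>.\<close>

definition adjoin :: "'c \<Rightarrow> nat \<Rightarrow> 'c set" where
  "adjoin x n = {poly r x |r. \<forall>i. (i \<le> n \<longrightarrow> Polynomial.coeff r i \<in> R (n - i)) \<and>
    (n < i \<longrightarrow> Polynomial.coeff r i = 0)}"

definition combs :: "nat \<Rightarrow> 'c \<Rightarrow> nat \<Rightarrow> 'c set" where
  "combs d x k = {\<Sum>j<d. c j * x ^ j |c. \<forall>j<d. c j \<in> R k}"

lemma card_combs: "finite (combs d x k)" "card (combs d x k) \<le> card (R k) ^ d"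
proof -
  let ?F = "Pi\<^sub>E {..<d} (\<lambda>_. R k)"
  have sub: "combs d x k \<subseteq> (\<lambda>c. \<Sum>j<d. c j * x ^ j) ` ?F"
  proof
    fix s assume "s \<in> combs d x k"
    then obtain c where c: "s = (\<Sum>j<d. c j * x ^ j)" "\<forall>j<d. c j \<in> R k"
      by (auto simp: combs_def)
    then have "s = (\<Sum>j<d. restrict c {..<d} j * x ^ j)" "restrict c {..<d} \<in> ?F"
      by auto
    then show "s \<in> (\<lambda>c. \<Sum>j<d. c j * x ^ j) ` ?F"
      by (rule image_eqI)
  qed
  have fin: "finite ?F"
    by (rule finite_PiE) (simp_all add: R_finite)
  then show "finite (combs d x k)"
    using sub finite_surj by blast
  have "card (combs d x k) \<le> card ?F"
    by (rule surj_card_le[OF fin sub])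
  then show "card (combs d x k) \<le> card (R k) ^ d"
    by (simp add: card_PiE)
qed

lemma combs_add:
  assumes "s \<in> combs d x k" "t \<in> combs d x k"
  shows "s + t \<in> combs d x k"
proof -
  obtain c where "s = (\<Sum>j<d. c j * x ^ j)" "\<forall>j<d. c j \<in> R k"
    using assms(1) by (auto simp: combs_def)
  moreover obtain e where "t = (\<Sum>j<d. e j * x ^ j)" "\<forall>j<d. e j \<in> R k"
    using assms(2) by (auto simp: combs_def)
  ultimately show ?thesis
    unfolding combs_def
    by (auto simp: sum.distrib[symmetric] distrib_right intro!: exI[of _ "\<lambda>j. c j + e j"] R_add)
qed

lemma combs_mult:
  assumes "r \<in> R m" "s \<in> combs d x k"
  shows "r * s \<in> combs d x (m + k)"
proof -
  obtain c where "s = (\<Sum>j<d. c j * x ^ j)" "\<forall>j<d. c j \<in> R k"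
    using assms(2) by (auto simp: combs_def)
  then show ?thesis
    unfolding combs_def using assms(1)
    by (auto simp: sum_distrib_left mult.assoc intro!: exI[of _ "\<lambda>j. r * c j"] R_mult)
qed

lemma combs_mono: "k \<le> l \<Longrightarrow> s \<in> combs d x k \<Longrightarrow> s \<in> combs d x l"
  unfolding combs_def using R_mono by blast

lemma combs_0: "0 \<in> combs d x k"
  unfolding combs_def by (auto intro!: exI[of _ "\<lambda>_. 0"] R_0)

lemma combs_sum: "(\<And>i. i \<in> A \<Longrightarrow> f i \<in> combs d x k) \<Longrightarrow> (\<Sum>i\<in>A. f i) \<in> combs d x k"
  by (induction A rule: infinite_finite_induct) (auto intro: combs_0 combs_add)

text \<open>This is reduction of powers of \<open>x\<close> without division: each multiplication by
  \<open>a * x\<close> shifts the coefficients, and the overflowing power \<open>x ^ d\<close> is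
  removed by the relation at the cost of the factor \<open>a\<close>. Each round costs
  \<open>h\<close> levels.\<close>

lemma power_mult_power_in_combs:
  assumes d: "0 < d" and e: "\<And>j. e j \<in> R h" and a: "a \<in> R h"
    and eq: "a * x ^ d = (\<Sum>j<d. e j * x ^ j)"
  shows "a ^ i * x ^ i \<in> combs d x (i * h)"
proof (induction i)
  case 0
  have "(\<Sum>j<d. (if j = 0 then 1 else 0) * x ^ j) = (1 :: 'c)"
    using d by (simp add: if_distrib[of "\<lambda>c. c * _"] cong: if_cong)
  then show ?case
    unfolding combs_def using R_0 R_1 by (auto intro!: exI[of _ "\<lambda>j. if j = 0 then 1 else 0"])
next
  case (Suc i)
  then obtain c where c: "a ^ i * x ^ i = (\<Sum>j<d. c j * x ^ j)" "\<forall>j<d. c j \<in> R (i * h)"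
    by (auto simp: combs_def)
  obtain d' where d': "d = Suc d'"
    using d by (cases d) auto
  \<comment> \<open>These are the coefficients after one shift, with the leading coefficient
    \<open>c d'\<close> redistributed along the relation.\<close>
  define f where "f j = (case j of 0 \<Rightarrow> 0 | Suc k \<Rightarrow> a * c k) + c d' * e j" for j
  have "a ^ Suc i * x ^ Suc i = a * x * (\<Sum>j<d. c j * x ^ j)"
    unfolding c(1)[symmetric] by simp
  also have "\<dots> = (\<Sum>j<d'. a * c j * x ^ Suc j) + c d' * (a * x ^ d)"
    by (simp add: d' sum_distrib_left algebra_simps)
  also have "(\<Sum>j<d'. a * c j * x ^ Suc j) = (\<Sum>j<d. (case j of 0 \<Rightarrow> 0 | Suc k \<Rightarrow> a * c k) * x ^ j)"
    unfolding d' by (subst sum.lessThan_Suc_shift) simp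
  finally have "a ^ Suc i * x ^ Suc i = (\<Sum>j<d. f j * x ^ j)"
    unfolding eq by (simp add: f_def distrib_right sum.distrib sum_distrib_left mult.assoc)
  moreover have "\<forall>j<d. f j \<in> R (Suc i * h)"
  proof (intro allI impI)
    fix j assume "j < d"
    have "(case j of 0 \<Rightarrow> 0 | Suc k \<Rightarrow> a * c k) \<in> R (h + i * h)"
      using c(2) a \<open>j < d\<close> by (auto split: nat.splits intro: R_0 R_mult)
    moreover have "c d' * e j \<in> R (i * h + h)"
      using c(2) e by (intro R_mult) (auto simp: d')
    ultimately show "f j \<in> R (Suc i * h)"
      unfolding f_def by (intro R_add) (simp_all add: add.commute)
  qed
  ultimately show ?case
    unfolding combs_def by blast
qed

lemma adjoin_E:
  assumes "z \<in> adjoin x n"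
  obtains c where "z = (\<Sum>i\<le>n. c i * x ^ i)" "\<And>i. i \<le> n \<Longrightarrow> c i \<in> R (n - i)"
proof -
  obtain r where r: "z = poly r x" "\<And>i. i \<le> n \<Longrightarrow> Polynomial.coeff r i \<in> R (n - i)"
    "\<And>i. n < i \<Longrightarrow> Polynomial.coeff r i = 0"
    using assms by (auto simp: adjoin_def)
  then show ?thesis
    using poly_eq_sum_le[of r n x] by (intro that[of "Polynomial.coeff r"]) (auto intro: degree_le)
qed

text \<open>With \<open>a\<close> the leading coefficient of an equation of degree \<open>d\<close>
  for \<open>x\<close>, multiplication by \<open>a ^ n\<close> is injective and carries
  \<open>adjoin x n\<close> into combinations of \<open>1, x, ..., x^(d - 1)\<close>. Their
  coefficients lie in a level of \<open>R\<close> linear in \<open>n\<close>, so the logarithm of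
  the cardinality stays linear.\<close>

lemma adjoin_card:
  assumes alg: "alg_over_base x"
  shows "\<exists>C'. \<forall>n. finite (adjoin x n) \<and> card (adjoin x n) \<le> q ^ (C' * (n + 1))"
proof -
  obtain p where p: "p \<noteq> 0" "poly (map_poly base p) x = 0"
    using alg by (auto simp: alg_over_base_def)
  define d where "d = Polynomial.degree p"
  define a where "a = base (Polynomial.lead_coeff p)"
  define h where "h = Max ((\<lambda>i. Polynomial.degree (Polynomial.coeff p i)) ` {..d})"
  have degp: "Polynomial.degree (Polynomial.coeff p i) \<le> h" for i
  proof (cases "i \<le> d")
    case True
    then show ?thesis
      unfolding h_def by (intro Max_ge) auto
  qed (simp add: d_def coeff_eq_0)
  have a0: "a \<noteq> 0"
    using p(1) by (simp add: a_def)
  have cf: "Polynomial.coeff (map_poly base p) i = base (Polynomial.coeff p i)" for i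
    by (simp add: coeff_map_poly)
  have "0 = (\<Sum>i\<le>d. base (Polynomial.coeff p i) * x ^ i)"
    using poly_eq_sum_le[of "map_poly base p" d x] p(2) unfolding cf d_def
    by (simp add: map_poly_degree_leq)
  also have "\<dots> = (\<Sum>i<d. base (Polynomial.coeff p i) * x ^ i) + a * x ^ d"
    by (simp add: lessThan_Suc_atMost[symmetric] a_def d_def)
  finally have eq: "a * x ^ d = (\<Sum>j<d. - base (Polynomial.coeff p j) * x ^ j)"
    by (simp add: sum_negf add_eq_0_iff)
  have d0: "0 < d"
  proof (rule ccontr)
    assume "\<not> 0 < d"
    then have "a = 0"
      using eq by simp
    then show False
      using a0 by simp
  qed
  have aR: "a \<in> R h" and eR: "- base (Polynomial.coeff p j) \<in> R h" for j
    unfolding a_def by (intro R_base R_minus degp)+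
  have sub: "(*) (a ^ n) ` adjoin x n \<subseteq> combs d x (n * h + n)" for n
  proof
    fix s assume "s \<in> (*) (a ^ n) ` adjoin x n"
    then obtain z where z: "s = a ^ n * z" "z \<in> adjoin x n"
      by auto
    obtain c where c: "z = (\<Sum>i\<le>n. c i * x ^ i)" "\<And>i. i \<le> n \<Longrightarrow> c i \<in> R (n - i)"
      using z(2) by (rule adjoin_E) blast
    \<comment> \<open>Of the \<open>n\<close> factors \<open>a\<close>, exactly \<open>i\<close> are
      spent on reducing \<open>x ^ i\<close>; the others are absorbed into the coefficient.\<close>
    have "a ^ n * (c i * x ^ i) \<in> combs d x (n * h + n)" if "i \<le> n" for i
    proof -
      have "a ^ n * (c i * x ^ i) = (a ^ (n - i) * c i) * (a ^ i * x ^ i)"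
        using that by (simp add: mult_ac flip: power_add)
      moreover have "a ^ (n - i) * c i \<in> R ((n - i) * h + (n - i))"
        by (intro R_mult R_power aR c(2) that)
      then have "(a ^ (n - i) * c i) * (a ^ i * x ^ i) \<in> combs d x ((n - i) * h + (n - i) + i * h)"
        by (rule combs_mult[OF _ power_mult_power_in_combs[OF d0 eR aR eq]])
      ultimately have "a ^ n * (c i * x ^ i) \<in> combs d x ((n - i) * h + (n - i) + i * h)"
        by (simp only:)
      moreover have "(n - i) * h + (n - i) + i * h \<le> n * h + n"
        unfolding diff_mult_distrib using that mult_le_mono1[OF that, of h] by linarith
      ultimately show ?thesis
        by (rule combs_mono[rotated])
    qed
    then show "s \<in> combs d x (n * h + n)"
      unfolding z(1) c(1) sum_distrib_left by (intro combs_sum) auto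
  qed
  have "finite (adjoin x n) \<and> card (adjoin x n) \<le> q ^ (C * d * (h + 1) * (n + 1))" for n
  proof
    have inj: "inj_on ((*) (a ^ n)) (adjoin x n)"
      using a0 by (simp add: inj_on_def)
    show "finite (adjoin x n)"
      using finite_subset[OF sub card_combs(1)] inj by (rule finite_imageD)
    have "card (adjoin x n) \<le> card (combs d x (n * h + n))"
      by (rule card_inj_on_le[OF inj sub card_combs(1)])
    also have "\<dots> \<le> card (R (n * h + n)) ^ d"
      by (rule card_combs)
    also have "\<dots> \<le> (q ^ (C * (n * h + n + 1))) ^ d"
      by (rule power_mono[OF R_card]) simp
    also have "\<dots> = q ^ (C * d * (n * h + n + 1))"
      unfolding power_mult[symmetric] by (simp only: mult_ac)
    also have "\<dots> \<le> q ^ (C * d * ((h + 1) * (n + 1)))"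
      using q_gt_1 by (intro power_increasing mult_le_mono2) auto
    finally show "card (adjoin x n) \<le> q ^ (C * d * (h + 1) * (n + 1))"
      by (simp only: mult.assoc)
  qed
  then show ?thesis
    by blast
qed

lemma adjoinI:
  assumes "\<And>i. i \<le> n \<Longrightarrow> Polynomial.coeff r i \<in> R (n - i)" "\<And>i. n < i \<Longrightarrow> Polynomial.coeff r i = 0"
  shows "poly r x \<in> adjoin x n"
  unfolding adjoin_def using assms by blast

lemma adjoin_obtain:
  assumes "z \<in> adjoin x n"
  obtains r where "z = poly r x" "\<And>i. i \<le> n \<Longrightarrow> Polynomial.coeff r i \<in> R (n - i)"
    "\<And>i. n < i \<Longrightarrow> Polynomial.coeff r i = 0"
  using assms by (auto simp: adjoin_def)

lemma adjoin_const:
  assumes "y \<in> R n"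
  shows "y \<in> adjoin x n"
  using adjoinI[of n "[:y:]" x] assms by (auto simp: coeff_pCons R_0 split: nat.splits)

lemma adjoin_self: "x \<in> adjoin x 1"
  using adjoinI[of 1 "[:0, 1:]" x] by (auto simp: coeff_pCons R_0 R_1 split: nat.splits)

lemma adjoin_mult:
  assumes "y \<in> adjoin x m" "z \<in> adjoin x n"
  shows "y * z \<in> adjoin x (m + n)"
proof -
  obtain r where r: "y = poly r x" "\<And>i. i \<le> m \<Longrightarrow> Polynomial.coeff r i \<in> R (m - i)"
    "\<And>i. m < i \<Longrightarrow> Polynomial.coeff r i = 0"
    using assms(1) by (rule adjoin_obtain) blast
  obtain s where s: "z = poly s x" "\<And>i. i \<le> n \<Longrightarrow> Polynomial.coeff s i \<in> R (n - i)"
    "\<And>i. n < i \<Longrightarrow> Polynomial.coeff s i = 0"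
    using assms(2) by (rule adjoin_obtain) blast
  have "poly (r * s) x \<in> adjoin x (m + n)"
  proof (rule adjoinI)
    fix k assume k: "k \<le> m + n"
    have "Polynomial.coeff r i * Polynomial.coeff s (k - i) \<in> R (m + n - k)" if "i \<le> k" for i
    proof (cases "i \<le> m \<and> k - i \<le> n")
      case True
      then have "Polynomial.coeff r i * Polynomial.coeff s (k - i) \<in> R ((m - i) + (n - (k - i)))"
        by (intro R_mult r s) auto
      moreover have "(m - i) + (n - (k - i)) = m + n - k"
        using True that by linarith
      ultimately show ?thesis
        by simp
    next
      case False
      then have "Polynomial.coeff r i = 0 \<or> Polynomial.coeff s (k - i) = 0"
        using r(3) s(3) not_le by blast
      then show ?thesis
        using R_0 by auto
    qed
    then show "Polynomial.coeff (r * s) k \<in> R (m + n - k)"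
      unfolding coeff_mult by (intro R_sum) auto
  next
    fix k assume k: "m + n < k"
    have "Polynomial.coeff r i * Polynomial.coeff s (k - i) = 0" for i
      using k r(3)[of i] s(3)[of "k - i"] by (cases "m < i") auto
    then show "Polynomial.coeff (r * s) k = 0"
      unfolding coeff_mult by (intro sum.neutral ballI)
  qed
  then show ?thesis
    by (simp add: r(1) s(1))
qed

lemma filtered_adjoin:
  assumes "alg_over_base x"
  shows "\<exists>C' B'. filtered \<pi> \<iota> Kvbar Kbar q (adjoin x) C' B'"
proof -
  obtain C' where C': "\<And>n. finite (adjoin x n)" "\<And>n. card (adjoin x n) \<le> q ^ (C' * (n + 1))"
    using adjoin_card[OF assms] by blast
  define B' where "B' = max B (vabs x)"
  have B': "1 \<le> B'" "0 \<le> B'" "B \<le> B'" "vabs x \<le> B'"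
    using B_ge_1 by (auto simp: B'_def)
  have "filtered \<pi> \<iota> Kvbar Kbar q (adjoin x) C' B'"
  proof
    fix m n y z
    show "base p \<in> adjoin x n" if "Polynomial.degree p \<le> n" for p
      by (rule adjoin_const[OF R_base[OF that]])
    show "y + z \<in> adjoin x n" if yz: "y \<in> adjoin x n" "z \<in> adjoin x n"
    proof -
      obtain r where r: "y = poly r x" "\<And>i. i \<le> n \<Longrightarrow> Polynomial.coeff r i \<in> R (n - i)"
        "\<And>i. n < i \<Longrightarrow> Polynomial.coeff r i = 0"
        using yz(1) by (rule adjoin_obtain) blast
      obtain s where s: "z = poly s x" "\<And>i. i \<le> n \<Longrightarrow> Polynomial.coeff s i \<in> R (n - i)"
        "\<And>i. n < i \<Longrightarrow> Polynomial.coeff s i = 0"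
        using yz(2) by (rule adjoin_obtain) blast
      show ?thesis
        using adjoinI[of n "r + s" x] r s R_add by simp
    qed
    show "- y \<in> adjoin x n" if y: "y \<in> adjoin x n"
    proof -
      obtain r where r: "y = poly r x" "\<And>i. i \<le> n \<Longrightarrow> Polynomial.coeff r i \<in> R (n - i)"
        "\<And>i. n < i \<Longrightarrow> Polynomial.coeff r i = 0"
        using y by (rule adjoin_obtain) blast
      show ?thesis
        using adjoinI[of n "- r" x] r R_minus by simp
    qed
    show "y * z \<in> adjoin x (m + n)" if "y \<in> adjoin x m" "z \<in> adjoin x n"
      using that by (rule adjoin_mult)
    show "y \<in> adjoin x n" if mn: "m \<le> n" and y: "y \<in> adjoin x m"
    proof -
      obtain r where r: "y = poly r x" "\<And>i. i \<le> m \<Longrightarrow> Polynomial.coeff r i \<in> R (m - i)"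
        "\<And>i. m < i \<Longrightarrow> Polynomial.coeff r i = 0"
        using y by (rule adjoin_obtain) blast
      have "Polynomial.coeff r i \<in> R (n - i)" if "i \<le> n" for i
        using r(2,3)[of i] R_0 R_mono[of "m - i" "n - i"] mn by (cases "i \<le> m") auto
      then show ?thesis
        using adjoinI[of n r x] r mn by simp
    qed
    show "finite (adjoin x n)" "card (adjoin x n) \<le> q ^ (C' * (n + 1))" "1 \<le> B'"
      by (fact C' B')+
    show "vabs y \<le> B' ^ (n + 1)" if y: "y \<in> adjoin x n"
    proof -
      obtain c where c: "y = (\<Sum>i\<le>n. c i * x ^ i)" "\<And>i. i \<le> n \<Longrightarrow> c i \<in> R (n - i)"
        using y by (rule adjoin_E) blast
      have "vabs (c i * x ^ i) \<le> B' ^ (n + 1)" if "i \<le> n" for i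
      proof -
        have "vabs (c i * x ^ i) \<le> B ^ (n - i + 1) * vabs x ^ i"
          using R_vabs[OF c(2)[OF that]] by (auto simp: vabs_mult vabs_nonneg intro!: mult_right_mono)
        also have "\<dots> \<le> B' ^ (n - i + 1) * B' ^ i"
          using B' B_ge_1 by (intro mult_mono power_mono) (auto simp: vabs_nonneg)
        also have "\<dots> = B' ^ (n + 1)"
          using that by (simp flip: power_add power_Suc)
        finally show ?thesis .
      qed
      then show ?thesis
        unfolding c(1) using B' by (intro vabs_sum_le) auto
    qed
  qed
  then show ?thesis
    by blast
qed

end

subsection \<open>The algebraic closure of the base field\<close>

lemma ring_of_type_algebra_simps:
  "carrier (ring_of_type_algebra\<lparr>carrier := K\<rparr>) = K"
  "x \<otimes>\<^bsub>ring_of_type_algebra\<lparr>carrier := K\<rparr>\<^esub> y = x * y"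
  "x \<oplus>\<^bsub>ring_of_type_algebra\<lparr>carrier := K\<rparr>\<^esub> y = x + y"
  "\<zero>\<^bsub>ring_of_type_algebra\<lparr>carrier := K\<rparr>\<^esub> = 0"
  "\<one>\<^bsub>ring_of_type_algebra\<lparr>carrier := K\<rparr>\<^esub> = 1"
  "x \<otimes>\<^bsub>ring_of_type_algebra\<^esub> y = x * y"
  "x \<oplus>\<^bsub>ring_of_type_algebra\<^esub> y = x + y"
  "\<zero>\<^bsub>ring_of_type_algebra\<^esub> = 0"
  "\<one>\<^bsub>ring_of_type_algebra\<^esub> = 1"
  by (simp_all add: ring_of_type_algebra_def)

lemma ring_of_UNIV: "ring_of_type_algebra\<lparr>carrier := UNIV\<rparr> = ring_of_type_algebra"
  by (simp add: ring_of_type_algebra_def)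

lemma ring_of_nat_pow:
  "x [^]\<^bsub>ring_of_type_algebra\<lparr>carrier := K\<rparr>\<^esub> (n :: nat) = (x :: 'c :: field) ^ n"
  by (induction n) (simp_all add: nat_pow_def ring_of_type_algebra_simps mult.commute)

text \<open>The bridge between two representations: the algebraic one lists coefficients from the
  leading one downwards, hence \<open>rev\<close>.\<close>

lemma ring_of_eval:
  assumes "ring (ring_of K)"
  shows "ring.eval (ring_of K) xs y = poly (Poly (rev xs)) y"
proof -
  interpret ring "ring_of K"
    by fact
  show ?thesis
    by (induction xs) (simp_all add: ring_of_type_algebra_simps ring_of_nat_pow Poly_append poly_monom)
qed

lemma rev_coeffs_in_carrier:
  assumes "p \<noteq> 0" "\<And>i. Polynomial.coeff p i \<in> K"
  shows "rev (coeffs p) \<in> carrier (K [X]\<^bsub>ring_of L\<^esub>)" "rev (coeffs p) \<noteq> []"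
proof -
  have "set (coeffs p) \<subseteq> K"
    using assms(2) by (auto simp: coeffs_def)
  moreover have "hd (rev (coeffs p)) \<noteq> 0"
    using assms(1) by (simp add: hd_rev last_coeffs_eq_coeff_degree)
  ultimately show "rev (coeffs p) \<in> carrier (K [X]\<^bsub>ring_of L\<^esub>)" "rev (coeffs p) \<noteq> []"
    using assms(1) by (auto simp: univ_poly_def polynomial_def ring_of_type_algebra_simps)
qed

lemma ex_common_denominator:
  fixes f :: "nat \<Rightarrow> 'a :: idom fract"
  shows "\<exists>D. D \<noteq> 0 \<and> (\<forall>i<n. \<exists>a. to_fract D * f i = to_fract a)"
proof (induction n)
  case 0
  show ?case
    by (intro exI[of _ 1]) simp
next
  case (Suc n)
  then obtain D where D: "D \<noteq> 0" "\<And>i. i < n \<Longrightarrow> \<exists>a. to_fract D * f i = to_fract a"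
    by blast
  obtain a b where ab: "f n = Fract a b" "b \<noteq> 0"
    by (cases "f n") auto
  have "\<exists>c. to_fract (D * b) * f i = to_fract c" if i: "i < Suc n" for i
  proof (cases "i = n")
    case True
    have "to_fract (D * b) * f i = to_fract (D * a)"
      using ab True by (simp add: Fract_conv_to_fract)
    then show ?thesis ..
  next
    case False
    then obtain c where "to_fract D * f i = to_fract c"
      using D(2)[of i] i by auto
    then have "to_fract (D * b) * f i = to_fract (c * b)"
      by (metis mult.assoc mult.commute to_fract_mult)
    then show ?thesis ..
  qed
  then show ?case
    using D(1) ab(2) by (intro exI[of _ "D * b"]) auto
qed

context finite_place_card
begin

lemma Kbar_range: "range \<iota> \<subseteq> Kbar"
proof -
  interpret algebraic_closure "ring_of Kbar" "range \<iota>"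
    by (rule Kbar)
  show ?thesis
    using subset by (simp add: ring_of_type_algebra_simps)
qed

lemma Kbar_base: "base p \<in> Kbar"
  using Kbar_range by (auto simp: base_def)

lemma Kbar_add: "x \<in> Kbar \<Longrightarrow> y \<in> Kbar \<Longrightarrow> x + y \<in> Kbar"
  and Kbar_mult: "x \<in> Kbar \<Longrightarrow> y \<in> Kbar \<Longrightarrow> x * y \<in> Kbar"
  and Kbar_inverse: "x \<in> Kbar \<Longrightarrow> inverse x \<in> Kbar"
proof -
  interpret algebraic_closure "ring_of Kbar" "range \<iota>"
    by (rule Kbar)
  show "x + y \<in> Kbar" if "x \<in> Kbar" "y \<in> Kbar"
    using add.m_closed[of x y] that by (simp add: ring_of_type_algebra_simps)
  show "x * y \<in> Kbar" if "x \<in> Kbar" "y \<in> Kbar"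
    using monoid.m_closed[OF monoid_axioms, of x y] that by (simp add: ring_of_type_algebra_simps)
  show "inverse x \<in> Kbar" if x: "x \<in> Kbar"
  proof (cases "x = 0")
    case False
    then have "x \<in> Units (ring_of Kbar)"
      using x by (simp add: field_Units ring_of_type_algebra_simps)
    then obtain y where "y \<in> Kbar" "x * y = 1"
      using Units_r_inv_ex[of x] by (auto simp: ring_of_type_algebra_simps)
    then show ?thesis
      by (simp add: inverse_unique)
  qed (use x in simp)
qed

lemma Kbar_0: "0 \<in> Kbar" and Kbar_1: "1 \<in> Kbar"
  using Kbar_base[of 0] Kbar_base[of 1] by simp_all

lemma Kbar_minus: "x \<in> Kbar \<Longrightarrow> - x \<in> Kbar"
  using Kbar_mult[OF Kbar_base[of "- 1"], of x] base_minus[of 1] by simp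

lemma Kbar_diff: "x \<in> Kbar \<Longrightarrow> y \<in> Kbar \<Longrightarrow> x - y \<in> Kbar"
  using Kbar_add[OF _ Kbar_minus] by fastforce

lemma Kbar_sum: "(\<And>i. i \<in> A \<Longrightarrow> f i \<in> Kbar) \<Longrightarrow> (\<Sum>i\<in>A. f i) \<in> Kbar"
  by (induction A rule: infinite_finite_induct) (auto intro: Kbar_0 Kbar_add)

lemma Kbar_power: "x \<in> Kbar \<Longrightarrow> x ^ n \<in> Kbar"
  by (induction n) (auto intro: Kbar_1 Kbar_mult)

text \<open>Algebraicity over \<open>k\<close> gives an equation with coefficients in the range of
  \<open>\<iota>\<close>; multiplying by a common denominator moves the coefficients into
  \<open>A\<close>.\<close>

lemma Kbar_alg_over_base:
  assumes x: "x \<in> Kbar"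
  shows "alg_over_base x"
proof -
  interpret algebraic_closure "ring_of Kbar" "range \<iota>"
    by (rule Kbar)
  have "((algebraic) over (range \<iota>)) x"
    using algebraic_extension x by (simp add: ring_of_type_algebra_simps)
  then obtain xs where xs: "xs \<in> carrier ((range \<iota>)[X]\<^bsub>ring_of Kbar\<^esub>)" "xs \<noteq> []" "eval xs x = 0"
    using algebraicE[OF subring_axioms, of x] x by (auto simp: ring_of_type_algebra_simps)
  define P where "P = Poly (rev xs)"
  have set: "set xs \<subseteq> range \<iota>" and hd: "hd xs \<noteq> 0"
    using xs(1,2) by (auto simp: univ_poly_def polynomial_def ring_of_type_algebra_simps)
  have P0: "poly P x = 0"
    using xs(3) unfolding P_def by (simp add: ring_of_eval[OF ring_axioms])
  have Pc: "Polynomial.coeff P i \<in> range \<iota>" for i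
  proof (cases "i < length xs")
    case True
    then have "Polynomial.coeff P i = rev xs ! i"
      by (simp add: P_def nth_default_def)
    moreover have "rev xs ! i \<in> set xs"
      using True by (metis length_rev nth_mem set_rev)
    ultimately show ?thesis
      using set by auto
  next
    case False
    then show ?thesis
      by (simp add: P_def nth_default_def) (metis iota_0 rangeI)
  qed
  have "Polynomial.coeff P (length xs - 1) = hd xs"
    using xs(2) by (simp add: P_def nth_default_def rev_nth hd_conv_nth)
  then have Pnz: "P \<noteq> 0"
    using hd by auto
  have "\<forall>i. \<exists>y. Polynomial.coeff P i = \<iota> y"
    using Pc by (meson rangeE)
  then obtain f where f: "\<And>i. Polynomial.coeff P i = \<iota> (f i)"
    by metis
  obtain D where D: "D \<noteq> 0" "\<And>i. i < Suc (Polynomial.degree P) \<Longrightarrow> \<exists>a. to_fract D * f i = to_fract a"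
    using ex_common_denominator by blast
  then obtain a where a: "\<And>i. i < Suc (Polynomial.degree P) \<Longrightarrow> to_fract D * f i = to_fract (a i)"
    by metis
  define p where "p = (\<Sum>i\<le>Polynomial.degree P. Polynomial.monom (a i) i)"
  have pc: "Polynomial.coeff p i = (if i \<le> Polynomial.degree P then a i else 0)" for i
    by (auto simp: p_def Polynomial.coeff_sum if_distrib cong: if_cong)
  have "map_poly base p = Polynomial.smult (base D) P"
  proof (rule poly_eqI)
    fix i
    show "Polynomial.coeff (map_poly base p) i = Polynomial.coeff (Polynomial.smult (base D) P) i"
    proof (cases "i \<le> Polynomial.degree P")
      case True
      have "base (a i) = \<iota> (to_fract D * f i)"
        using a True by (simp add: base_def)
      also have "\<dots> = base D * Polynomial.coeff P i"
        by (simp add: iota_simps f base_def)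
      finally show ?thesis
        using True by (simp add: coeff_map_poly pc)
    qed (simp add: coeff_map_poly pc coeff_eq_0)
  qed
  then have "poly (map_poly base p) x = 0" "map_poly base p \<noteq> 0"
    using P0 D(1) Pnz by simp_all
  then show ?thesis
    unfolding alg_over_base_def by (intro exI[of _ p]) auto
qed

lemma Kbar_root:
  assumes p: "\<And>i. Polynomial.coeff p i \<in> Kbar" "0 < Polynomial.degree p"
  shows "\<exists>y\<in>Kbar. poly p y = 0"
proof -
  interpret algebraic_closure "ring_of Kbar" "range \<iota>"
    by (rule Kbar)
  define xs where "xs = rev (coeffs p)"
  have "p \<noteq> 0"
    using p(2) by auto
  then have xs: "xs \<in> carrier (poly_ring (ring_of Kbar))"
    using rev_coeffs_in_carrier(1)[of p Kbar Kbar] p(1) unfolding xs_def by (simp add: ring_of_type_algebra_simps)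
  then have "splitted xs"
    by (rule roots_over_carrier)
  moreover have "Polynomials.degree xs = Polynomial.degree p"
    by (simp add: xs_def degree_eq_length_coeffs)
  ultimately have "roots xs \<noteq> {#}"
    using p(2) unfolding splitted_def by auto
  then obtain y where "y \<in># roots xs"
    by blast
  then have y: "is_root xs y"
    using roots_mem_iff_is_root[OF xs] by auto
  then have "y \<in> Kbar" "eval xs y = 0"
    by (auto simp: is_root_def ring_of_type_algebra_simps)
  then show ?thesis
    unfolding ring_of_eval[OF ring_axioms] xs_def by (auto simp: Poly_coeffs)
qed

lemma Kbar_fr_surj:
  assumes x: "x \<in> Kbar"
  shows "\<exists>y\<in>Kbar. fr n y = x"
proof -
  let ?p = "Polynomial.monom 1 (q ^ n) - [:x:]"
  have n: "0 < q ^ n"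
    using q_gt_1 by simp
  have "Polynomial.coeff ?p i \<in> Kbar" for i
    using x by (auto simp: coeff_pCons Kbar_0 Kbar_1 Kbar_minus Kbar_diff split: nat.splits)
  moreover have "0 < Polynomial.degree ?p"
  proof -
    have "Polynomial.coeff ?p (q ^ n) = 1"
      using n by (cases "q ^ n") simp_all
    then have "q ^ n \<le> Polynomial.degree ?p"
      by (intro le_degree) simp
    then show ?thesis
      using n by linarith
  qed
  ultimately obtain y where "y \<in> Kbar" "poly ?p y = 0"
    using Kbar_root by blast
  then show ?thesis
    by (auto simp: fr_def poly_monom)
qed

text \<open>A coincidence would make \<open>x\<close> a root of \<open>X^(q^j) - X^(q^i)\<close>, a
  nonzero polynomial with coefficients \<open>0\<close>, \<open>1\<close> and \<open>-1\<close> in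
  the constant field.\<close>

lemma fr_neq_if_not_const:
  assumes x: "x \<in> Kbar" "x \<notin> const_closure \<iota> Kbar" and "i < j"
  shows "fr i x \<noteq> fr j x"
proof
  assume eq: "fr i x = fr j x"
  interpret T: field "ring_of_type_algebra :: 'c ring"
    by (rule field_from_type_algebra)
  let ?S = "range (\<lambda>c. \<iota> (to_fract [:c:]))"
  let ?p = "Polynomial.monom 1 (q ^ j) - Polynomial.monom 1 (q ^ i) :: 'c poly"
  have ij: "q ^ i < q ^ j"
    using q_gt_1 assms(3) by simp
  have S: "base [:c:] \<in> ?S" for c
    by (auto simp: base_def)
  have "[:- 1:] = (- 1 :: 'a poly)"
    by (simp add: one_pCons)
  then have "0 \<in> ?S" "1 \<in> ?S" "- 1 \<in> ?S"
    using S[of 0] S[of 1] S[of "- 1"] base_minus[of 1] by (simp_all flip: one_pCons)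
  then have c: "Polynomial.coeff ?p k \<in> ?S" for k
    using ij by auto
  have "Polynomial.coeff ?p (q ^ j) = 1"
    using ij by simp
  then have "?p \<noteq> 0"
    by (metis coeff_0 zero_neq_one)
  note mem = rev_coeffs_in_carrier(1)[of ?p ?S UNIV, OF this c, unfolded ring_of_UNIV]
    rev_coeffs_in_carrier(2)[of ?p ?S, OF this c]
  have "poly ?p x = 0"
    using eq by (simp add: fr_def poly_monom)
  moreover have "T.eval (rev (coeffs ?p)) x = poly (Poly (rev (rev (coeffs ?p)))) x"
    using ring_of_eval[of "UNIV :: 'c set"] T.ring_axioms unfolding ring_of_UNIV by blast
  ultimately have "T.eval (rev (coeffs ?p)) x = \<zero>\<^bsub>ring_of_type_algebra\<^esub>"
    by (simp only: rev_rev_ident Poly_coeffs ring_of_type_algebra_simps)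
  then have "((T.algebraic) over ?S) x"
    by (rule T.algebraicI[OF mem])
  then show False
    using x by (simp add: const_closure_def)
qed

lemma adjoin_subset_Kbar:
  assumes "filtered \<pi> \<iota> Kvbar Kbar q R C B" "\<And>n. R n \<subseteq> Kbar" "x \<in> Kbar"
  shows "filtered.adjoin R x n \<subseteq> Kbar"
proof
  interpret filtered \<pi> \<iota> Kvbar Kbar q R C B
    by fact
  fix z assume "z \<in> adjoin x n"
  then obtain c where c: "z = (\<Sum>i\<le>n. c i * x ^ i)" "\<And>i. i \<le> n \<Longrightarrow> c i \<in> R (n - i)"
    by (rule adjoin_E) blast
  show "z \<in> Kbar"
    unfolding c(1) using c(2) assms(2,3) by (intro Kbar_sum Kbar_mult Kbar_power) auto
qed

text \<open>The generators are adjoined to \<open>A\<close> one at a time; each enters at level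
  \<open>1\<close>, and the earlier ones keep their level by \<open>adjoin_const\<close>.\<close>

lemma ex_filtered:
  assumes "finite S" "S \<subseteq> Kbar"
  shows "\<exists>R C B. filtered \<pi> \<iota> Kvbar Kbar q R C B \<and> S \<subseteq> R 1 \<and> (\<forall>n. R n \<subseteq> Kbar)"
  using assms
proof (induction S rule: finite_induct)
  case empty
  have "base ` A \<subseteq> Kbar" for A
    by (auto intro: Kbar_base)
  then show ?case
    using filtered_base by blast
next
  case (insert x S)
  then obtain R C B where F: "filtered \<pi> \<iota> Kvbar Kbar q R C B" "S \<subseteq> R 1" "\<And>n. R n \<subseteq> Kbar"
    by auto
  interpret filtered \<pi> \<iota> Kvbar Kbar q R C B
    by (rule F(1))
  have x: "x \<in> Kbar"
    using insert.prems by simp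
  obtain C' B' where "filtered \<pi> \<iota> Kvbar Kbar q (adjoin x) C' B'"
    using filtered_adjoin Kbar_alg_over_base[OF x] by blast
  moreover have "insert x S \<subseteq> adjoin x 1"
    using adjoin_self adjoin_const F(2) by auto
  moreover have "\<forall>n. adjoin x n \<subseteq> Kbar"
    using adjoin_subset_Kbar[OF F(1,3) x] by blast
  ultimately show ?case
    by blast
qed

end

subsection \<open>Determinants and adjugates\<close>

lemma det_hom:
  fixes h :: "'a :: comm_ring_1 \<Rightarrow> 'b :: comm_ring_1" and A :: "'a ^ 'n ^ 'n"
  assumes add: "\<And>x y. h (x + y) = h x + h y" and mult: "\<And>x y. h (x * y) = h x * h y" and one: "h 1 = 1"
  shows "det (map_matrix h A) = h (det A)"
proof -
  have zero: "h 0 = 0"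
    using add[of 0 0] by simp
  have minus: "h (- x) = - h x" for x
    using add[of x "- x"] zero by (simp add: add_eq_0_iff)
  have sum: "h (sum f S) = (\<Sum>i\<in>S. h (f i))" for f :: "('n \<Rightarrow> 'n) \<Rightarrow> 'a" and S
    by (induction S rule: infinite_finite_induct) (simp_all add: zero add)
  have prod: "h (prod f S) = (\<Prod>i\<in>S. h (f i))" for f :: "'n \<Rightarrow> 'a" and S
    by (induction S rule: infinite_finite_induct) (simp_all add: one mult)
  have "h (of_int (sign p)) = of_int (sign p)" for p :: "'n \<Rightarrow> 'n"
    by (simp add: sign_def one minus)
  then show ?thesis
    unfolding det_def by (simp add: sum prod mult)
qed

lemma det_in_subring:
  fixes A :: "'a :: comm_ring_1 ^ 'n ^ 'n"
  assumes "\<And>x y. x \<in> S \<Longrightarrow> y \<in> S \<Longrightarrow> x + y \<in> S" "\<And>x y. x \<in> S \<Longrightarrow> y \<in> S \<Longrightarrow> x * y \<in> S"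
    "\<And>x. x \<in> S \<Longrightarrow> - x \<in> S" "0 \<in> S" "1 \<in> S" "\<And>i j. A $ i $ j \<in> S"
  shows "det A \<in> S"
proof -
  have "sum f I \<in> S" if "\<And>i. i \<in> I \<Longrightarrow> f i \<in> S" for f :: "('n \<Rightarrow> 'n) \<Rightarrow> 'a" and I
    using that by (induction I rule: infinite_finite_induct) (auto intro: assms)
  moreover have "prod f I \<in> S" if "\<And>i. i \<in> I \<Longrightarrow> f i \<in> S" for f :: "'n \<Rightarrow> 'a" and I
    using that by (induction I rule: infinite_finite_induct) (auto intro: assms)
  moreover have "of_int (sign p) \<in> S" for p :: "'n \<Rightarrow> 'n"
    by (simp add: sign_def assms)
  ultimately show ?thesis
    unfolding det_def by (simp add: assms)
qed

text \<open>Replacing row \<open>j\<close> by the \<open>i\<close>-th unit vector gives the cofactor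
  at position \<open>(j, i)\<close>. In the usual terminology this is already the adjugate, in the
  form that satisfies the identity from the right.\<close>

definition cofactor_mat :: "'a :: comm_ring_1 ^ 'n ^ 'n \<Rightarrow> 'a ^ 'n ^ 'n" where
  "cofactor_mat A = (\<chi> i j. det (\<chi> r. if r = j then axis i 1 else A $ r))"

text \<open>By linearity of the determinant in row \<open>j\<close>, the sum is the determinant of
  \<open>A\<close> with row \<open>j\<close> replaced by row \<open>k\<close>, which has two equal
  rows unless \<open>k = j\<close>.\<close>

lemma matrix_mult_cofactor_mat: "(\<Sum>i\<in>UNIV. A $ k $ i * cofactor_mat A $ i $ j) = (if k = j then det A else 0)"
proof -
  have "(\<Sum>i\<in>UNIV. A $ k $ i * cofactor_mat A $ i $ j)
      = (\<Sum>i\<in>UNIV. det (\<chi> r. if r = j then A $ k $ i *s axis i 1 else A $ r))"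
    by (simp add: cofactor_mat_def det_row_mul)
  also have "\<dots> = det (\<chi> r. if r = j then (\<Sum>i\<in>UNIV. A $ k $ i *s axis i 1) else A $ r)"
    by (subst det_linear_row_sum) simp_all
  also have "(\<Sum>i\<in>UNIV. A $ k $ i *s axis i 1) = A $ k"
    by (rule basis_expansion)
  also have "det (\<chi> r. if r = j then A $ k else A $ r) = (if k = j then det A else 0)"
  proof (cases "k = j")
    case True
    then have "(\<chi> r. if r = j then A $ k else A $ r) = A"
      by (simp add: vec_eq_iff)
    then show ?thesis
      using True by simp
  next
    case False
    then have "det (\<chi> r. if r = j then A $ k else A $ r) = 0"
      by (intro det_identical_rows[of k j]) (auto simp: row_def vec_eq_iff)
    then show ?thesis
      using False by simp
  qed
  finally show ?thesis .
qed

text \<open>The two transpositions turn the identity from the right into one from the left, valid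
  over any commutative ring and in particular over polynomials.\<close>

definition adjugate :: "'a :: comm_ring_1 ^ 'n ^ 'n \<Rightarrow> 'a ^ 'n ^ 'n" where
  "adjugate A = transpose (cofactor_mat (transpose A))"

lemma adjugate_nth:
  "adjugate A $ i $ j = det (\<chi> r. if r = i then axis j 1 else transpose A $ r)"
  by (simp add: adjugate_def cofactor_mat_def transpose_def[of "\<chi> i. F i" for F])

lemma adjugate_mult: "(\<Sum>i\<in>UNIV. adjugate A $ j $ i * A $ i $ k) = (if j = k then det A else 0)"
  using matrix_mult_cofactor_mat[of "transpose A" k j]
  by (simp add: adjugate_def transpose_def mult.commute det_transpose[unfolded transpose_def] cong: sum.cong)

lemma map_matrix_adjugate:
  fixes h :: "'a :: comm_ring_1 \<Rightarrow> 'b :: comm_ring_1"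
  assumes "\<And>x y. h (x + y) = h x + h y" "\<And>x y. h (x * y) = h x * h y" "h 1 = 1"
  shows "map_matrix h (adjugate A) = adjugate (map_matrix h A)"
proof -
  have zero: "h 0 = 0"
    using assms(1)[of 0 0] by simp
  have "h (det (\<chi> r. if r = j then axis i 1 else transpose A $ r)) =
      det (\<chi> r. if r = j then axis i 1 else transpose (map_matrix h A) $ r)" for i j
  proof (subst det_hom[of h, OF assms, symmetric], rule arg_cong[of _ _ det])
  qed (auto simp: vec_eq_iff axis_def transpose_def zero assms)
  then show ?thesis
    by (simp add: vec_eq_iff adjugate_nth)
qed

text \<open>Dividing \<open>adjugate_mult\<close> by the determinant gives a left inverse, which
  over a field is also a right inverse.\<close>

lemma matrix_mult_adjugate:
  fixes A :: "'a :: field ^ 'n ^ 'n"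
  assumes "det A \<noteq> 0"
  shows "(\<Sum>i\<in>UNIV. A $ j $ i * adjugate A $ i $ k) = (if j = k then det A else 0)"
proof -
  define B where "B = (\<chi> i j. adjugate A $ i $ j / det A)"
  have "B ** A = mat 1"
  proof (subst vec_eq_iff, intro allI, subst vec_eq_iff, intro allI)
    fix i j
    have "(B ** A) $ i $ j = (\<Sum>k\<in>UNIV. adjugate A $ i $ k * A $ k $ j) / det A"
      by (simp add: matrix_matrix_mult_def B_def sum_divide_distrib)
    then show "(B ** A) $ i $ j = mat 1 $ i $ j"
      using assms by (simp add: adjugate_mult mat_def)
  qed
  then have "A ** B = mat 1"
    by (simp add: matrix_left_right_inverse)
  then have "(A ** B) $ j $ k = mat 1 $ j $ k"
    by simp
  moreover have "(A ** B) $ j $ k = (\<Sum>i\<in>UNIV. A $ j $ i * adjugate A $ i $ k) / det A"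
    by (simp add: matrix_matrix_mult_def B_def sum_divide_distrib)
  ultimately show ?thesis
    using assms by (auto simp: mat_def field_simps split: if_splits)
qed

text \<open>Associativity of row times matrix times column, used below to rearrange matrix
  products.\<close>

lemma sum_mult_sum:
  fixes a :: "'i \<Rightarrow> 'r :: comm_ring_1"
  shows "(\<Sum>s\<in>S. a s * (\<Sum>t\<in>T. b s t * c t)) = (\<Sum>t\<in>T. (\<Sum>s\<in>S. a s * b s t) * c t)"
  by (simp add: sum_distrib_left sum_distrib_right mult.assoc) (rule sum.swap)

subsection \<open>The auxiliary function\<close>

text \<open>The hypotheses of the theorem with all negative twists removed: \<open>psi_eq\<close> is
  the functional equation twisted once, and \<open>det_Phi\<close> speaks of the
  \<open>i\<close>-fold twist of \<open>\<Phi>\<close> at \<open>\<gamma>\<close> instead of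
  \<open>\<Phi>\<close> at a root of \<open>\<gamma>\<close>.\<close>

locale vadic_system = filtered \<pi> \<iota> Kvbar Kbar q R C B
  for \<pi> :: "'a :: {field, finite} poly" and \<iota> :: "'a poly fract \<Rightarrow> 'c :: {field, complete_space}"
    and Kvbar Kbar :: "'c set" and q :: nat and R :: "nat \<Rightarrow> 'c set" and C :: nat and B :: real +
  fixes \<Phi> :: "'c poly ^ 'l ^ 'l" and \<psi> :: "'c fps ^ 'l" and \<gamma> :: 'c and \<rho> :: "'c ^ 'l" and d :: nat
  assumes Phi_coeff: "Polynomial.coeff (\<Phi> $ r $ s) i \<in> R 1"
    and Phi_degree: "Polynomial.degree (\<Phi> $ r $ s) \<le> d"
    and gamma_R: "\<gamma> \<in> R 1"
    and rho_R: "\<rho> $ r \<in> R 1"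
    and psi_bounded: "0 < T \<Longrightarrow> \<exists>b\<ge>1. \<forall>r. bounded_at (\<psi> $ r) T b"
    and psi_eq: "\<psi> $ r = ffr 1 (\<Sum>s\<in>UNIV. fps_of_poly (\<Phi> $ r $ s) * \<psi> $ s)"
    and gamma_nz: "\<gamma> \<noteq> 0"
    and gamma_distinct: "i < j \<Longrightarrow> fr i \<gamma> \<noteq> fr j \<gamma>"
    and det_Phi: "0 < i \<Longrightarrow> det (map_matrix (\<lambda>p. poly (pfr i p) \<gamma>) \<Phi>) \<noteq> 0"
    and rho_vanishes: "vanishes (\<Sum>r\<in>UNIV. fps_const (\<rho> $ r) * \<psi> $ r) \<gamma>"
    and rho_nz: "\<rho> \<noteq> 0"
    and R_Kbar: "R n \<subseteq> Kbar"
begin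

definition pb :: "nat \<Rightarrow> nat \<Rightarrow> 'c poly \<Rightarrow> bool" where
  "pb h n p \<longleftrightarrow> (\<forall>i. Polynomial.coeff p i \<in> R h) \<and> Polynomial.degree p \<le> n"

lemma pb_mono: "pb h n p \<Longrightarrow> h \<le> h' \<Longrightarrow> n \<le> n' \<Longrightarrow> pb h' n' p"
  unfolding pb_def using R_mono by (meson order_trans)

lemma pb_mult: "pb h n p \<Longrightarrow> pb h' n' r \<Longrightarrow> pb (h + h') (n + n') (p * r)"
  unfolding pb_def by (auto simp: coeff_mult intro!: R_sum R_mult intro: order_trans[OF degree_mult_le])

lemma pb_sum: "(\<And>i. i \<in> A \<Longrightarrow> pb h n (f i)) \<Longrightarrow> pb h n (\<Sum>i\<in>A. f i)"
  unfolding pb_def by (cases "finite A") (auto simp: Polynomial.coeff_sum R_0 intro!: R_sum degree_sum_le)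

lemma pb_pfr: "pb h n p \<Longrightarrow> pb (q ^ k * h) n (pfr k p)"
  unfolding pb_def using R_power by (auto simp: fr_def)

lemma pb_poly:
  assumes "pb h n p" "x \<in> R k"
  shows "poly p x \<in> R (h + n * k)"
  unfolding poly_altdef
proof (rule R_sum)
  fix i assume "i \<in> {..Polynomial.degree p}"
  then have i: "i \<le> n"
    using assms(1) by (simp add: pb_def)
  have "Polynomial.coeff p i * x ^ i \<in> R (h + i * k)"
    using assms by (intro R_mult R_power) (auto simp: pb_def)
  then show "Polynomial.coeff p i * x ^ i \<in> R (h + n * k)"
    by (rule R_mono[rotated]) (use i in simp)
qed

text \<open>\<open>\<psi> = G m \<psi>\<^sup>(\<^sup>m\<^sup>)\<close> for every \<open>m\<close>; evaluating at \<open>\<gamma>\<close>, the relation \<open>\<rho>\<psi>(\<gamma>) = 0\<close> becomes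
  a relation for \<open>\<psi>\<^sup>(\<^sup>m\<^sup>)(\<gamma>)\<close> with coefficients \<open>w m = \<rho> G m(\<gamma>)\<close>.\<close>

primrec G :: "nat \<Rightarrow> 'c poly ^ 'l ^ 'l" where
  "G 0 = mat 1"
| "G (Suc m) = G m ** map_matrix (pfr (Suc m)) \<Phi>"

lemma psi_G: "\<psi> $ r = (\<Sum>s\<in>UNIV. fps_of_poly (G m $ r $ s) * ffr m (\<psi> $ s))"
proof (induction m)
  case 0
  have "fps_of_poly (G 0 $ r $ s) * \<psi> $ s = (if s = r then \<psi> $ s else 0)" for s
    by (simp add: mat_def)
  then show ?case
    by simp
next
  case (Suc m)
  have "ffr m (\<psi> $ s) = (\<Sum>t\<in>UNIV. fps_of_poly (pfr (Suc m) (\<Phi> $ s $ t)) * ffr (Suc m) (\<psi> $ t))" for s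
    by (subst psi_eq) (simp add: ffr_ffr ffr_sum ffr_mult fps_of_poly_pfr)
  then have "\<psi> $ r = (\<Sum>s\<in>UNIV. fps_of_poly (G m $ r $ s) *
      (\<Sum>t\<in>UNIV. fps_of_poly (pfr (Suc m) (\<Phi> $ s $ t)) * ffr (Suc m) (\<psi> $ t)))"
    using Suc by simp
  then show ?case
    by (simp add: sum_mult_sum matrix_matrix_mult_def fps_of_poly_sum fps_of_poly_mult)
qed

lemma ffr_psi_G: "ffr k (\<psi> $ r) = (\<Sum>s\<in>UNIV. fps_of_poly (pfr k (G m $ r $ s)) * ffr (k + m) (\<psi> $ s))"
proof -
  have "ffr k (\<psi> $ r) = ffr k (\<Sum>s\<in>UNIV. fps_of_poly (G m $ r $ s) * ffr m (\<psi> $ s))"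
    using psi_G[of r m] by simp
  then show ?thesis
    by (simp add: ffr_sum ffr_mult fps_of_poly_pfr ffr_ffr)
qed

lemma pb_G: "pb (2 * q ^ m) (m * d) (G m $ r $ s)"
proof (induction m arbitrary: r s)
  case 0
  show ?case
    by (simp add: pb_def mat_def R_0 R_1)
next
  case (Suc m)
  \<comment> \<open>As \<open>q\<close> is at least \<open>2\<close>, the heights of the successive
    twisted factors add up like a geometric series; the factor \<open>2\<close> in the bound absorbs
    all of them.\<close>
  have q: "2 * q ^ m \<le> q ^ Suc m"
    using q_gt_1 by simp
  have "pb (q ^ Suc m * 1) d (pfr (Suc m) (\<Phi> $ t $ s))" for t
    by (rule pb_pfr) (unfold pb_def, blast intro: Phi_coeff Phi_degree)
  then have "pb (2 * q ^ m + q ^ Suc m * 1) (m * d + d) (G m $ r $ t * pfr (Suc m) (\<Phi> $ t $ s))" for t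
    by (rule pb_mult[OF Suc])
  then have "pb (2 * q ^ Suc m) (Suc m * d) (G m $ r $ t * pfr (Suc m) (\<Phi> $ t $ s))" for t
    by (rule pb_mono) (use q in auto)
  then show ?case
    by (simp add: matrix_matrix_mult_def pb_sum)
qed

definition w :: "nat \<Rightarrow> 'l \<Rightarrow> 'c" where
  "w m s = (\<Sum>r\<in>UNIV. \<rho> $ r * poly (G m $ r $ s) \<gamma>)"

lemma less_power_q: "m < q ^ m"
  using q_gt_1 by (simp add: power_gt_expt)

text \<open>The level depends on \<open>m + j\<close> only. With \<open>m = s - j\<close> all
  coefficient rows in the linear system below therefore have the same height, of order
  \<open>q ^ s\<close>.\<close>

lemma fr_w_R: "fr j (w m s) \<in> R ((d + 3) * q ^ (m + j))"
proof -
  have "\<rho> $ r * poly (G m $ r $ s) \<gamma> \<in> R (1 + (2 * q ^ m + m * d * 1))" for r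
    by (intro R_mult rho_R pb_poly pb_G gamma_R)
  then have "w m s \<in> R (1 + (2 * q ^ m + m * d * 1))"
    unfolding w_def by (rule R_sum)
  then have "fr j (w m s) \<in> R (q ^ j * (1 + (2 * q ^ m + m * d * 1)))"
    unfolding fr_def by (rule R_power)
  moreover have "m * d \<le> q ^ m * d"
    using less_power_q[of m] by simp
  then have "1 + (2 * q ^ m + m * d * 1) \<le> (d + 3) * q ^ m"
    unfolding add_mult_distrib mult.commute[of d] mult_1_right using less_power_q[of m] by linarith
  then have "q ^ j * (1 + (2 * q ^ m + m * d * 1)) \<le> (d + 3) * q ^ (m + j)"
    using mult_le_mono2[of "1 + (2 * q ^ m + m * d * 1)" "(d + 3) * q ^ m" "q ^ j"]
    by (simp add: power_add mult_ac)
  ultimately show ?thesis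
    by (rule R_mono[rotated])
qed

lemma det_G: "det (map_matrix (\<lambda>p. poly p \<gamma>) (G m)) \<noteq> 0"
proof (induction m)
  case 0
  have "map_matrix (\<lambda>p. poly p \<gamma>) (G 0) = mat 1"
    by (simp add: vec_eq_iff mat_def)
  then show ?case
    by simp
next
  case (Suc m)
  have "map_matrix (\<lambda>p. poly p \<gamma>) (G (Suc m)) =
      map_matrix (\<lambda>p. poly p \<gamma>) (G m) ** map_matrix (\<lambda>p. poly (pfr (Suc m) p) \<gamma>) \<Phi>"
    by (simp add: vec_eq_iff matrix_matrix_mult_def poly_sum)
  then show ?case
    using Suc det_Phi[of "Suc m"] by (simp add: det_mul)
qed

text \<open>The row \<open>\<rho>\<close> can be recovered from \<open>w m\<close> up to a nonzero
  factor by the adjugate of the invertible matrix \<open>G m\<close> at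
  \<open>\<gamma>\<close>.\<close>

lemma w_nz: "\<exists>s. w m s \<noteq> 0"
proof (rule ccontr)
  assume "\<not> ?thesis"
  then have w0: "w m s = 0" for s
    by simp
  let ?A = "map_matrix (\<lambda>p. poly p \<gamma>) (G m)"
  have "\<rho> $ t = 0" for t
  proof -
    have "0 = (\<Sum>s\<in>UNIV. w m s * adjugate ?A $ s $ t)"
      by (simp add: w0)
    also have "\<dots> = (\<Sum>s\<in>UNIV. (\<Sum>r\<in>UNIV. \<rho> $ r * ?A $ r $ s) * adjugate ?A $ s $ t)"
      by (simp add: w_def)
    also have "\<dots> = (\<Sum>r\<in>UNIV. \<rho> $ r * (\<Sum>s\<in>UNIV. ?A $ r $ s * adjugate ?A $ s $ t))"
      by (rule sum_mult_sum[symmetric])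
    also have "\<dots> = \<rho> $ t * det ?A"
      by (subst matrix_mult_adjugate[OF det_G]) (simp add: if_distrib cong: if_cong)
    finally show ?thesis
      using det_G[of m] by simp
  qed
  then show False
    using rho_nz by (simp add: vec_eq_iff)
qed

lemma ffr_psi_bounded:
  assumes "0 < T"
  shows "\<exists>b\<ge>1. \<forall>r. bounded_at (ffr k (\<psi> $ r)) (T ^ (q ^ k)) (b ^ (q ^ k))"
  using psi_bounded[OF assms] bounded_at_ffr[of _ T] assms by (meson less_imp_le)

lemma vanishes_psi_poly_iff:
  "vanishes (\<Sum>r\<in>UNIV. fps_of_poly (p r) * ffr k (\<psi> $ r)) z \<longleftrightarrow>
    vanishes (\<Sum>r\<in>UNIV. fps_const (poly (p r) z) * ffr k (\<psi> $ r)) z"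
proof -
  define T where "T = 1 + vabs z"
  have T: "1 \<le> T"
    by (simp add: T_def vabs_nonneg)
  obtain b where b: "\<And>r. bounded_at (ffr k (\<psi> $ r)) (T ^ (q ^ k)) (b ^ (q ^ k))"
    using ffr_psi_bounded[of T k] T by auto
  have "T ^ 1 \<le> T ^ (q ^ k)"
    using T q_gt_1 by (intro power_increasing) auto
  then have "vabs z < T ^ (q ^ k)" "1 \<le> T ^ (q ^ k)"
    using T by (auto simp: T_def one_le_power)
  then show ?thesis
    using b by (intro vanishes_poly_mult_iff) auto
qed

lemma vanishes_fr_w:
  "vanishes (\<Sum>s\<in>UNIV. fps_const (fr j (w m s)) * ffr (j + m) (\<psi> $ s)) (fr j \<gamma>)"
proof -
  have "(\<Sum>r\<in>UNIV. fps_const (\<rho> $ r) * \<psi> $ r) =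
      (\<Sum>r\<in>UNIV. fps_const (\<rho> $ r) * (\<Sum>s\<in>UNIV. fps_of_poly (G m $ r $ s) * ffr m (\<psi> $ s)))"
    by (subst psi_G[of _ m]) (rule refl)
  also have "\<dots> = (\<Sum>s\<in>UNIV. fps_of_poly (\<Sum>r\<in>UNIV. [:\<rho> $ r:] * G m $ r $ s) * ffr m (\<psi> $ s))"
    by (simp only: sum_mult_sum fps_of_poly_sum fps_of_poly_mult fps_of_poly_const)
  finally have "vanishes (\<Sum>s\<in>UNIV. fps_of_poly (\<Sum>r\<in>UNIV. [:\<rho> $ r:] * G m $ r $ s) * ffr m (\<psi> $ s)) \<gamma>"
    using rho_vanishes by simp
  then have "vanishes (\<Sum>s\<in>UNIV. fps_const (w m s) * ffr m (\<psi> $ s)) \<gamma>"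
    unfolding vanishes_psi_poly_iff by (simp add: w_def poly_sum)
  from vanishes_ffr[OF this, of j] show ?thesis
    by (simp add: ffr_sum ffr_mult ffr_const ffr_ffr)
qed

end

section \<open>Construction of the auxiliary function and the upper bound from its zeros\<close>

context vadic_system
begin

text \<open>The unknowns are the coefficients of \<open>Q\<close> together with the multipliers
  \<open>c j\<close>. Admitting the multipliers, instead of prescribing values, is what leaves more
  unknowns than equations although \<open>L < N\<close>.\<close>

lemma ex_auxiliary_polys:
  assumes N: "N = 2 * CARD('l) * N'" and L: "L + N' = N" and N': "0 < N'" and s: "s = 2 * N"
  obtains Q :: "'l \<Rightarrow> 'c poly" and c :: "nat \<Rightarrow> 'c" where
    "\<And>r i. Polynomial.coeff (Q r) i \<in> R (siegel_const (2 * CARD('l)) * ((d + 3) * q ^ s))"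
    "\<And>r i. L \<le> i \<Longrightarrow> Polynomial.coeff (Q r) i = 0"
    "\<And>j r. j < N \<Longrightarrow> poly (Q r) (fr j \<gamma>) = c j * fr j (w (s - j) r)"
    "\<exists>r. Q r \<noteq> 0"
proof -
  let ?I = "((UNIV :: 'l set) \<times> {..<L}) <+> {..<N}" and ?J = "(UNIV :: 'l set) \<times> {..<N}"
  let ?h = "(d + 3) * q ^ s" and ?u = "2 * CARD('l)"
  let ?D = "siegel_const ?u * ?h"
  \<comment> \<open>Left summands of the index type stand for coefficients of \<open>Q\<close>,
    right summands for the multipliers. Row \<open>(r, j)\<close> expresses the condition on
    \<open>Q r\<close> at the point \<open>fr j \<gamma>\<close>.\<close>
  define e where "e y i = (case i of
      Inl (r, k) \<Rightarrow> if fst y = r then (fr (snd y) \<gamma>) ^ k else 0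
    | Inr j \<Rightarrow> if snd y = j then - fr (snd y) (w (s - snd y) (fst y)) else 0)"
    for y :: "'l \<times> nat" and i :: "'l \<times> nat + nat"
  have fin: "finite ?I" "finite ?J"
    by auto
  obtain k where k: "CARD('l) = Suc k"
    using not0_implies_Suc[of "CARD('l)"] by auto
  have Lk: "L = (2 * k + 1) * N'"
    using L N by (simp add: k algebra_simps)
  \<comment> \<open>With \<open>l = CARD('l)\<close> there are
    \<open>l * L + N = (l + 1/2) * N\<close> unknowns and \<open>l * N\<close> equations, so the
    ratio is exactly \<open>1 + 1 / (2 * l)\<close>.\<close>
  have "(?u + 1) * card ?J = ?u * card ?I"
    by (simp add: card_Plus card_cartesian_product k N Lk algebra_simps)
  then have card: "(?u + 1) * card ?J \<le> ?u * card ?I"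
    by simp
  have "0 \<in> {..<N}"
    using N N' by simp
  then have ne: "?I \<noteq> {}"
    by blast
  have e_R: "e y i \<in> R ?h" if i: "i \<in> ?I" and y: "y \<in> ?J" for i y
  proof (cases i)
    case (Inl rk)
    obtain r k where rk: "rk = (r, k)" "k < L"
      using i Inl by auto
    have j: "snd y < N"
      using y by auto
    have "\<gamma> ^ (q ^ snd y) \<in> R (q ^ snd y * 1)"
      by (rule R_power[OF gamma_R])
    then have "(fr (snd y) \<gamma>) ^ k \<in> R (k * (q ^ snd y * 1))"
      unfolding fr_def by (rule R_power)
    \<comment> \<open>This is where \<open>s = 2 * N\<close> enters: both the exponent
      \<open>k\<close> and \<open>q ^ snd y\<close> are at most \<open>q ^ N\<close>.\<close>
    moreover have "k * (q ^ snd y * 1) \<le> ?h"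
    proof -
      have "k \<le> q ^ N"
        using rk(2) L less_power_q[of N] by linarith
      moreover have "q ^ snd y \<le> q ^ N"
        using j q_gt_1 by (intro power_increasing) auto
      ultimately have "k * (q ^ snd y * 1) \<le> q ^ N * q ^ N"
        unfolding mult_1_right by (rule mult_le_mono)
      also have "\<dots> = 1 * q ^ s"
        by (simp add: s mult_2 power_add)
      also have "\<dots> \<le> ?h"
        by (rule mult_le_mono1) simp
      finally show ?thesis .
    qed
    ultimately have "(fr (snd y) \<gamma>) ^ k \<in> R ?h"
      by (rule R_mono[rotated])
    then show ?thesis
      using R_0 by (simp add: e_def Inl rk)
  next
    case (Inr j)
    have "snd y < N"
      using y by auto
    then have "s - snd y + snd y = s"
      using s by simp
    then have "fr (snd y) (w (s - snd y) (fst y)) \<in> R ?h"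
      using fr_w_R[of "snd y" "s - snd y" "fst y"] by simp
    then have "- fr (snd y) (w (s - snd y) (fst y)) \<in> R ?h"
      by (rule R_minus)
    then show ?thesis
      unfolding e_def Inr sum.case by (cases "snd y = j") (simp_all add: R_0)
  qed
  have "0 < ?u"
    by simp
  have "\<exists>x. (\<forall>i\<in>?I. x i \<in> R ?D) \<and> (\<exists>i\<in>?I. x i \<noteq> 0) \<and> (\<forall>y\<in>?J. (\<Sum>i\<in>?I. e y i * x i) = 0)"
    using siegel[where c = e and h = ?h and u = ?u, OF fin \<open>0 < ?u\<close> card ne] e_R by blast
  then obtain x where
    "(\<forall>i\<in>?I. x i \<in> R ?D) \<and> (\<exists>i\<in>?I. x i \<noteq> 0) \<and> (\<forall>y\<in>?J. (\<Sum>i\<in>?I. e y i * x i) = 0)" ..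
  note x = this[THEN conjunct1, THEN bspec] this[THEN conjunct2, THEN conjunct1]
    this[THEN conjunct2, THEN conjunct2, THEN bspec]
  define Q where "Q r = (\<Sum>k<L. Polynomial.monom (x (Inl (r, k))) k)" for r
  have Qc: "Polynomial.coeff (Q r) i = (if i < L then x (Inl (r, i)) else 0)" for r i
    by (auto simp: Q_def Polynomial.coeff_sum if_distrib cong: if_cong)
  have Q_eval: "poly (Q r) (fr j \<gamma>) = x (Inr j) * fr j (w (s - j) r)" if j: "j < N" for j r
  proof -
    have "0 = (\<Sum>i\<in>?I. e (r, j) i * x i)"
      using x(3)[of "(r, j)"] j by simp
    also have "\<dots> = (\<Sum>(r', k)\<in>UNIV \<times> {..<L}. e (r, j) (Inl (r', k)) * x (Inl (r', k))) +
        (\<Sum>j'<N. e (r, j) (Inr j') * x (Inr j'))"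
      by (subst sum.Plus) (simp_all add: comp_def case_prod_unfold)
    also have "(\<Sum>(r', k)\<in>UNIV \<times> {..<L}. e (r, j) (Inl (r', k)) * x (Inl (r', k))) =
        (\<Sum>r'\<in>UNIV. \<Sum>k<L. e (r, j) (Inl (r', k)) * x (Inl (r', k)))"
      by (rule sum.cartesian_product[symmetric])
    also have "\<dots> = (\<Sum>r'\<in>UNIV. if r' = r then \<Sum>k<L. (fr j \<gamma>) ^ k * x (Inl (r, k)) else 0)"
      by (rule sum.cong) (auto simp: e_def)
    also have "\<dots> = (\<Sum>k<L. (fr j \<gamma>) ^ k * x (Inl (r, k)))"
      by simp
    also have "\<dots> = poly (Q r) (fr j \<gamma>)"
      by (simp add: Q_def poly_sum poly_monom mult.commute)
    also have "(\<Sum>j'<N. e (r, j) (Inr j') * x (Inr j')) =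
        (\<Sum>j'<N. if j' = j then - fr j (w (s - j) r) * x (Inr j) else 0)"
      by (rule sum.cong) (auto simp: e_def)
    also have "\<dots> = - fr j (w (s - j) r) * x (Inr j)"
      using j by simp
    finally show ?thesis
      by (simp add: mult.commute)
  qed
  \<comment> \<open>If \<open>Q\<close> were zero, the nonvanishing of the rows \<open>w\<close>
    would force all multipliers to be zero too, against the nontriviality of the solution.\<close>
  have "\<exists>r. Q r \<noteq> 0"
  proof (rule ccontr)
    assume "\<not> ?thesis"
    then have Q0: "Q r = 0" for r
      by simp
    have "x (Inl (r, k)) = 0" if "k < L" for r k
      using Qc[of r k] Q0[of r] that by simp
    moreover have "x (Inr j) = 0" if j: "j < N" for j
    proof -
      obtain r where "w (s - j) r \<noteq> 0"
        using w_nz by blast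
      then show ?thesis
        using Q_eval[OF j, of r] Q0[of r] by simp
    qed
    ultimately show False
      using x(2) by auto
  qed
  moreover have "Polynomial.coeff (Q r) i \<in> R ?D" for r i
    unfolding Qc by (cases "i < L") (auto intro!: x(1) R_0)
  ultimately show ?thesis
    using that[of Q "\<lambda>j. x (Inr j)"] Qc Q_eval by simp
qed

lemma auxiliary_vanishes:
  assumes "\<And>r. poly (Q r) (fr j \<gamma>) = c * fr j (w m r)"
  shows "vanishes (\<Sum>r\<in>UNIV. fps_of_poly (Q r) * ffr (j + m) (\<psi> $ r)) (fr j \<gamma>)"
proof -
  have "(\<Sum>r\<in>UNIV. fps_const (poly (Q r) (fr j \<gamma>)) * ffr (j + m) (\<psi> $ r)) =
      fps_const c * (\<Sum>r\<in>UNIV. fps_const (fr j (w m r)) * ffr (j + m) (\<psi> $ r))"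
    by (simp add: assms sum_distrib_left mult.assoc flip: fps_const_mult)
  then show ?thesis
    unfolding vanishes_psi_poly_iff using vanishes_const_mult[OF vanishes_fr_w] by simp
qed

lemma sum_power_less: "(\<Sum>j<N. q ^ j) < q ^ N"
proof (induction N)
  case (Suc N)
  have "2 * q ^ N \<le> q * q ^ N"
    by (rule mult_le_mono1) (use q_gt_1 in simp)
  then show ?case
    unfolding sum.lessThan_Suc power_Suc using Suc by linarith
qed simp

text \<open>Schwarz's lemma on radius \<open>T = 2 ^ (q ^ s)\<close> divides by
  \<open>T ^ N\<close>, while the degree of \<open>Q\<close> costs only \<open>T ^ L\<close>. The
  surplus \<open>N - L = N'\<close> leaves the factor \<open>(2 ^ N') ^ (q ^ s)\<close>; everything
  else is a constant to the power \<open>q ^ s\<close>.\<close>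

lemma vabs_auxiliary_le:
  assumes L: "L + N' = N" and s: "s = 2 * N"
    and Q: "\<And>r i. Polynomial.coeff (Q r) i \<in> R (k * q ^ s)" "\<And>r i. L \<le> i \<Longrightarrow> Polynomial.coeff (Q r) i = 0"
    and zeros: "\<And>j. j < N \<Longrightarrow> vanishes H (fr j \<gamma>)"
    and H: "H = (\<Sum>r\<in>UNIV. fps_of_poly (Q r) * ffr s (\<psi> $ r))" "H \<noteq> 0"
    and b: "1 \<le> b" "\<And>r. bounded_at (\<psi> $ r) 2 b"
    and g: "g = max 1 (vabs \<gamma>)" "g < 2 ^ (q ^ N)"
  shows "vabs (fps_nth H (subdegree H)) * (2 ^ N') ^ (q ^ s) \<le> (g * B ^ (k + 1) * b) ^ (q ^ s)"
proof -
  define T :: real where "T = 2 ^ (q ^ s)"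
  have T: "1 \<le> T"
    by (simp add: T_def)
  have g1: "1 \<le> g" "vabs \<gamma> \<le> g"
    by (auto simp: g)
  have qs: "1 \<le> q ^ s"
    using q_gt_1 by simp
  let ?Z = "(\<lambda>j. fr j \<gamma>) ` {..<N}"
  have inj: "inj_on (\<lambda>j. fr j \<gamma>) {..<N}"
    using gamma_distinct by (auto simp: inj_on_def) (metis linorder_neqE_nat)
  have "bounded_at (fps_of_poly (Q r) * ffr s (\<psi> $ r)) T (B ^ (k * q ^ s + 1) * T ^ L * b ^ (q ^ s))" for r
    unfolding T_def using T Q
    by (intro bounded_at_mult bounded_at_poly bounded_at_ffr b(2) R_vabs) (auto simp: T_def)
  then have bdd: "bounded_at H T (B ^ (k * q ^ s + 1) * T ^ L * b ^ (q ^ s))"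
    unfolding H(1) using T B_ge_1 b by (intro bounded_at_sum) auto
  \<comment> \<open>All zeros lie in the disc because \<open>T\<close> equals
    \<open>(2 ^ (q ^ N)) ^ (q ^ N)\<close> for \<open>s = 2 * N\<close>.\<close>
  have "vabs (fr j \<gamma>) < T" if "j < N" for j
  proof -
    have "vabs (fr j \<gamma>) \<le> g ^ (q ^ j)"
      unfolding vabs_fr using g1 by (intro power_mono) (auto simp: vabs_nonneg)
    also have "\<dots> \<le> g ^ (q ^ N)"
      using g1 q_gt_1 that by (intro power_increasing) auto
    also have "\<dots> < (2 ^ (q ^ N)) ^ (q ^ N)"
      using g g1 q_gt_1 by (intro power_strict_mono) auto
    also have "\<dots> = T"
      by (simp add: T_def s mult_2 power_add flip: power_mult)
    finally show ?thesis .
  qed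
  then have le: "vabs (fps_nth H (subdegree H)) \<le>
      (\<Prod>z\<in>?Z. vabs z) * (B ^ (k * q ^ s + 1) * T ^ L * b ^ (q ^ s)) / T ^ card ?Z"
    using zeros gamma_nz by (intro vabs_lowest_coeff_le[OF _ bdd H(2) T]) auto
  have "(\<Prod>z\<in>?Z. vabs z) = (\<Prod>j<N. vabs \<gamma> ^ (q ^ j))"
    by (subst prod.reindex[OF inj]) (simp add: vabs_fr comp_def)
  also have "\<dots> \<le> (\<Prod>j<N. g ^ (q ^ j))"
    using g1 by (intro prod_mono conjI power_mono) (auto simp: vabs_nonneg)
  also have "\<dots> = g ^ (\<Sum>j<N. q ^ j)"
    by (rule power_sum[symmetric])
  also have "\<dots> \<le> g ^ (q ^ s)"
  proof (rule power_increasing[OF _ g1(1)])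
    have "q ^ N \<le> q ^ s"
      using q_gt_1 s by (intro power_increasing) auto
    then show "(\<Sum>j<N. q ^ j) \<le> q ^ s"
      using sum_power_less[of N] by linarith
  qed
  finally have prod: "(\<Prod>z\<in>?Z. vabs z) \<le> g ^ (q ^ s)" .
  have Bk: "B ^ (k * q ^ s + 1) \<le> (B ^ (k + 1)) ^ (q ^ s)"
    unfolding power_mult[symmetric] using B_ge_1 qs by (intro power_increasing) (auto simp: algebra_simps)
  have TN: "T ^ N = T ^ L * (2 ^ N') ^ (q ^ s)"
    unfolding T_def L[symmetric] power_add by (simp add: mult.commute flip: power_mult)
  have pos: "0 < T ^ L"
    using T by simp
  have card: "card ?Z = N"
    by (simp add: card_image[OF inj])
  have "vabs (fps_nth H (subdegree H)) * T ^ N \<le>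
      (\<Prod>z\<in>?Z. vabs z) * (B ^ (k * q ^ s + 1) * T ^ L * b ^ (q ^ s))"
    using le T unfolding card by (simp add: pos_le_divide_eq)
  also have "\<dots> \<le> g ^ (q ^ s) * ((B ^ (k + 1)) ^ (q ^ s) * T ^ L * b ^ (q ^ s))"
    using prod Bk pos g1 b B_ge_1 by (intro mult_mono) auto
  also have "\<dots> = T ^ L * (g * B ^ (k + 1) * b) ^ (q ^ s)"
    by (simp only: power_mult_distrib mult_ac)
  finally have "T ^ L * (vabs (fps_nth H (subdegree H)) * (2 ^ N') ^ (q ^ s)) \<le>
      T ^ L * (g * B ^ (k + 1) * b) ^ (q ^ s)"
    unfolding TN by (simp only: mult_ac)
  then show ?thesis
    using pos by (simp only: mult_le_cancel_left_pos)
qed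

end

section \<open>Lower bounds from additive equations\<close>

context filtered
begin

text \<open>In the term with the lowest nonzero coefficient \<open>e j0\<close>, cancel
  \<open>x ^ (q ^ j0)\<close>: all other terms keep at least one factor \<open>x\<close>. So a small
  \<open>x\<close> would make \<open>e j0\<close> small, contradicting
  \<open>liouville\<close>.\<close>

lemma vabs_ge_of_frobenius_relation:
  assumes e: "\<And>j. j \<le> n \<Longrightarrow> e j \<in> R h" "\<exists>j\<le>n. e j \<noteq> 0"
    and rel: "(\<Sum>j\<le>n. e j * fr j x) = 0" and x: "x \<noteq> 0"
  shows "1 \<le> vabs x * (real q ^ (C * C * h) * B ^ (h + 1))"
proof (cases "vabs x < 1")
  case False
  have "1 \<le> real q ^ (C * C * h)" "1 \<le> B ^ (h + 1)"
    using q_gt_1 B_ge_1 by (simp_all add: one_le_power del: power_Suc)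
  then have "1 * (1 * 1) \<le> vabs x * (real q ^ (C * C * h) * B ^ (h + 1))"
    using False by (intro mult_mono) auto
  then show ?thesis
    by simp
next
  case True
  define j0 where "j0 = (LEAST j. j \<le> n \<and> e j \<noteq> 0)"
  have j0: "j0 \<le> n" "e j0 \<noteq> 0"
    using LeastI_ex[of "\<lambda>j. j \<le> n \<and> e j \<noteq> 0"] e(2) unfolding j0_def by auto
  have less: "e j = 0" if "j < j0" for j
    using not_less_Least[of j "\<lambda>j. j \<le> n \<and> e j \<noteq> 0"] that j0(1) unfolding j0_def by auto
  let ?S = "\<Sum>j\<in>{..n} - {j0}. e j * fr j x"
  have "e j0 * fr j0 x + ?S = 0"
    using rel sum.remove[of "{..n}" j0 "\<lambda>j. e j * fr j x"] j0(1) by simp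
  then have "vabs (e j0 * fr j0 x) = vabs ?S"
    by (metis add_eq_0_iff2 vabs_minus)
  also have "\<dots> \<le> B ^ (h + 1) * vabs x ^ (q ^ j0 + 1)"
  proof (rule vabs_sum_le)
    fix j assume j: "j \<in> {..n} - {j0}"
    show "vabs (e j * fr j x) \<le> B ^ (h + 1) * vabs x ^ (q ^ j0 + 1)"
    proof (cases "j < j0")
      case True
      then show ?thesis
        using B_ge_1 vabs_nonneg[of x] by (simp add: less)
    next
      case False
      then have "q ^ j0 < q ^ j"
        using j q_gt_1 by (intro power_strict_increasing) auto
      then have "vabs x ^ (q ^ j) \<le> vabs x ^ (q ^ j0 + 1)"
        using True by (intro power_decreasing) (auto simp: vabs_nonneg)
      then show ?thesis
        unfolding vabs_mult vabs_fr using R_vabs[OF e(1)[of j]] j B_ge_1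
        by (intro mult_mono) (auto simp: vabs_nonneg)
    qed
  qed (use B_ge_1 vabs_nonneg[of x] in auto)
  finally have "vabs x ^ (q ^ j0) * vabs (e j0) \<le> vabs x ^ (q ^ j0) * (B ^ (h + 1) * vabs x)"
    by (simp add: vabs_mult vabs_fr mult_ac)
  then have "vabs (e j0) \<le> B ^ (h + 1) * vabs x"
    using vabs_pos[OF x] by (simp only: mult_le_cancel_left_pos zero_less_power)
  moreover have "1 / real q ^ (C * C * h) \<le> vabs (e j0)"
    using liouville e(1) j0 by blast
  ultimately have "1 / real q ^ (C * C * h) \<le> B ^ (h + 1) * vabs x"
    by linarith
  then show ?thesis
    using q_gt_1 by (simp add: pos_divide_le_eq mult_ac)
qed

text \<open>All twists of \<open>H\<close> have the same subdegree. Let \<open>i\<close> be the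
  least index at which some \<open>a j\<close> has a nonzero coefficient; comparing coefficients at
  \<open>i + subdegree H\<close> leaves only the lowest terms.\<close>

lemma lowest_coeff_frobenius_relation:
  assumes a: "\<exists>j\<le>n. a j \<noteq> 0" and rel: "(\<Sum>j\<le>n. fps_of_poly (a j) * ffr j H) = 0"
  shows "\<exists>i. (\<exists>j\<le>n. Polynomial.coeff (a j) i \<noteq> 0) \<and>
    (\<Sum>j\<le>n. Polynomial.coeff (a j) i * fr j (fps_nth H (subdegree H))) = 0"
proof -
  let ?P = "\<lambda>i. \<exists>j\<le>n. Polynomial.coeff (a j) i \<noteq> 0"
  define i where "i = (LEAST i. ?P i)"
  have "\<exists>i. ?P i"
    using a by (metis leading_coeff_0_iff)
  then have i: "?P i"
    unfolding i_def by (rule LeastI_ex)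
  have less: "Polynomial.coeff (a j) k = 0" if "k < i" "j \<le> n" for j k
    using not_less_Least[of k ?P] that unfolding i_def by blast
  let ?m = "subdegree H"
  have "fps_nth (fps_of_poly (a j) * ffr j H) (i + ?m) = Polynomial.coeff (a j) i * fr j (fps_nth H ?m)"
    if j: "j \<le> n" for j
  proof -
    have "fps_nth (fps_of_poly (a j) * ffr j H) (i + ?m) =
        (\<Sum>k=0..i+?m. if k = i then Polynomial.coeff (a j) i * fr j (fps_nth H ?m) else 0)"
      unfolding fps_mult_nth
    proof (rule sum.cong[OF refl])
      fix k assume "k \<in> {0..i+?m}"
      then consider "k < i" | "k = i" | "i < k" "i + ?m - k < ?m"
        by fastforce
      then show "fps_nth (fps_of_poly (a j)) k * fps_nth (ffr j H) (i + ?m - k) =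
          (if k = i then Polynomial.coeff (a j) i * fr j (fps_nth H ?m) else 0)"
        using less[OF _ j] nth_less_subdegree_zero[of "i + ?m - k" H] by cases auto
    qed
    then show ?thesis
      by simp
  qed
  then have "(\<Sum>j\<le>n. Polynomial.coeff (a j) i * fr j (fps_nth H ?m)) =
      fps_nth (\<Sum>j\<le>n. fps_of_poly (a j) * ffr j H) (i + ?m)"
    unfolding fps_sum_nth by (intro sum.cong) auto
  then show ?thesis
    using i rel by auto
qed

end

section \<open>Dependence of the twists and vanishing of the auxiliary function\<close>

context vadic_system
begin

text \<open>The \<open>CARD('l) + 1\<close> twists of \<open>H\<close> are combinations of the \<open>CARD('l)\<close> entries of one twist
  of \<open>\<psi>\<close>, hence linearly dependent over the polynomials.\<close>

lemma ex_frobenius_relation: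
  assumes Q: "\<And>r i. Polynomial.coeff (Q r) i \<in> R (k * q ^ s)" "\<And>r i. L \<le> i \<Longrightarrow> Polynomial.coeff (Q r) i = 0"
    and H: "H = (\<Sum>r\<in>UNIV. fps_of_poly (Q r) * ffr s (\<psi> $ r))"
  obtains a :: "nat \<Rightarrow> 'c poly" where
    "\<And>j i. j \<le> CARD('l) \<Longrightarrow>
      Polynomial.coeff (a j) i \<in> R (siegel_const (2 * CARD('l) + 1) * (q ^ CARD('l) * (k + 2)) * q ^ s)"
    "\<exists>j\<le>CARD('l). a j \<noteq> 0"
    "(\<Sum>j\<le>CARD('l). fps_of_poly (a j) * ffr j H) = 0"
proof -
  define l where "l = CARD('l)"
  have l: "0 < l"
    by (simp add: l_def)
  \<comment> \<open>These are the coordinates of the \<open>j\<close>-fold twist of \<open>H\<close>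
    with respect to the entries of the \<open>(s + l)\<close>-fold twist of \<open>\<psi>\<close>, a
    target common to all \<open>j \<le> l\<close>.\<close>
  define V where "V j r = (\<Sum>t\<in>UNIV. pfr j (Q t) * pfr (s + j) (G (l - j) $ t $ r))" for j r
  have V_H: "ffr j H = (\<Sum>r\<in>UNIV. fps_of_poly (V j r) * ffr (s + l) (\<psi> $ r))" if "j \<le> l" for j
  proof -
    have "ffr j H = (\<Sum>t\<in>UNIV. fps_of_poly (pfr j (Q t)) * ffr (s + j) (\<psi> $ t))"
      by (simp add: H ffr_sum ffr_mult fps_of_poly_pfr ffr_ffr add.commute)
    also have "\<dots> = (\<Sum>t\<in>UNIV. fps_of_poly (pfr j (Q t)) *
        (\<Sum>r\<in>UNIV. fps_of_poly (pfr (s + j) (G (l - j) $ t $ r)) * ffr (s + l) (\<psi> $ r)))"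
      using that by (subst ffr_psi_G[of "s + j" _ "l - j"]) simp
    finally show ?thesis
      by (simp only: sum_mult_sum V_def fps_of_poly_sum fps_of_poly_mult)
  qed
  let ?h = "q ^ l * (k + 2) * q ^ s"
  define M where "M = L + l * d + 1"
  have "pb ?h (L + l * d) (V j r)" if j: "j \<le> l" for j r
    unfolding V_def
  proof (rule pb_sum)
    fix t
    have "pb (k * q ^ s) L (Q t)"
      using Q by (auto simp: pb_def intro: degree_le)
    then have "pb (q ^ j * (k * q ^ s) + q ^ (s + j) * (2 * q ^ (l - j))) (L + (l - j) * d)
        (pfr j (Q t) * pfr (s + j) (G (l - j) $ t $ r))"
      by (intro pb_mult pb_pfr pb_G)
    moreover have "q ^ j * (k * q ^ s) + q ^ (s + j) * (2 * q ^ (l - j)) \<le> ?h"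
    proof -
      have "q ^ (s + j) * (2 * q ^ (l - j)) = 2 * q ^ l * q ^ s"
        using j by (simp add: mult_ac flip: power_add)
      moreover have "q ^ j \<le> q ^ l"
        using j q_gt_1 by (intro power_increasing) auto
      then have "q ^ j * (k * q ^ s) \<le> q ^ l * (k * q ^ s)"
        by (rule mult_le_mono1)
      moreover have "?h = q ^ l * (k * q ^ s) + 2 * q ^ l * q ^ s"
        by (simp add: algebra_simps)
      ultimately show ?thesis
        by linarith
    qed
    ultimately show "pb ?h (L + l * d) (pfr j (Q t) * pfr (s + j) (G (l - j) $ t $ r))"
      by (rule pb_mono) simp
  qed
  then have V_R: "Polynomial.coeff (V j r) i \<in> R ?h" and V_0: "M \<le> i \<Longrightarrow> Polynomial.coeff (V j r) i = 0"
    if "j \<le> l" for j r i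
    using that by (auto simp: pb_def M_def intro!: coeff_eq_0 dest: le_less_trans)
      (metis Suc_le_lessD coeff_eq_0 le_less_trans)
  \<comment> \<open>There are \<open>(l + 1) * L'\<close> unknowns and \<open>l * (L' + M)\<close>
    equations, so the choice \<open>L' = 2 * l * M\<close> makes the ratio
    \<open>1 + 1 / (2 * l + 1)\<close>. The degree \<open>L\<close> affects only the size of the
    system, not the level \<open>?h\<close>.\<close>
  define L' where "L' = 2 * l * M"
  let ?I = "{..l} \<times> {..<L'}" and ?J = "(UNIV :: 'l set) \<times> {..<L' + M}" and ?u = "2 * l + 1"
  \<comment> \<open>This is the convolution matrix of multiplication by \<open>V\<close>.
    Coefficients of the product from \<open>L' + M\<close> on vanish by themselves, since each
    \<open>V j r\<close> has fewer than \<open>M + 1\<close> coefficients.\<close>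
  define e where "e y i = (if snd i \<le> snd y then Polynomial.coeff (V (fst i) (fst y)) (snd y - snd i) else 0)"
    for y :: "'l \<times> nat" and i :: "nat \<times> nat"
  have "(?u + 1) * card ?J = ?u * card ?I"
    by (simp add: card_cartesian_product L'_def algebra_simps flip: l_def)
  then have card: "(?u + 1) * card ?J \<le> ?u * card ?I"
    by simp
  have "(0, 0) \<in> ?I"
    using l by (simp add: L'_def M_def)
  then have ne: "?I \<noteq> {}"
    by blast
  have e_R: "e y i \<in> R ?h" if "i \<in> ?I" for i y
    using V_R[of "fst i"] R_0 that by (auto simp: e_def)
  have fin: "finite ?I" "finite ?J" and u: "0 < ?u"
    by simp_all
  have "\<exists>x. (\<forall>i\<in>?I. x i \<in> R (siegel_const ?u * ?h)) \<and> (\<exists>i\<in>?I. x i \<noteq> 0) \<and>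
      (\<forall>y\<in>?J. (\<Sum>i\<in>?I. e y i * x i) = 0)"
    by (rule siegel[where c = e and h = ?h and u = ?u, OF fin u card ne]) (rule e_R)
  then obtain x where
    "(\<forall>i\<in>?I. x i \<in> R (siegel_const ?u * ?h)) \<and> (\<exists>i\<in>?I. x i \<noteq> 0) \<and>
      (\<forall>y\<in>?J. (\<Sum>i\<in>?I. e y i * x i) = 0)" ..
  note x = this[THEN conjunct1, THEN bspec] this[THEN conjunct2, THEN conjunct1]
    this[THEN conjunct2, THEN conjunct2, THEN bspec]
  define a where "a j = (\<Sum>i<L'. Polynomial.monom (x (j, i)) i)" for j
  have ac: "Polynomial.coeff (a j) i = (if i < L' then x (j, i) else 0)" for j i
    by (auto simp: a_def Polynomial.coeff_sum if_distrib cong: if_cong)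
  have aV: "(\<Sum>j\<le>l. a j * V j r) = 0" for r
  proof (rule poly_eqI)
    fix n
    have "Polynomial.coeff (\<Sum>j\<le>l. a j * V j r) n = (\<Sum>j\<le>l. \<Sum>i<L'. e (r, n) (j, i) * x (j, i))"
      unfolding Polynomial.coeff_sum
    proof (rule sum.cong[OF refl])
      fix j
      have "Polynomial.coeff (a j * V j r) n =
          (\<Sum>i<L'. Polynomial.coeff (Polynomial.monom (x (j, i)) i * V j r) n)"
        by (simp only: a_def sum_distrib_right Polynomial.coeff_sum)
      also have "\<dots> = (\<Sum>i<L'. e (r, n) (j, i) * x (j, i))"
        by (rule sum.cong) (auto simp: coeff_monom_mult e_def)
      finally show "Polynomial.coeff (a j * V j r) n = (\<Sum>i<L'. e (r, n) (j, i) * x (j, i))" .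
    qed
    also have "\<dots> = (\<Sum>i\<in>?I. e (r, n) i * x i)"
      by (simp add: sum.cartesian_product case_prod_unfold)
    also have "\<dots> = 0"
    proof (cases "n < L' + M")
      case True
      then show ?thesis
        using x(3)[of "(r, n)"] by simp
    next
      case False
      then have "e (r, n) i = 0" if "i \<in> ?I" for i
        using that V_0[of "fst i" "n - snd i" r] by (auto simp: e_def)
      then show ?thesis
        by simp
    qed
    finally show "Polynomial.coeff (\<Sum>j\<le>l. a j * V j r) n = Polynomial.coeff 0 n"
      by simp
  qed
  have "(\<Sum>j\<le>l. fps_of_poly (a j) * ffr j H) =
      (\<Sum>j\<le>l. fps_of_poly (a j) * (\<Sum>r\<in>UNIV. fps_of_poly (V j r) * ffr (s + l) (\<psi> $ r)))"
    by (intro sum.cong) (simp_all add: V_H)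
  also have "\<dots> = (\<Sum>r\<in>UNIV. fps_of_poly (\<Sum>j\<le>l. a j * V j r) * ffr (s + l) (\<psi> $ r))"
    by (simp only: sum_mult_sum fps_of_poly_sum fps_of_poly_mult)
  also have "\<dots> = 0"
    by (simp add: aV)
  finally have rel: "(\<Sum>j\<le>l. fps_of_poly (a j) * ffr j H) = 0" .
  have "\<exists>j\<le>l. a j \<noteq> 0"
  proof -
    obtain j i where "j \<le> l" "i < L'" "x (j, i) \<noteq> 0"
      using x(2) by auto
    then have "Polynomial.coeff (a j) i \<noteq> 0"
      by (simp add: ac)
    then show ?thesis
      using \<open>j \<le> l\<close> by (metis coeff_0)
  qed
  moreover have "Polynomial.coeff (a j) i \<in> R (siegel_const ?u * (q ^ l * (k + 2)) * q ^ s)" if "j \<le> l" for j i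
    using x(1)[of "(j, i)"] that R_0 by (simp add: ac mult.assoc)
  ultimately show ?thesis
    using that[of a] rel by (simp only: l_def)
qed

text \<open>Applies the bound for additive equations to the lowest coefficient of \<open>H\<close>.
  The number \<open>K\<close> is independent of \<open>s\<close>, so the whole loss is a constant to
  the power \<open>q ^ s\<close>, comparable with the upper bound.\<close>

lemma vabs_auxiliary_ge:
  fixes k s :: nat
  defines "K \<equiv> siegel_const (2 * CARD('l) + 1) * (q ^ CARD('l) * (k + 2))"
  assumes Q: "\<And>r i. Polynomial.coeff (Q r) i \<in> R (k * q ^ s)" "\<And>r i. L \<le> i \<Longrightarrow> Polynomial.coeff (Q r) i = 0"
    and H: "H = (\<Sum>r\<in>UNIV. fps_of_poly (Q r) * ffr s (\<psi> $ r))" "H \<noteq> 0"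
  shows "1 \<le> vabs (fps_nth H (subdegree H)) * (real q ^ (C * C * K) * B ^ (K + 1)) ^ (q ^ s)"
proof -
  let ?x = "fps_nth H (subdegree H)"
  obtain a where a: "\<And>j i. j \<le> CARD('l) \<Longrightarrow> Polynomial.coeff (a j) i \<in> R (K * q ^ s)"
    "\<exists>j\<le>CARD('l). a j \<noteq> 0" "(\<Sum>j\<le>CARD('l). fps_of_poly (a j) * ffr j H) = 0"
    unfolding K_def by (rule ex_frobenius_relation[OF Q H(1)]) blast+
  obtain i where i: "\<exists>j\<le>CARD('l). Polynomial.coeff (a j) i \<noteq> 0"
    "(\<Sum>j\<le>CARD('l). Polynomial.coeff (a j) i * fr j ?x) = 0"
    using lowest_coeff_frobenius_relation[OF a(2,3)] by blast
  have "1 \<le> vabs ?x * (real q ^ (C * C * (K * q ^ s)) * B ^ (K * q ^ s + 1))"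
    using H(2) by (intro vabs_ge_of_frobenius_relation[OF a(1) i]) auto
  also have "\<dots> \<le> vabs ?x * (real q ^ (C * C * K) * B ^ (K + 1)) ^ (q ^ s)"
  proof (rule mult_left_mono[OF _ vabs_nonneg])
    have "1 \<le> q ^ s"
      using q_gt_1 by simp
    then have "B ^ (K * q ^ s + 1) \<le> (B ^ (K + 1)) ^ (q ^ s)"
      unfolding power_mult[symmetric] using B_ge_1 by (intro power_increasing) (auto simp: algebra_simps)
    then show "real q ^ (C * C * (K * q ^ s)) * B ^ (K * q ^ s + 1)
        \<le> (real q ^ (C * C * K) * B ^ (K + 1)) ^ (q ^ s)"
      by (simp add: power_mult_distrib mult.assoc mult_left_mono flip: power_mult)
  qed
  finally show ?thesis .
qed

lemma ex_twisted_relation: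
  obtains Q :: "'l \<Rightarrow> 'c poly" and c :: 'c and j m D :: nat where
    "\<And>r i. Polynomial.coeff (Q r) i \<in> R D"
    "\<And>r. poly (Q r) (fr j \<gamma>) = c * fr j (w m r)"
    "c \<noteq> 0"
    "(\<Sum>r\<in>UNIV. fps_of_poly (Q r) * ffr (j + m) (\<psi> $ r)) = 0"
proof -
  define k where "k = siegel_const (2 * CARD('l)) * (d + 3)"
  define K where "K = siegel_const (2 * CARD('l) + 1) * (q ^ CARD('l) * (k + 2))"
  define g where "g = max 1 (vabs \<gamma>)"
  obtain b where b: "1 \<le> b" "\<And>r. bounded_at (\<psi> $ r) 2 b"
    using psi_bounded[of 2] by auto
  define A1 where "A1 = g * B ^ (k + 1) * b"
  define A2 where "A2 = real q ^ (C * C * K) * B ^ (K + 1)"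
  have g1: "1 \<le> g"
    by (simp add: g_def)
  have "1 \<le> B ^ (k + 1)" "1 \<le> B ^ (K + 1)" "1 \<le> real q ^ (C * C * K)"
    using B_ge_1 q_gt_1 by (simp_all add: one_le_power del: power_Suc power_add)
  then have A2: "1 \<le> A2" and A1: "g \<le> A1"
    using g1 b(1) mult_mono[of 1 "real q ^ (C * C * K)" 1 "B ^ (K + 1)"]
      mult_mono[of "g * 1" "g * B ^ (k + 1)" 1 b] by (auto simp: A1_def A2_def)
  \<comment> \<open>The constants \<open>A1\<close> and \<open>A2\<close> are fixed before
    \<open>N'\<close>: they come from the heights per \<open>q ^ s\<close> and the bound of
    \<open>\<psi>\<close> on radius \<open>2\<close>, and not from \<open>N\<close>.\<close>
  obtain N' where N': "A1 * A2 < 2 ^ N'"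
    using real_arch_pow[of 2] by auto
  have "1 * 1 \<le> A1 * A2"
    using A1 A2 g1 by (intro mult_mono) auto
  then have N'0: "0 < N'"
    using N' by (cases N') auto
  define N where "N = 2 * CARD('l) * N'"
  define L where "L = N - N'"
  define s where "s = 2 * N"
  have N'N: "N' \<le> N"
    by (simp add: N_def)
  have LN: "L + N' = N"
    using N'N by (simp add: L_def)
  have "g * 1 \<le> A1 * A2"
    using A1 A2 g1 by (intro mult_mono) auto
  then have "g < 2 ^ N'"
    using N' by simp
  also have "(2 :: real) ^ N' \<le> 2 ^ (q ^ N)"
    using N'N less_power_q[of N] by (intro power_increasing) auto
  finally have g2: "g < 2 ^ (q ^ N)" .
  obtain Q :: "'l \<Rightarrow> 'c poly" and c where Q: "\<And>r i. Polynomial.coeff (Q r) i \<in> R (k * q ^ s)"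
    "\<And>r i. L \<le> i \<Longrightarrow> Polynomial.coeff (Q r) i = 0"
    "\<And>j r. j < N \<Longrightarrow> poly (Q r) (fr j \<gamma>) = c j * fr j (w (s - j) r)" "\<exists>r. Q r \<noteq> 0"
    using ex_auxiliary_polys[OF N_def LN N'0 s_def] unfolding k_def mult.assoc by blast
  define H where "H = (\<Sum>r\<in>UNIV. fps_of_poly (Q r) * ffr s (\<psi> $ r))"
  have sj: "j + (s - j) = s" if "j < N" for j
    using that by (simp add: s_def)
  have zeros: "vanishes H (fr j \<gamma>)" if "j < N" for j
    using auxiliary_vanishes[OF Q(3)[OF that]] sj[OF that] by (simp add: H_def)
  \<comment> \<open>Otherwise the two bounds for the lowest coefficient would combine to
    \<open>(2 ^ N') ^ (q ^ s) \<le> (A1 * A2) ^ (q ^ s)\<close>.\<close>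
  have "H = 0"
  proof (rule ccontr)
    assume H0: "H \<noteq> 0"
    let ?v = "vabs (fps_nth H (subdegree H))"
    have "?v * (2 ^ N') ^ (q ^ s) \<le> A1 ^ (q ^ s)"
      unfolding A1_def by (rule vabs_auxiliary_le[OF LN s_def Q(1,2) zeros H_def H0 b g_def g2])
    moreover have "1 \<le> ?v * A2 ^ (q ^ s)"
      unfolding A2_def K_def by (rule vabs_auxiliary_ge[OF Q(1,2) H_def H0])
    ultimately have "1 * (2 ^ N') ^ (q ^ s) \<le> ?v * A2 ^ (q ^ s) * (2 ^ N') ^ (q ^ s)"
      and le: "?v * (2 ^ N') ^ (q ^ s) * A2 ^ (q ^ s) \<le> A1 ^ (q ^ s) * A2 ^ (q ^ s)"
      using A2 by (auto intro!: mult_right_mono)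
    then have "(2 ^ N') ^ (q ^ s) \<le> ?v * (2 ^ N') ^ (q ^ s) * A2 ^ (q ^ s)"
      by (simp only: mult_1 mult_ac)
    also have "\<dots> \<le> (A1 * A2) ^ (q ^ s)"
      using le by (simp only: power_mult_distrib)
    finally have "(2 ^ N') ^ (q ^ s) \<le> (A1 * A2) ^ (q ^ s)" .
    moreover have "(A1 * A2) ^ (q ^ s) < (2 ^ N') ^ (q ^ s)"
      using N' A1 A2 g1 q_gt_1 by (intro power_strict_mono) auto
    ultimately show False
      by linarith
  qed
  obtain r where r: "Q r \<noteq> 0"
    using Q(4) by blast
  \<comment> \<open>If all multipliers were zero, \<open>Q r\<close> would vanish at
    \<open>N\<close> distinct points although its degree is at most \<open>L < N\<close>.\<close>
  have "\<exists>j<N. c j \<noteq> 0"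
  proof (rule ccontr)
    assume "\<not> ?thesis"
    then have "(\<lambda>j. fr j \<gamma>) ` {..<N} \<subseteq> {z. poly (Q r) z = 0}"
      using Q(3)[of _ r] by auto
    moreover have "inj_on (\<lambda>j. fr j \<gamma>) {..<N}"
      using gamma_distinct by (auto simp: inj_on_def) (metis linorder_neqE_nat)
    ultimately have "N \<le> card {z. poly (Q r) z = 0}"
      using card_mono[OF poly_roots_finite[OF r]] by (metis card_image card_lessThan)
    also have "\<dots> \<le> Polynomial.degree (Q r)"
      using r by (rule card_poly_roots_bound)
    also have "\<dots> \<le> L"
      using Q(2) by (intro degree_le) auto
    also have "\<dots> < N"
      using LN N'0 by simp
    finally show False
      by simp
  qed
  then obtain j where j: "j < N" "c j \<noteq> 0"
    by blast
  show ?thesis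
    using that[OF Q(1) Q(3)[OF j(1)] j(2)] \<open>H = 0\<close> sj[OF j(1)] by (simp add: H_def)
qed

end

subsection \<open>Descent of the relation\<close>

context finite_place_card
begin

lemma polys_over_Kbar:
  "0 \<in> polys_over Kbar" "1 \<in> polys_over Kbar"
  "p \<in> polys_over Kbar \<Longrightarrow> r \<in> polys_over Kbar \<Longrightarrow> p + r \<in> polys_over Kbar"
  "p \<in> polys_over Kbar \<Longrightarrow> r \<in> polys_over Kbar \<Longrightarrow> p * r \<in> polys_over Kbar"
  "p \<in> polys_over Kbar \<Longrightarrow> - p \<in> polys_over Kbar"
  "p \<in> polys_over Kbar \<Longrightarrow> pfr n p \<in> polys_over Kbar"
  by (auto simp: polys_over_def coeff_mult fr_def Polynomial.coeff_1
      intro!: Kbar_0 Kbar_1 Kbar_add Kbar_sum Kbar_mult Kbar_minus Kbar_power)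

lemma polys_over_Kbar_sum:
  "(\<And>i. i \<in> A \<Longrightarrow> f i \<in> polys_over Kbar) \<Longrightarrow> (\<Sum>i\<in>A. f i) \<in> polys_over Kbar"
  by (induction A rule: infinite_finite_induct) (auto intro: polys_over_Kbar)

lemma poly_Kbar: "p \<in> polys_over Kbar \<Longrightarrow> x \<in> Kbar \<Longrightarrow> poly p x \<in> Kbar"
  unfolding poly_altdef by (intro Kbar_sum Kbar_mult Kbar_power) (auto simp: polys_over_def)

lemma adjugate_polys_over_Kbar:
  fixes M :: "'c poly ^ 'n ^ 'n"
  assumes "\<And>i j. M $ i $ j \<in> polys_over Kbar"
  shows "adjugate M $ i $ j \<in> polys_over Kbar"
  unfolding adjugate_nth
  by (rule det_in_subring) (auto simp: axis_def transpose_def intro: polys_over_Kbar assms)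

lemma polys_over_Kbar_pfr_surj:
  assumes "p \<in> polys_over Kbar"
  shows "\<exists>r\<in>polys_over Kbar. pfr n r = p"
proof -
  have "\<forall>x. \<exists>y. x \<in> Kbar \<longrightarrow> y \<in> Kbar \<and> fr n y = x"
    using Kbar_fr_surj by blast
  then obtain h where h: "\<And>x. x \<in> Kbar \<Longrightarrow> h x \<in> Kbar \<and> fr n (h x) = x"
    by metis
  \<comment> \<open>Without this, \<open>map_poly h\<close> would not act coefficientwise beyond the
    degree.\<close>
  have "h 0 = 0"
    using h[OF Kbar_0] fr_eq_0_iff by blast
  then have "Polynomial.coeff (map_poly h p) i = h (Polynomial.coeff p i)" for i
    by (simp add: coeff_map_poly)
  then show ?thesis
    using assms h by (intro bexI[of _ "map_poly h p"] poly_eqI) (auto simp: polys_over_def)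
qed

end

context vadic_system
begin

lemma G_polys_over_Kbar: "G m $ r $ s \<in> polys_over Kbar"
  using pb_G[of m r s] R_Kbar by (auto simp: pb_def polys_over_def)

text \<open>A relation for \<open>\<psi>\<^sup>(\<^sup>j\<^sup>+\<^sup>m\<^sup>)\<close> is carried back to \<open>\<psi>\<^sup>(\<^sup>j\<^sup>)\<close> by the adjugate of the twisted
  \<open>G m\<close>, and from there to \<open>\<psi>\<close> by extracting \<open>q\<^sup>j\<close>-th roots of the coefficients.\<close>

lemma ex_relation:
  "\<exists>P :: 'c poly ^ 'l. (\<forall>r. P $ r \<in> polys_over Kbar) \<and> (\<forall>r. poly (P $ r) \<gamma> = \<rho> $ r) \<and>
    (\<Sum>r\<in>UNIV. fps_of_poly (P $ r) * \<psi> $ r) = 0"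
proof -
  obtain Q :: "'l \<Rightarrow> 'c poly" and c j m D where Q: "\<And>r i. Polynomial.coeff (Q r) i \<in> R D"
    "\<And>r. poly (Q r) (fr j \<gamma>) = c * fr j (w m r)" "c \<noteq> 0"
    "(\<Sum>r\<in>UNIV. fps_of_poly (Q r) * ffr (j + m) (\<psi> $ r)) = 0"
    by (rule ex_twisted_relation) (rule that, blast+)
  define A where "A = map_matrix (pfr j) (G m)"
  define P0 where "P0 r = (\<Sum>t\<in>UNIV. Q t * adjugate A $ t $ r)" for r
  define z where "z = fr j \<gamma>"
  have A_z: "map_matrix (\<lambda>p. poly p z) A = map_matrix (fr j) (map_matrix (\<lambda>p. poly p \<gamma>) (G m))"
    by (simp add: vec_eq_iff A_def z_def poly_pfr)
  define \<delta> where "\<delta> = det (map_matrix (\<lambda>p. poly p z) A)"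
  \<comment> \<open>Evaluating the twisted matrix at the twisted point is twisting the value, so the
    determinant is a twist of the nonzero one from \<open>det_G\<close>.\<close>
  have \<delta>: "\<delta> \<noteq> 0"
    unfolding \<delta>_def A_z by (subst det_hom) (simp_all add: fr_add fr_mult det_G)
  have "Q r \<in> polys_over Kbar" for r
    using Q(1) R_Kbar by (auto simp: polys_over_def)
  then have P0_Kbar: "P0 r \<in> polys_over Kbar" for r
    unfolding P0_def by (intro polys_over_Kbar_sum polys_over_Kbar adjugate_polys_over_Kbar)
      (auto simp: A_def intro: polys_over_Kbar G_polys_over_Kbar)
  have P0_eval: "poly (P0 r) z = c * \<delta> * fr j (\<rho> $ r)" for r
  proof -
    let ?A = "map_matrix (\<lambda>p. poly p z) A"
    have adj: "poly (adjugate A $ t $ r) z = adjugate ?A $ t $ r" for t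
      using map_matrix_adjugate[of "\<lambda>p. poly p z" A] by (simp add: vec_eq_iff)
    have fw: "fr j (w m t) = (\<Sum>k\<in>UNIV. fr j (\<rho> $ k) * ?A $ k $ t)" for t
      by (simp add: w_def A_def z_def fr_sum fr_mult poly_pfr)
    have "poly (P0 r) z = c * (\<Sum>t\<in>UNIV. fr j (w m t) * adjugate ?A $ t $ r)"
      using Q(2) by (simp add: P0_def poly_sum adj sum_distrib_left mult.assoc flip: z_def)
    also have "(\<Sum>t\<in>UNIV. fr j (w m t) * adjugate ?A $ t $ r) =
        (\<Sum>k\<in>UNIV. fr j (\<rho> $ k) * (\<Sum>t\<in>UNIV. ?A $ k $ t * adjugate ?A $ t $ r))"
      unfolding fw by (rule sum_mult_sum[symmetric])
    also have "\<dots> = fr j (\<rho> $ r) * \<delta>"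
      using \<delta> unfolding \<delta>_def by (subst matrix_mult_adjugate) (simp_all add: if_distrib cong: if_cong)
    finally show ?thesis
      by (simp add: mult_ac)
  qed
  have P0_A: "(\<Sum>r\<in>UNIV. P0 r * A $ r $ t) = Q t * det A" for t
  proof -
    have "(\<Sum>r\<in>UNIV. P0 r * A $ r $ t) = (\<Sum>k\<in>UNIV. Q k * (\<Sum>r\<in>UNIV. adjugate A $ k $ r * A $ r $ t))"
      unfolding P0_def by (rule sum_mult_sum[symmetric])
    then show ?thesis
      by (simp add: adjugate_mult if_distrib cong: if_cong)
  qed
  have "(\<Sum>r\<in>UNIV. fps_of_poly (P0 r) * ffr j (\<psi> $ r)) =
      (\<Sum>r\<in>UNIV. fps_of_poly (P0 r) * (\<Sum>t\<in>UNIV. fps_of_poly (A $ r $ t) * ffr (j + m) (\<psi> $ t)))"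
    by (subst ffr_psi_G[of j _ m]) (simp add: A_def)
  also have "\<dots> = (\<Sum>t\<in>UNIV. fps_of_poly (\<Sum>r\<in>UNIV. P0 r * A $ r $ t) * ffr (j + m) (\<psi> $ t))"
    by (simp only: sum_mult_sum fps_of_poly_sum fps_of_poly_mult)
  also have "\<dots> = (\<Sum>t\<in>UNIV. fps_of_poly (Q t * det A) * ffr (j + m) (\<psi> $ t))"
    by (simp only: P0_A)
  also have "\<dots> =
      fps_of_poly (det A) * (\<Sum>t\<in>UNIV. fps_of_poly (Q t) * ffr (j + m) (\<psi> $ t))"
    by (simp add: sum_distrib_left fps_of_poly_mult mult_ac)
  finally have P0_psi: "(\<Sum>r\<in>UNIV. fps_of_poly (P0 r) * ffr j (\<psi> $ r)) = 0"
    using Q(4) by simp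
  have "\<forall>r. \<exists>p. p \<in> polys_over Kbar \<and> pfr j p = P0 r"
    using polys_over_Kbar_pfr_surj P0_Kbar by blast
  then obtain P1 where P1: "\<And>r. P1 r \<in> polys_over Kbar" "\<And>r. pfr j (P1 r) = P0 r"
    by metis
  have "ffr j (\<Sum>r\<in>UNIV. fps_of_poly (P1 r) * \<psi> $ r) = 0"
    using P0_psi by (simp add: ffr_sum ffr_mult P1(2) flip: fps_of_poly_pfr)
  then have P1_psi: "(\<Sum>r\<in>UNIV. fps_of_poly (P1 r) * \<psi> $ r) = 0"
    by simp
  obtain r0 where r0: "\<rho> $ r0 \<noteq> 0"
    using rho_nz by (auto simp: vec_eq_iff)
  have Kbar_1: "\<gamma> \<in> Kbar" "\<rho> $ r0 \<in> Kbar"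
    using gamma_R rho_R R_Kbar by blast+
  \<comment> \<open>The factor to be divided out is the \<open>q ^ j\<close>-th root of
    \<open>c * \<delta>\<close>. Since \<open>c\<close> is only known as an element of
    \<open>'c\<close>, the root is produced as a quotient of values, which visibly lies in
    \<open>Kbar\<close>.\<close>
  define e where "e = poly (P1 r0) \<gamma> * inverse (\<rho> $ r0)"
  have P1_eval: "fr j (poly (P1 r) \<gamma>) = c * \<delta> * fr j (\<rho> $ r)" for r
    using P0_eval[of r] poly_pfr[of j "P1 r" \<gamma>] by (simp add: P1(2) z_def)
  have "e * \<rho> $ r0 = poly (P1 r0) \<gamma>"
    using r0 by (simp add: e_def)
  then have "fr j e * fr j (\<rho> $ r0) = c * \<delta> * fr j (\<rho> $ r0)"
    by (metis P1_eval fr_mult)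
  then have e: "fr j e = c * \<delta>"
    using r0 by simp
  then have e0: "e \<noteq> 0"
    using \<delta> Q(3) by auto
  have eval: "poly (P1 r) \<gamma> = e * \<rho> $ r" for r
    using P1_eval[of r] by (metis e fr_eq_iff fr_mult)
  have eK: "inverse e \<in> Kbar"
    unfolding e_def by (intro Kbar_inverse Kbar_mult poly_Kbar P1(1) Kbar_1)
  show ?thesis
  proof (intro exI[of _ "\<chi> r. Polynomial.smult (inverse e) (P1 r)"] conjI allI)
    fix r
    show "(\<chi> r. Polynomial.smult (inverse e) (P1 r)) $ r \<in> polys_over Kbar"
      using P1(1)[of r] eK by (auto simp: polys_over_def intro: Kbar_mult)
    show "poly ((\<chi> r. Polynomial.smult (inverse e) (P1 r)) $ r) \<gamma> = \<rho> $ r"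
      using e0 by (simp add: eval)
  next
    have "(\<Sum>r\<in>UNIV. fps_of_poly ((\<chi> r. Polynomial.smult (inverse e) (P1 r)) $ r) * \<psi> $ r) =
        fps_const (inverse e) * (\<Sum>r\<in>UNIV. fps_of_poly (P1 r) * \<psi> $ r)"
      by (simp add: fps_of_poly_smult sum_distrib_left mult.assoc)
    then show "(\<Sum>r\<in>UNIV. fps_of_poly ((\<chi> r. Polynomial.smult (inverse e) (P1 r)) $ r) * \<psi> $ r) = 0"
      by (simp add: P1_psi)
  qed
qed

end

section \<open>Reduction of the theorem to the twisted system\<close>

context finite_place_card
begin

text \<open>The \<open>THE\<close> in \<open>frob\<close> is meaningful here: a root exists in
  \<open>Kbar\<close>, and it is unique because \<open>fr n\<close> is injective.\<close>

lemma fr_frob_minus: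
  assumes "x \<in> Kbar" "0 < n"
  shows "fr n (frob q (- int n) x) = x"
proof -
  obtain y where y: "fr n y = x"
    using Kbar_fr_surj[OF assms(1)] by blast
  have "(THE y. fr n y = x) = y"
    using y by (intro the_equality) auto
  then show ?thesis
    using y assms(2) by (simp add: frob_def fr_def)
qed

end

theorem theorem2p2p2:
  fixes \<pi> :: "'a :: {field, finite} poly"
    and \<iota> :: "'a poly fract \<Rightarrow> 'c :: {field, complete_space}"
    and Kvbar Kbar :: "'c set"
    and \<Phi> :: "'c poly ^ 'l ^ 'l"
    and \<psi> :: "'c fps ^ 'l"
    and \<gamma> :: 'c
  assumes "finite_place \<pi> \<iota> Kvbar Kbar"
    and "\<forall>r s. \<Phi> $ r $ s \<in> polys_over Kbar"
    and "\<forall>r. \<psi> $ r \<in> entire_series \<iota> Kbar"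
    and "vec_twist CARD('a) (-1) \<psi> = map_matrix fps_of_poly \<Phi> *v \<psi>"
    and "\<gamma> \<in> (Kbar - {0}) - (const_closure \<iota> Kbar - {0})"
    and "\<forall>i::int. i > 0 \<longrightarrow>
           det (map_matrix (\<lambda>p. poly p (frob CARD('a) (- i) \<gamma>)) \<Phi>) \<noteq> 0"
  shows "\<forall>\<rho> :: 'c ^ 'l.
           (\<forall>r. \<rho> $ r \<in> Kbar) \<and> (\<Sum>r\<in>UNIV. \<rho> $ r * series_eval (\<psi> $ r) \<gamma>) = 0 \<longrightarrow>
           (\<exists>P :: 'c poly ^ 'l.
              (\<forall>r. P $ r \<in> polys_over Kbar) \<and>
              (\<forall>r. poly (P $ r) \<gamma> = \<rho> $ r) \<and>
              (\<Sum>r\<in>UNIV. fps_of_poly (P $ r) * \<psi> $ r) = 0)"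
proof (intro allI impI, elim conjE)
  fix \<rho> :: "'c ^ 'l"
  assume \<rho>: "\<forall>r. \<rho> $ r \<in> Kbar" "(\<Sum>r\<in>UNIV. \<rho> $ r * series_eval (\<psi> $ r) \<gamma>) = 0"
  interpret finite_place_card \<pi> \<iota> Kvbar Kbar "CARD('a)"
    using assms(1) by (simp add: finite_place_card_def finite_place_card_axioms_def)
  have \<gamma>: "\<gamma> \<in> Kbar" "\<gamma> \<noteq> 0" "\<gamma> \<notin> const_closure \<iota> Kbar"
    using assms(5) by auto
  show "\<exists>P :: 'c poly ^ 'l. (\<forall>r. P $ r \<in> polys_over Kbar) \<and> (\<forall>r. poly (P $ r) \<gamma> = \<rho> $ r) \<and>
      (\<Sum>r\<in>UNIV. fps_of_poly (P $ r) * \<psi> $ r) = 0"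
  \<comment> \<open>The zero row is lifted by \<open>P = 0\<close>; the system demands a nonzero
    \<open>\<rho>\<close> in order to have nonzero rows \<open>w\<close>.\<close>
  proof (cases "\<rho> = 0")
    case True
    then show ?thesis
      by (intro exI[of _ 0]) (simp add: polys_over_def Kbar_0)
  next
    case False
    define d where "d = Max (range (\<lambda>(r, s). Polynomial.degree (\<Phi> $ r $ s)))"
    have d: "Polynomial.degree (\<Phi> $ r $ s) \<le> d" for r s
      unfolding d_def by (rule Max_ge) (auto intro: range_eqI[of _ _ "(r, s)"])
    \<comment> \<open>Only finitely many algebraic numbers enter the system:
      \<open>\<gamma>\<close>, the entries of \<open>\<rho>\<close> and the coefficients of
      \<open>\<Phi>\<close>. The coefficients of \<open>\<psi>\<close> are not placed in the
      filtration and are controlled by Gauss norms alone.\<close>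
    define S where "S = insert \<gamma> (range (($) \<rho>) \<union>
      (\<lambda>(r, s, i). Polynomial.coeff (\<Phi> $ r $ s) i) ` (UNIV \<times> UNIV \<times> {..d}))"
    have "finite S"
      by (simp add: S_def)
    moreover have "S \<subseteq> Kbar"
      using \<gamma>(1) \<rho>(1) assms(2) by (auto simp: S_def polys_over_def)
    ultimately have "\<exists>R C B. filtered \<pi> \<iota> Kvbar Kbar CARD('a) R C B \<and> S \<subseteq> R 1 \<and> (\<forall>n. R n \<subseteq> Kbar)"
      by (rule ex_filtered)
    then obtain R C B where
      "filtered \<pi> \<iota> Kvbar Kbar CARD('a) R C B \<and> S \<subseteq> R 1 \<and> (\<forall>n. R n \<subseteq> Kbar)"
      by (elim exE)
    then have F: "filtered \<pi> \<iota> Kvbar Kbar CARD('a) R C B" "S \<subseteq> R 1" "\<And>n. R n \<subseteq> Kbar"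
      by simp_all
    interpret filtered \<pi> \<iota> Kvbar Kbar "CARD('a)" R C B
      by (rule F(1))
    have bdd: "\<exists>b\<ge>1. \<forall>r. bounded_at (\<psi> $ r) T b" if T: "0 < T" for T
    proof -
      have "\<forall>r. \<exists>b\<ge>1. bounded_at (\<psi> $ r) T b"
        using entire_series_bounded_at[OF _ T] assms(3) by blast
      then obtain b where b: "\<And>r. 1 \<le> b r" "\<And>r. bounded_at (\<psi> $ r) T (b r)"
        by metis
      have le: "b r \<le> Max (range b)" for r
        by (rule Max_ge) auto
      have "bounded_at (\<psi> $ r) T (Max (range b))" for r
        using b(2)[of r] le[of r] unfolding bounded_at_def by (meson order_trans)
      moreover have "1 \<le> Max (range b)"
        using b(1) le order_trans by blast
      ultimately show ?thesis
        by blast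
    qed
    have coeff: "Polynomial.coeff (\<Phi> $ r $ s) i \<in> R 1" for r s i
    proof (cases "i \<le> d")
      case True
      then have "Polynomial.coeff (\<Phi> $ r $ s) i \<in> S"
        unfolding S_def by (intro insertI2 UnI2 image_eqI[of _ _ "(r, s, i)"]) auto
      then show ?thesis
        using F(2) by blast
    next
      case False
      then show ?thesis
        using d[of r s] R_0 by (simp add: coeff_eq_0)
    qed
    have psi_eq: "\<psi> $ r = ffr 1 (\<Sum>s\<in>UNIV. fps_of_poly (\<Phi> $ r $ s) * \<psi> $ s)" for r
    proof -
      have "(\<Sum>s\<in>UNIV. fps_of_poly (\<Phi> $ r $ s) * \<psi> $ s) = twist CARD('a) (-1) (\<psi> $ r)"
        using arg_cong[OF assms(4), of "\<lambda>v. v $ r"]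
        by (simp add: vec_twist_def matrix_vector_mult_def)
      moreover have "ffr 1 (twist CARD('a) (-1) (\<psi> $ r)) = \<psi> $ r"
        using fr_frob_minus[of _ 1] assms(3)
        by (intro fps_ext) (simp add: twist_def entire_series_def)
      ultimately show ?thesis
        by simp
    qed
    \<comment> \<open>Twisting \<open>i\<close> times turns the value of \<open>\<Phi>\<close> at
      the \<open>q ^ i\<close>-th root of \<open>\<gamma>\<close> into the value of the twisted
      matrix at \<open>\<gamma>\<close>, and twisting is injective.\<close>
    have det: "det (map_matrix (\<lambda>p. poly (pfr i p) \<gamma>) \<Phi>) \<noteq> 0" if i: "0 < i" for i
    proof -
      define \<gamma>' where "\<gamma>' = frob CARD('a) (- int i) \<gamma>"
      have \<gamma>': "fr i \<gamma>' = \<gamma>"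
        unfolding \<gamma>'_def by (rule fr_frob_minus[OF \<gamma>(1) i])
      have "det (map_matrix (fr i) (map_matrix (\<lambda>p. poly p \<gamma>') \<Phi>)) = fr i (det (map_matrix (\<lambda>p. poly p \<gamma>') \<Phi>))"
        by (rule det_hom) (simp_all add: fr_add fr_mult)
      moreover have "map_matrix (\<lambda>p. poly (pfr i p) \<gamma>) \<Phi> = map_matrix (fr i) (map_matrix (\<lambda>p. poly p \<gamma>') \<Phi>)"
        by (simp add: vec_eq_iff \<gamma>' flip: poly_pfr)
      ultimately show ?thesis
        using assms(6)[rule_format, of "int i"] i by (simp add: \<gamma>'_def)
    qed
    obtain b where b: "\<forall>r. bounded_at (\<psi> $ r) (1 + vabs \<gamma>) b"
      using bdd[of "1 + vabs \<gamma>"] vabs_nonneg[of \<gamma>] by auto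
    have vanish: "vanishes (\<Sum>r\<in>UNIV. fps_const (\<rho> $ r) * \<psi> $ r) \<gamma>"
      using \<rho>(2) b by (intro vanishes_iff_series_eval[where T = "1 + vabs \<gamma>" and B = "\<lambda>_. b"]) auto
    have SR: "\<gamma> \<in> R 1" "\<rho> $ r \<in> R 1" for r
      using F(2) by (auto simp: S_def)
    interpret vadic_system \<pi> \<iota> Kvbar Kbar "CARD('a)" R C B \<Phi> \<psi> \<gamma> \<rho> d
      by (intro vadic_system.intro filtered_axioms vadic_system_axioms.intro)
        (fact coeff d SR bdd psi_eq \<gamma> fr_neq_if_not_const[OF \<gamma>(1,3)] det vanish False F(3))+
    show ?thesis
      by (rule ex_relation)
  qed
qed

end
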